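(* Let $\mathcal X,\mathcal Y$ be countable sets, $\lambda>0$, and let $c\colon\mathcal X\times\mathcal Y\to\mathbb R$ be a cost function admitting two (possibly identical) collections of dominating functions $c_{\mathcal X}^-,c_{\mathcal X}^+,c_{\mathcal Y}^-,c_{\mathcal Y}^+$ and $\tilde c_{\mathcal X}^-,\tilde c_{\mathcal X}^+,\tilde c_{\mathcal Y}^-,\tilde c_{\mathcal Y}^+$. Let $\mathcal C_{\mathcal X},\mathcal C_{\mathcal Y},\phi_{\mathcal Y}$ be the weights of the first collection and $\tilde{\mathcal C}_{\mathcal X},\tilde{\mathcal C}_{\mathcal Y},\tilde\phi_{\mathcal X}$ those of the second. Let $r\in\mathcal P(\mathcal X)$, $s\in\mathcal P(\mathcal Y)$. (i) (One sample from $r$) Let $\hat r_n=\frac1n\sum_{i=1}^n\delta_{X_i}$ with $X_1,\dots,X_n$ i.i.d. with law $r$, and assume $$\sum_{x\in\mathcal X}\Big(\mathcal C_{\mathcal X}(x)\sqrt{r_x}+\big(\tilde{\mathcal C}_{\mathcal X}^2+\tilde\phi_{\mathcal X}^2\big)(x)\,r_x\Big)<\infty,\qquad \sum_{y\in\mathcal Y}\big(\mathcal C_{\mathcal Y}+\tilde{\mathcal C}_{\mathcal Y}+\phi_{\mathcal Y}\big)(y)\,s_y<\infty .$$ Then, as $n\to\infty$, $$\sqrt n\,\big(EROT^\lambda(\hat r_n,s)-EROT^\lambda(r,s)\big)\xrightarrow{\ \mathcal D\ }\mathcal N\big(0,\sigma_\lambda^2(r|s)\big),$$ where $\sigma^2_\lambda(r|s)=\mathrm{Var}_{X\sim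 r}[\alpha^\lambda_X]$ and $(\alpha^\lambda,\beta^\lambda)\in\ell^1_r(\mathcal X)\times\ell^1_s(\mathcal Y)$ are EROT potentials for $(r,s)$ with cost $c$. (ii) (Two samples) Additionally let $\hat s_m=\frac1m\sum_{i=1}^m\delta_{Y_i}$ with $Y_1,\dots,Y_m$ i.i.d. with law $s$, independent of $X_1,\dots,X_n$, and assume $$\sum_{x\in\mathcal X}\Big(\mathcal C_{\mathcal X}(x)\sqrt{r_x}+\big(\tilde{\mathcal C}_{\mathcal X}^2+\tilde\phi_{\mathcal X}^2\big)(x)\,r_x\Big)<\infty,\qquad \sum_{y\in\mathcal Y}\Big(\tilde{\mathcal C}_{\mathcal Y}(y)\sqrt{s_y}+\big(\mathcal C_{\mathcal Y}^2+\phi_{\mathcal Y}^2\big)(y)\,s_y\Big)<\infty .$$ Then, for $\min(m,n)\to\infty$ with $\frac{m}{m+n}\to\delta\in(0,1)$, $$\sqrt{\tfrac{nm}{n+m}}\,\big(EROT^\lambda(\hat r_n,\hat s_m)-EROT^\lambda(r,s)\big)\xrightarrow{\ \mathcal D\ }\mathcal N\big(0,\delta\sigma_\lambda^2(r|s)+(1-\delta)\sigma_\lambda^2(s|r)\big),$$ where $\sigma_\lambda^2(r|s)=\mathrm{Var}_{X\sim r}[\alpha^\lambda_X]$ and $\sigma_\lambda^2(s|r)=\mathrm{Var}_{Y\sim s}[\beta^\lambda_Y]$ for a pair $(\alpha^\lambda,\beta^\lambda)\in\ell^1_r(\mathcal X)\times\ell^1_s(\mathcal Y)$ of EROT potentials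 for $(r,s)$ with cost $c$.
   Context: $\mathcal P(\mathcal X)$ denotes the probability measures on the countable set $\mathcal X$, written $r=(r_x)_{x\in\mathcal X}$; likewise $\mathcal P(\mathcal Y)$. $\ell^1_r(\mathcal X)$ is the space of functions on $\mathcal X$ with finite expectation under $r$; $\langle f,r\rangle=\sum_xf(x)r_x$. Entropy regularized optimal transport (EROT): $\Pi(r,s)$ is the set of couplings of $r,s$; $M(\pi)=\sum_{x,y}\pi_{xy}\log\big(\pi_{xy}/(r_xs_y)\big)\in[0,\infty]$ for $\pi\in\Pi(r,s)$ (with $0\log0=0$); $EROT^\lambda(r,s)=\inf_{\pi\in\Pi(r,s)}\langle c,\pi\rangle+\lambda M(\pi)$. The dual problem is $$\sup_{\alpha\in\ell^1_r(\mathcal X),\ \beta\in\ell^1_s(\mathcal Y)}\langle\alpha,r\rangle+\langle\beta,s\rangle-\lambda\sum_{x,y}\Big[\exp\Big(\tfrac{\alpha_x+\beta_y-c(x,y)}\lambda\Big)r_xs_y-r_xs_y\Big],$$ and its maximizers $(\alpha^\lambda,\beta^\lambda)$ are called EROT potentials; if $c$ is $r\otimes s$-integrable they exist and are unique on $\mathrm{supp}(r)\times\mathrm{supp}(s)$ up to replacing $(\alpha,\beta)$ by $(\alpha+\eta,\beta-\eta)$, $\eta\in\mathbb R$. Dominating functions for $c$: functions $c_{\mathcal X}^-\le c_{\mathcal X}^+$ on $\mathcal X$ and $c_{\mathcal Y}^-\le c_{\mathcal Y}^+$ on $\mathcal Y$ (real-valued) with $c_{\mathcal X}^-(x)+c_{\mathcal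 Y}^-(y)\le c(x,y)\le c_{\mathcal X}^+(x)+c_{\mathcal Y}^+(y)$ for all $(x,y)$. Their weights are $\mathcal C_{\mathcal X}=1+|c_{\mathcal X}^+|+|c_{\mathcal X}^-|$, $\mathcal C_{\mathcal Y}=1+|c_{\mathcal Y}^+|+|c_{\mathcal Y}^-|$, $\phi_{\mathcal X}=\exp\big((c_{\mathcal X}^+-c_{\mathcal X}^-)/\lambda\big)$, $\phi_{\mathcal Y}=\exp\big((c_{\mathcal Y}^+-c_{\mathcal Y}^-)/\lambda\big)$; the weights of the second collection are defined by the same formulas and carry a tilde. $\xrightarrow{\mathcal D}$ is weak convergence. *)

theory Defs
  imports "HOL-Probability.Probability"
begin

text \<open>
  Sum of an arbitrary real family with values in the extended reals: sum of the positive parts minus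
  sum of the negative parts (\<open>ennreal\<close> maps negative reals to 0). An undefined
  \<open>\<infinity> - \<infinity>\<close> evaluates to \<open>\<infinity>\<close>.
\<close>
definition ext_sum :: "('a \<Rightarrow> real) \<Rightarrow> ereal" where
  "ext_sum f = enn2ereal (\<integral>\<^sup>+a. ennreal (f a) \<partial>count_space UNIV)
             - enn2ereal (\<integral>\<^sup>+a. ennreal (- f a) \<partial>count_space UNIV)"

definition couplings :: "'x pmf \<Rightarrow> 'y pmf \<Rightarrow> ('x \<times> 'y) pmf set" where
  "couplings r s = {\<pi>. map_pmf fst \<pi> = r \<and> map_pmf snd \<pi> = s}"

definition transport_cost :: "('x \<Rightarrow> 'y \<Rightarrow> real) \<Rightarrow> ('x \<times> 'y) pmf \<Rightarrow> ereal" where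
  "transport_cost c \<pi> = ext_sum (\<lambda>(x, y). c x y * pmf \<pi> (x, y))"

text \<open>
  For a coupling the negative parts below are always summable, so the value lies in
  \<open>[0, \<infinity>]\<close>; the convention \<open>0 log 0 = 0\<close> holds because of the leading factor.
\<close>
definition coupling_entropy :: "'x pmf \<Rightarrow> 'y pmf \<Rightarrow> ('x \<times> 'y) pmf \<Rightarrow> ereal" where
  "coupling_entropy r s \<pi> =
     ext_sum (\<lambda>(x, y). pmf \<pi> (x, y) * ln (pmf \<pi> (x, y) / (pmf r x * pmf s y)))"

definition EROT :: "real \<Rightarrow> ('x \<Rightarrow> 'y \<Rightarrow> real) \<Rightarrow> 'x pmf \<Rightarrow> 'y pmf \<Rightarrow> ereal" where
  "EROT lam c r s =
     (INF \<pi>\<in>couplings r s. transport_cost c \<pi> + ereal lam * coupling_entropy r s \<pi>)"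

definition l1_space :: "'a pmf \<Rightarrow> ('a \<Rightarrow> real) set" where
  "l1_space p = {f. integrable (measure_pmf p) f}"

text \<open>
  The negative parts of the exponential sum are dominated by the product of the two laws, hence
  summable; where that sum diverges the objective is \<open>-\<infinity>\<close>.
\<close>
definition EROT_dual ::
  "real \<Rightarrow> ('x \<Rightarrow> 'y \<Rightarrow> real) \<Rightarrow> 'x pmf \<Rightarrow> 'y pmf \<Rightarrow> ('x \<Rightarrow> real) \<Rightarrow> ('y \<Rightarrow> real) \<Rightarrow> ereal" where
  "EROT_dual lam c r s \<alpha> \<beta> =
     ereal (measure_pmf.expectation r \<alpha> + measure_pmf.expectation s \<beta>)
     - ereal lam * ext_sum (\<lambda>(x, y).
         exp ((\<alpha> x + \<beta> y - c x y) / lam) * (pmf r x * pmf s y) - pmf r x * pmf s y)"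

definition EROT_potentials ::
  "real \<Rightarrow> ('x \<Rightarrow> 'y \<Rightarrow> real) \<Rightarrow> 'x pmf \<Rightarrow> 'y pmf \<Rightarrow> ('x \<Rightarrow> real) \<Rightarrow> ('y \<Rightarrow> real) \<Rightarrow> bool" where
  "EROT_potentials lam c r s \<alpha> \<beta> \<longleftrightarrow>
     \<alpha> \<in> l1_space r \<and> \<beta> \<in> l1_space s \<and>
     (\<forall>\<alpha>'\<in>l1_space r. \<forall>\<beta>'\<in>l1_space s.
        EROT_dual lam c r s \<alpha>' \<beta>' \<le> EROT_dual lam c r s \<alpha> \<beta>)"

definition dominating ::
  "('x \<Rightarrow> 'y \<Rightarrow> real) \<Rightarrow> ('x \<Rightarrow> real) \<Rightarrow> ('x \<Rightarrow> real) \<Rightarrow> ('y \<Rightarrow> real) \<Rightarrow> ('y \<Rightarrow> real) \<Rightarrow> bool" where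
  "dominating c cX_lo cX_hi cY_lo cY_hi \<longleftrightarrow>
     (\<forall>x. cX_lo x \<le> cX_hi x) \<and> (\<forall>y. cY_lo y \<le> cY_hi y) \<and>
     (\<forall>x y. cX_lo x + cY_lo y \<le> c x y \<and> c x y \<le> cX_hi x + cY_hi y)"

definition weight_C :: "('a \<Rightarrow> real) \<Rightarrow> ('a \<Rightarrow> real) \<Rightarrow> 'a \<Rightarrow> real" where
  "weight_C lo hi a = 1 + \<bar>hi a\<bar> + \<bar>lo a\<bar>"

definition weight_phi :: "real \<Rightarrow> ('a \<Rightarrow> real) \<Rightarrow> ('a \<Rightarrow> real) \<Rightarrow> 'a \<Rightarrow> real" where
  "weight_phi lam lo hi a = exp ((hi a - lo a) / lam)"

text \<open>
  The sample is indexed from 0, so the first \<open>n\<close> observations are \<open>X 0, \<dots>, X (n - 1)\<close>. The value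
  for \<open>n = 0\<close> is unspecified.
\<close>
definition iid_sample :: "'w measure \<Rightarrow> 'a pmf \<Rightarrow> (nat \<Rightarrow> 'w \<Rightarrow> 'a) \<Rightarrow> bool" where
  "iid_sample M p X \<longleftrightarrow>
     prob_space.indep_vars M (\<lambda>_. count_space UNIV) X UNIV \<and>
     (\<forall>i. distr M (count_space UNIV) (X i) = measure_pmf p)"

definition empirical :: "(nat \<Rightarrow> 'w \<Rightarrow> 'a) \<Rightarrow> nat \<Rightarrow> 'w \<Rightarrow> 'a pmf" where
  "empirical X n w = map_pmf (\<lambda>i. X i w) (pmf_of_set {..<n})"

text \<open>
  Independence of the sigma-algebras generated by the two sequences; the library constant
  \<open>indep_var\<close> needs both variables to have the same type.
\<close>
definition indep_samples ::
  "'w measure \<Rightarrow> (nat \<Rightarrow> 'w \<Rightarrow> 'a) \<Rightarrow> (nat \<Rightarrow> 'w \<Rightarrow> 'b) \<Rightarrow> bool" where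
  "indep_samples M X Y \<longleftrightarrow>
     prob_space.indep_set M
       (sets (vimage_algebra (space M) (\<lambda>w i. X i w) (\<Pi>\<^sub>M i\<in>UNIV. count_space UNIV)))
       (sets (vimage_algebra (space M) (\<lambda>w i. Y i w) (\<Pi>\<^sub>M i\<in>UNIV. count_space UNIV)))"

text \<open>
  The normal law with variance \<open>v \<ge> 0\<close>, as an affine image of the standard normal law. For
  \<open>v = 0\<close> it is the point mass at \<open>\<mu>\<close>, which the library's \<open>normal_density\<close> does not cover.
\<close>
definition normal_law :: "real \<Rightarrow> real \<Rightarrow> real measure" where
  "normal_law \<mu> v = distr std_normal_distribution borel (\<lambda>z. \<mu> + sqrt v * z)"

end

theory Submission
  imports Defs
begin

text \<open>
  Let \<open>F (r, s)\<close> be the optimal value. A solution \<open>(\<alpha>, \<beta>)\<close> of the Schroedinger system for \<open>(r, s)\<close>,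
  extended to all of \<open>X \<times> Y\<close>, gives \<open>F (r, s) = \<langle>\<alpha>, r\<rangle> + \<langle>\<beta>, s\<rangle>\<close>, and for every \<open>r'\<close> the pair is still
  feasible with exponential mass one for \<open>(r', s)\<close>, because only the integral over \<open>s\<close> enters. Weak duality used in
  both directions therefore sandwiches the increment without any error term,
  \<open>\<langle>\<alpha>, r' - r\<rangle> \<le> F (r', s) - F (r, s) \<le> \<langle>\<alpha>', r' - r\<rangle>\<close> with \<open>\<alpha>'\<close> a potential for \<open>(r', s)\<close>. The two sides differ
  by \<open>\<langle>\<alpha>' - \<alpha>, r' - r\<rangle>\<close>. Uniform bounds on potentials, compactness and uniqueness show that \<open>\<alpha>' - \<alpha>\<close> is
  pointwise small and dominated by the weight \<open>C_X\<close> when \<open>r'\<close> is close to \<open>r\<close> in weighted \<open>l1\<close>; since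
  \<open>E \<bar>r_n x - r x\<bar> \<le> sqrt (r x / n)\<close> for the empirical measure \<open>r_n\<close>, summability of \<open>C_X sqrt r\<close> makes this
  difference negligible at scale \<open>1 / sqrt n\<close>, and the central limit theorem for \<open>\<langle>\<alpha>, r_n - r\<rangle>\<close> remains. With two
  samples the same sandwich is applied to \<open>F (r_n, s_m) - F (r_n, s)\<close>, with \<open>\<beta>\<close> in place of \<open>\<alpha>\<close>.
\<close>

section \<open>Weighted total variation distance\<close>

text \<open>Two obstacles shape the development. An empirical law may charge only part of the
  support of \<open>r\<close>, while the sandwich integrates its potential against \<open>r\<close>
  itself. Hence the Schroedinger equations are demanded at every point, and dual maximisers are
  first extended off the supports by the equations themselves. Moreover, in the second increment the
  base \<open>(r_n, s)\<close> moves, while the linear term must keep the fixed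
  \<open>\<beta>\<close>; so the potentials of both \<open>(r_n, s)\<close> and
  \<open>(r_n, s_m)\<close> are compared with \<open>\<beta>\<close>. Two collections of dominating
  functions occur because a two-sided bound on \<open>\<alpha>\<close> costs an exponential moment
  on \<open>Y\<close>, and one on \<open>\<beta>\<close> costs an exponential moment on
  \<open>X\<close>; the first collection pays for \<open>\<alpha>\<close>, the second for
  \<open>\<beta>\<close>. Summability of \<open>C_X sqrt r\<close> has a second use: a summable
  nonnegative function is square summable, which gives the potential the second moment required by
  the central limit theorem. All analytic estimates hold on deterministic weighted \<open>l1\<close>
  balls, and randomness is inserted at the end.\<close>

abbreviation pmf_mean :: "'a pmf \<Rightarrow> ('a \<Rightarrow> real) \<Rightarrow> real" where
  "pmf_mean p f \<equiv> measure_pmf.expectation p f"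

abbreviation pmf_var :: "'a pmf \<Rightarrow> ('a \<Rightarrow> real) \<Rightarrow> real" where
  "pmf_var p f \<equiv> measure_pmf.variance p f"

abbreviation pmf_integrable :: "'a pmf \<Rightarrow> ('a \<Rightarrow> real) \<Rightarrow> bool" where
  "pmf_integrable p f \<equiv> integrable (measure_pmf p) f"

lemma integrable_measure_pmf_iff:
  fixes f :: "'a \<Rightarrow> real"
  shows "pmf_integrable p f \<longleftrightarrow> integrable (count_space UNIV) (\<lambda>x. pmf p x * f x)"
  by (simp add: measure_pmf_eq_density integrable_density)

lemma integral_measure_pmf_count_space:
  fixes f :: "'a \<Rightarrow> real"
  shows "pmf_mean p f = (\<integral>x. pmf p x * f x \<partial>count_space UNIV)"
  by (simp add: measure_pmf_eq_density integral_density)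

lemma integrable_measure_pmf_bound:
  fixes f w :: "'a \<Rightarrow> real"
  assumes "pmf_integrable p w" "\<And>x. \<bar>f x\<bar> \<le> w x"
  shows "pmf_integrable p f"
  using assms(2) by (intro Bochner_Integration.integrable_bound[OF assms(1)] AE_I2) (force, smt (verit) real_norm_def)

text \<open>Valued in \<open>ennreal\<close>, so that closeness to \<open>q\<close> can be assumed
  of a law \<open>p\<close> for which \<open>w\<close> is not yet known to be integrable; a finite
  distance then transfers integrability from \<open>q\<close> to \<open>p\<close>.\<close>

definition wdist :: "('a \<Rightarrow> real) \<Rightarrow> 'a pmf \<Rightarrow> 'a pmf \<Rightarrow> ennreal" where
  "wdist w p q = (\<integral>\<^sup>+x. ennreal (w x * \<bar>pmf p x - pmf q x\<bar>) \<partial>count_space UNIV)"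

lemma wdist_cmult: "0 \<le> K \<Longrightarrow> wdist (\<lambda>x. K * w x) p q = ennreal K * wdist w p q"
  unfolding wdist_def by (simp add: ennreal_mult' mult.assoc nn_integral_cmult)

lemma wdist_self: "wdist w p p = 0"
  by (simp add: wdist_def)

lemma integrable_of_wdist_finite:
  assumes w: "\<And>x. 0 \<le> w x" and q: "pmf_integrable q w" and fin: "wdist w p q < \<top>"
  shows "pmf_integrable p w"
proof (rule integrableI_bounded)
  have "(\<integral>\<^sup>+x. ennreal (norm (w x)) \<partial>measure_pmf p)
      = (\<integral>\<^sup>+x. ennreal (pmf p x * w x) \<partial>count_space UNIV)"
    using w by (simp add: nn_integral_measure_pmf ennreal_mult')
  also have "\<dots> \<le> (\<integral>\<^sup>+x. ennreal (pmf q x * w x) + ennreal (w x * \<bar>pmf p x - pmf q x\<bar>) \<partial>count_space UNIV)"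
  proof (intro nn_integral_mono)
    fix x
    have "pmf p x * w x \<le> pmf q x * w x + w x * \<bar>pmf p x - pmf q x\<bar>"
      using mult_left_mono[OF abs_ge_self[of "pmf p x - pmf q x"] w[of x]] by (simp add: algebra_simps)
    then show "ennreal (pmf p x * w x) \<le> ennreal (pmf q x * w x) + ennreal (w x * \<bar>pmf p x - pmf q x\<bar>)"
      using w[of x] by (simp flip: ennreal_plus add: ennreal_leI)
  qed
  also have "\<dots> = (\<integral>\<^sup>+x. ennreal (w x) \<partial>measure_pmf q) + wdist w p q"
    using w by (simp add: nn_integral_add wdist_def nn_integral_measure_pmf ennreal_mult')
  also have "\<dots> < \<infinity>"
    using fin q w by (simp add: integrable_iff_bounded)
  finally show "(\<integral>\<^sup>+x. ennreal (norm (w x)) \<partial>measure_pmf p) < \<infinity>" .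
qed simp

lemma abs_integral_diff_le_wdist:
  fixes f :: "'a \<Rightarrow> real"
  assumes "pmf_integrable p w" "pmf_integrable q w" "\<And>x. \<bar>f x\<bar> \<le> w x"
  shows "ennreal \<bar>pmf_mean p f - pmf_mean q f\<bar> \<le> wdist w p q"
proof -
  have f: "pmf_integrable p f" "pmf_integrable q f"
    using assms integrable_measure_pmf_bound by blast+
  then have "pmf_mean p f - pmf_mean q f
      = (\<integral>x. (pmf p x - pmf q x) * f x \<partial>count_space UNIV)"
    by (simp add: integral_measure_pmf_count_space integrable_measure_pmf_iff left_diff_distrib
        flip: Bochner_Integration.integral_diff)
  also have "ennreal \<bar>\<dots>\<bar> \<le> (\<integral>\<^sup>+x. norm ((pmf p x - pmf q x) * f x) \<partial>count_space UNIV)"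
    using integral_norm_bound_ennreal[of "count_space UNIV" "\<lambda>x. (pmf p x - pmf q x) * f x"] f
    by (simp add: integrable_measure_pmf_iff left_diff_distrib)
  also have "\<dots> \<le> wdist w p q"
    unfolding wdist_def using assms(3)
    by (intro nn_integral_mono ennreal_leI) (simp add: abs_mult mult.commute[of "w _"] mult_left_mono)
  finally show ?thesis .
qed

text \<open>Dominated convergence with a moving law: replacing \<open>p k\<close> by
  \<open>q\<close> costs at most \<open>wdist w (p k) q\<close>, uniformly over integrands bounded
  by \<open>w\<close>; what remains is dominated convergence under the fixed
  \<open>q\<close>.\<close>

lemma tendsto_expectation_wdist:
  fixes f :: "nat \<Rightarrow> 'a \<Rightarrow> real"
  assumes w: "pmf_integrable q w"
    and conv: "(\<lambda>k. wdist w (p k) q) \<longlonglongrightarrow> 0"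
    and bound: "\<And>k x. \<bar>f k x\<bar> \<le> w x"
    and pointwise: "\<And>x. (\<lambda>k. f k x) \<longlonglongrightarrow> g x"
  shows "(\<lambda>k. pmf_mean (p k) (f k)) \<longlonglongrightarrow> pmf_mean q g"
proof -
  have w0: "0 \<le> w x" for x using bound[of 0 x] by linarith
  have ev: "eventually (\<lambda>k. wdist w (p k) q < 1) sequentially"
    using order_tendstoD(2)[OF conv, of 1] by simp
  have "(\<lambda>k. ennreal \<bar>pmf_mean (p k) (f k) - pmf_mean q (f k)\<bar>) \<longlonglongrightarrow> 0"
  proof (rule tendsto_sandwich[OF _ _ tendsto_const conv])
    show "eventually (\<lambda>k. ennreal \<bar>pmf_mean (p k) (f k) - pmf_mean q (f k)\<bar>
        \<le> wdist w (p k) q) sequentially"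
      using ev
    proof eventually_elim
      case (elim k)
      then have "pmf_integrable (p k) w"
        by (intro integrable_of_wdist_finite[OF w0 w]) (auto intro: less_trans)
      then show ?case by (rule abs_integral_diff_le_wdist[OF _ w bound])
    qed
  qed simp
  then have "(\<lambda>k. \<bar>pmf_mean (p k) (f k) - pmf_mean q (f k)\<bar>) \<longlonglongrightarrow> 0"
    by (subst (asm) ennreal_0[symmetric], subst (asm) tendsto_ennreal_iff) auto
  then have "(\<lambda>k. pmf_mean (p k) (f k) - pmf_mean q (f k)) \<longlonglongrightarrow> 0"
    by (rule tendsto_rabs_zero_cancel)
  moreover have "(\<lambda>k. pmf_mean q (f k)) \<longlonglongrightarrow> pmf_mean q g"
    using bound pointwise by (intro integral_dominated_convergence[OF _ _ w]) auto
  ultimately show ?thesis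
    using tendsto_add[of "\<lambda>k. pmf_mean (p k) (f k) - pmf_mean q (f k)" 0] by force
qed

section \<open>Evaluation of sums in the extended reals\<close>

lemma ext_sum_eq_integral:
  assumes "integrable (count_space UNIV) f"
  shows "ext_sum f = ereal (\<integral>x. f x \<partial>count_space UNIV)"
proof -
  have *: "(\<integral>\<^sup>+x. ennreal (f x) \<partial>count_space UNIV) < \<top>" "(\<integral>\<^sup>+x. ennreal (- f x) \<partial>count_space UNIV) < \<top>"
    using assms by (simp_all add: real_integrable_def less_top)
  then obtain a b where "(\<integral>\<^sup>+x. ennreal (f x) \<partial>count_space UNIV) = ennreal a" "0 \<le> a"
     "(\<integral>\<^sup>+x. ennreal (- f x) \<partial>count_space UNIV) = ennreal b" "0 \<le> b"
    by (metis less_top_ennreal)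
  then show ?thesis
    using real_lebesgue_integral_def[OF assms] by (simp add: ext_sum_def enn2ereal_ennreal)
qed

lemma ext_sum_eq_infinity:
  assumes "(\<integral>\<^sup>+x. ennreal (- f x) \<partial>count_space UNIV) < \<top>" "\<not> integrable (count_space UNIV) f"
  shows "ext_sum f = \<infinity>"
proof -
  have "(\<integral>\<^sup>+x. ennreal (f x) \<partial>count_space UNIV) = \<top>"
    using assms by (auto simp: real_integrable_def simp flip: less_top)
  moreover obtain b where "(\<integral>\<^sup>+x. ennreal (- f x) \<partial>count_space UNIV) = ennreal b" "0 \<le> b"
    using assms(1) by (metis less_top_ennreal)
  ultimately show ?thesis
    by (simp add: ext_sum_def enn2ereal_ennreal)
qed

section \<open>Duality\<close>

definition gibbs :: "real \<Rightarrow> ('x \<Rightarrow> 'y \<Rightarrow> real) \<Rightarrow> ('x \<Rightarrow> real) \<Rightarrow> ('y \<Rightarrow> real) \<Rightarrow> 'x \<Rightarrow> 'y \<Rightarrow> real" where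
  "gibbs lam c \<alpha> \<beta> x y = exp ((\<alpha> x + \<beta> y - c x y) / lam)"

text \<open>The equations are imposed at every point, also outside the supports, because a potential
  of one pair of laws is later integrated against another law.\<close>

definition schroedinger ::
  "real \<Rightarrow> ('x \<Rightarrow> 'y \<Rightarrow> real) \<Rightarrow> 'x pmf \<Rightarrow> 'y pmf \<Rightarrow> ('x \<Rightarrow> real) \<Rightarrow> ('y \<Rightarrow> real) \<Rightarrow> bool" where
  "schroedinger lam c r s \<alpha> \<beta> \<longleftrightarrow>
     (\<forall>x. pmf_mean s (\<lambda>y. gibbs lam c \<alpha> \<beta> x y) = 1) \<and>
     (\<forall>y. pmf_mean r (\<lambda>x. gibbs lam c \<alpha> \<beta> x y) = 1)"

lemma gibbs_pos: "0 < gibbs lam c \<alpha> \<beta> x y"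
  by (simp add: gibbs_def)

lemma gibbs_nonneg: "0 \<le> gibbs lam c \<alpha> \<beta> x y"
  by (simp add: gibbs_def)

lemma gibbs_swap: "gibbs lam (\<lambda>y x. c x y) \<beta> \<alpha> y x = gibbs lam c \<alpha> \<beta> x y"
  by (simp add: gibbs_def add.commute)

lemma schroedinger_swap: "schroedinger lam (\<lambda>y x. c x y) s r \<beta> \<alpha> \<longleftrightarrow> schroedinger lam c r s \<alpha> \<beta>"
  by (auto simp: schroedinger_def gibbs_swap[of lam c])

lemma dominating_swap:
  "dominating (\<lambda>y x. c x y) cY_lo cY_hi cX_lo cX_hi \<longleftrightarrow> dominating c cX_lo cX_hi cY_lo cY_hi"
  by (auto simp: dominating_def add.commute)

text \<open>The Bochner integral of a non-integrable function is 0 by convention, so the value 1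
  certifies integrability; this is how \<open>schroedinger\<close> encodes it.\<close>

lemma integrable_of_expectation_eq_1:
  fixes f :: "'a \<Rightarrow> real"
  shows "pmf_mean p f = 1 \<Longrightarrow> pmf_integrable p f"
  using not_integrable_integral_eq by fastforce

lemma nn_integral_eq_1_of_expectation:
  assumes "pmf_mean p f = 1" "\<And>x. 0 \<le> f x"
  shows "(\<integral>\<^sup>+x. ennreal (f x) \<partial>measure_pmf p) = 1"
  using nn_integral_eq_integral[OF integrable_of_expectation_eq_1[OF assms(1)]] assms by simp

lemma nn_integral_pair_pmf_count_space:
  assumes "\<And>x y. 0 \<le> f x y"
  shows "(\<integral>\<^sup>+z. ennreal (case z of (x, y) \<Rightarrow> f x y * (pmf r x * pmf s y)) \<partial>count_space UNIV)
       = (\<integral>\<^sup>+x. \<integral>\<^sup>+y. ennreal (f x y) \<partial>measure_pmf s \<partial>measure_pmf r)"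
proof -
  have "(\<integral>\<^sup>+x. \<integral>\<^sup>+y. ennreal (f x y) \<partial>measure_pmf s \<partial>measure_pmf r)
      = (\<integral>\<^sup>+z. ennreal (case z of (x, y) \<Rightarrow> f x y) \<partial>pair_pmf r s)"
    by (simp add: nn_integral_pair_pmf')
  also have "\<dots> = (\<integral>\<^sup>+z. ennreal (case z of (x, y) \<Rightarrow> f x y * (pmf r x * pmf s y)) \<partial>count_space UNIV)"
    using assms by (auto simp: nn_integral_measure_pmf pmf_pair ennreal_mult' mult_ac intro!: nn_integral_cong)
  finally show ?thesis by simp
qed

lemma nn_integral_count_space_swap:
  fixes f :: "'a \<times> 'b \<Rightarrow> ennreal"
  shows "(\<integral>\<^sup>+z. f (prod.swap z) \<partial>count_space UNIV) = (\<integral>\<^sup>+z. f z \<partial>count_space UNIV)"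
  by (intro nn_integral_bij_count_space bij_betwI[where g=prod.swap]) auto

lemma pmf_pair_pmf_eq: "pmf (pair_pmf r s) = (\<lambda>(x, y). pmf r x * pmf s y)"
  by (auto simp: fun_eq_iff pmf_pair)

lemma integrable_pair_pmf_weights: "integrable (count_space UNIV) (\<lambda>(x, y). pmf r x * pmf s y)"
  using integrable_pmf[of UNIV "pair_pmf r s"] by (simp add: pmf_pair_pmf_eq)

lemma integral_pair_pmf_weights: "(\<integral>(x, y). pmf r x * pmf s y \<partial>count_space UNIV) = 1"
  using integral_pmf[where M="pair_pmf r s" and X=UNIV] by (simp add: pmf_pair_pmf_eq)

section \<open>Couplings, relative entropy and weak duality\<close>

lemma pmf_coupling_le:
  assumes "\<pi> \<in> couplings r s"
  shows "pmf \<pi> (x, y) \<le> pmf r x" "pmf \<pi> (x, y) \<le> pmf s y"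
proof -
  have le: "pmf \<pi> z \<le> pmf (map_pmf f \<pi>) (f z)" for z and f :: "_ \<Rightarrow> 'c"
    using measure_pmf.finite_measure_mono[of "{z}" "f -` {f z}" \<pi>] by (simp add: pmf_map measure_pmf_single)
  show "pmf \<pi> (x, y) \<le> pmf r x" using le[of "(x, y)" fst] assms by (simp add: couplings_def)
  show "pmf \<pi> (x, y) \<le> pmf s y" using le[of "(x, y)" snd] assms by (simp add: couplings_def)
qed

lemma pmf_coupling_pos:
  assumes "\<pi> \<in> couplings r s" "0 < pmf \<pi> (x, y)"
  shows "0 < pmf r x * pmf s y"
  using pmf_coupling_le[OF assms(1), of x y] assms(2) by (simp add: zero_less_mult_iff)

text \<open>This is \<open>ln v \<le> v - 1\<close> at \<open>v = exp u * g / t\<close>, a family of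
  tangent bounds indexed by \<open>u\<close>: the choice \<open>u = 0\<close> controls negative
  parts, and \<open>u = (\<alpha> + \<beta> - c) / lam\<close> yields weak duality.\<close>

lemma xlogx_ge:
  fixes t g u :: real
  assumes "0 \<le> t" "0 \<le> g" "0 < t \<Longrightarrow> 0 < g"
  shows "t * u + t - exp u * g \<le> t * ln (t / g)"
proof (cases "t = 0")
  case False
  then have t: "0 < t" "0 < g" using assms by auto
  have "ln (exp u * g / t) \<le> exp u * g / t - 1"
    using t by (intro ln_le_minus_one) simp
  moreover have "ln (exp u * g / t) = u - ln (t / g)"
    using t by (simp add: ln_mult ln_div)
  ultimately have "t * (u - ln (t / g)) \<le> t * (exp u * g / t - 1)"
    using t by (intro mult_left_mono) auto
  then show ?thesis using t by (simp add: algebra_simps)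
qed (use assms in auto)

lemma integral_coupling_sum:
  assumes "\<pi> \<in> couplings r s" "pmf_integrable r f" "pmf_integrable s g"
  shows "pmf_integrable \<pi> (\<lambda>z. f (fst z) + g (snd z))"
    and "pmf_mean \<pi> (\<lambda>z. f (fst z) + g (snd z) :: real)
       = pmf_mean r f + pmf_mean s g"
proof -
  have r: "r = map_pmf fst \<pi>" and s: "s = map_pmf snd \<pi>" using assms by (auto simp: couplings_def)
  have i: "pmf_integrable \<pi> (\<lambda>z. f (fst z))" "pmf_integrable \<pi> (\<lambda>z. g (snd z))"
    using assms(2,3) by (simp_all add: r s)
  show "pmf_integrable \<pi> (\<lambda>z. f (fst z) + g (snd z))"
    using i by simp
  show "pmf_mean \<pi> (\<lambda>z. f (fst z) + g (snd z))
       = pmf_mean r f + pmf_mean s g"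
    using i by (simp add: r s)
qed

lemma coupling_entropy_neg_part:
  assumes "\<pi> \<in> couplings r s"
  shows "(\<integral>\<^sup>+z. ennreal (- (case z of (x, y) \<Rightarrow> pmf \<pi> (x, y) * ln (pmf \<pi> (x, y) / (pmf r x * pmf s y))))
            \<partial>count_space UNIV) < \<top>"
proof -
  have "(\<integral>\<^sup>+z. ennreal (- (case z of (x, y) \<Rightarrow> pmf \<pi> (x, y) * ln (pmf \<pi> (x, y) / (pmf r x * pmf s y))))
            \<partial>count_space UNIV) \<le> (\<integral>\<^sup>+z. ennreal (case z of (x, y) \<Rightarrow> 1 * (pmf r x * pmf s y)) \<partial>count_space UNIV)"
  proof (intro nn_integral_mono ennreal_leI, clarsimp)
    fix x y
    have "pmf \<pi> (x, y) - pmf r x * pmf s y \<le> pmf \<pi> (x, y) * ln (pmf \<pi> (x, y) / (pmf r x * pmf s y))"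
      using xlogx_ge[of "pmf \<pi> (x, y)" "pmf r x * pmf s y" 0] pmf_coupling_pos[OF assms, of x y] by simp
    then show "- (pmf \<pi> (x, y) * ln (pmf \<pi> (x, y) / (pmf r x * pmf s y))) \<le> pmf r x * pmf s y"
      using pmf_nonneg[of \<pi> "(x, y)"] by linarith
  qed
  also have "\<dots> < \<top>"
    by (subst nn_integral_pair_pmf_count_space) simp_all
  finally show ?thesis .
qed

text \<open>Integrating the Fenchel inequality \<open>t ln (t / g) \<ge> t u + t - exp u * g\<close> with
  \<open>u = (\<alpha> + \<beta> - c) / lam\<close> over a coupling.\<close>
lemma EROT_ge_dual:
  fixes c :: "'x \<Rightarrow> 'y \<Rightarrow> real"
  assumes lam: "0 < lam" and dom: "dominating c cX_lo cX_hi cY_lo cY_hi"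
    and lo: "pmf_integrable r cX_lo" "pmf_integrable s cY_lo"
    and ab: "pmf_integrable r \<alpha>" "pmf_integrable s \<beta>"
    and mass: "(\<integral>\<^sup>+x. \<integral>\<^sup>+y. ennreal (gibbs lam c \<alpha> \<beta> x y) \<partial>measure_pmf s \<partial>measure_pmf r) \<le> 1"
  shows "ereal (pmf_mean r \<alpha> + pmf_mean s \<beta>) \<le> EROT lam c r s"
  unfolding EROT_def
proof (rule INF_greatest)
  fix \<pi> assume \<pi>: "\<pi> \<in> couplings r s"
  define E where "E = (\<lambda>(x, y). pmf \<pi> (x, y) * ln (pmf \<pi> (x, y) / (pmf r x * pmf s y)))"
  define C where "C = (\<lambda>(x, y). c x y * pmf \<pi> (x, y))"
  define Q where "Q = (\<lambda>(x, y). gibbs lam c \<alpha> \<beta> x y * (pmf r x * pmf s y))"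
  have negE: "(\<integral>\<^sup>+z. ennreal (- E z) \<partial>count_space UNIV) < \<top>"
    using coupling_entropy_neg_part[OF \<pi>] by (simp add: E_def)
  have negC: "(\<integral>\<^sup>+z. ennreal (- C z) \<partial>count_space UNIV) < \<top>"
  proof -
    have "(\<integral>\<^sup>+z. ennreal (- C z) \<partial>count_space UNIV)
        \<le> (\<integral>\<^sup>+z. ennreal (norm (pmf \<pi> z * (cX_lo (fst z) + cY_lo (snd z)))) \<partial>count_space UNIV)"
    proof (intro nn_integral_mono ennreal_leI)
      fix z :: "'x \<times> 'y"
      obtain x y where z: "z = (x, y)" by (cases z)
      have "pmf \<pi> z * (cX_lo x + cY_lo y) \<le> pmf \<pi> z * c x y"
        using dom by (intro mult_left_mono) (auto simp: dominating_def)
      then show "- C z \<le> norm (pmf \<pi> z * (cX_lo (fst z) + cY_lo (snd z)))"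
        by (simp add: C_def z mult.commute del: mult_less_0_iff)
    qed
    also have "\<dots> < \<top>"
      using integral_coupling_sum(1)[OF \<pi> lo] unfolding integrable_measure_pmf_iff unfolding integrable_iff_bounded by simp
    finally show ?thesis .
  qed
  \<comment> \<open>Finite negative parts exclude the value \<open>-\<infinity>\<close>. So if one
    of the two sums is not integrable, the primal objective is \<open>\<infinity>\<close>, and only
    the integrable case has content.\<close>
  have E_ge: "ext_sum E \<noteq> - \<infinity>" and C_ge: "ext_sum C \<noteq> - \<infinity>"
    using ext_sum_eq_infinity[OF negE] ext_sum_eq_infinity[OF negC] ext_sum_eq_integral[of E] ext_sum_eq_integral[of C]
    by fastforce+
  have "ereal (pmf_mean r \<alpha> + pmf_mean s \<beta>) \<le> ext_sum C + ereal lam * ext_sum E"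
  proof (cases "integrable (count_space UNIV) C \<and> integrable (count_space UNIV) E")
    case False
    then have "ext_sum C = \<infinity> \<or> ext_sum E = \<infinity>"
      using ext_sum_eq_infinity[OF negE] ext_sum_eq_infinity[OF negC] by blast
    then have inf: "ext_sum C + ereal lam * ext_sum E = \<infinity>"
      using lam E_ge C_ge by (cases "ext_sum C"; cases "ext_sum E") auto
    show ?thesis by (subst inf) simp
  next
    case True
    have Q0: "0 \<le> Q z" for z by (auto simp: Q_def gibbs_nonneg split: prod.split)
    have Qi: "(\<integral>\<^sup>+z. ennreal (Q z) \<partial>count_space UNIV) \<le> 1"
      unfolding Q_def using mass by (subst nn_integral_pair_pmf_count_space) (simp_all add: gibbs_nonneg)
    then have Q_int: "integrable (count_space UNIV) Q"
      using Q0 by (intro integrableI_bounded) (auto intro: le_less_trans)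
    then have Q_le: "(\<integral>z. Q z \<partial>count_space UNIV) \<le> 1"
      using Qi Q0 nn_integral_eq_integral[OF Q_int] by (simp flip: ennreal_1)
    define L where "L = (\<lambda>z. pmf \<pi> z * (\<alpha> (fst z) + \<beta> (snd z)))"
    have L: "integrable (count_space UNIV) L"
      "(\<integral>z. L z \<partial>count_space UNIV) = pmf_mean r \<alpha> + pmf_mean s \<beta>"
      using integral_coupling_sum[OF \<pi> ab]
      by (simp_all add: L_def integrable_measure_pmf_iff integral_measure_pmf_count_space)
    have "(\<integral>z. L z + lam * (pmf \<pi> z - Q z) \<partial>count_space UNIV) \<le> (\<integral>z. C z + lam * E z \<partial>count_space UNIV)"
    proof (intro integral_mono)
      fix z :: "'x \<times> 'y"
      obtain x y where z: "z = (x, y)" by (cases z)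
      let ?u = "(\<alpha> x + \<beta> y - c x y) / lam"
      have "pmf \<pi> z * ?u + pmf \<pi> z - exp ?u * (pmf r x * pmf s y) \<le> E z"
        unfolding E_def z prod.case
        using pmf_coupling_pos[OF \<pi>, of x y] by (intro xlogx_ge) auto
      then have "lam * (pmf \<pi> z * ?u + pmf \<pi> z - exp ?u * (pmf r x * pmf s y)) \<le> lam * E z"
        using lam by simp
      moreover have "lam * (pmf \<pi> z * ?u) = pmf \<pi> z * (\<alpha> x + \<beta> y - c x y)" using lam by simp
      ultimately show "L z + lam * (pmf \<pi> z - Q z) \<le> C z + lam * E z"
        by (simp add: L_def C_def Q_def gibbs_def z algebra_simps)
    qed (use True L Q_int integrable_pmf[of UNIV \<pi>] in \<open>auto intro!: Bochner_Integration.integrable_add Bochner_Integration.integrable_diff\<close>)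
    moreover have "(\<integral>z. L z + lam * (pmf \<pi> z - Q z) \<partial>count_space UNIV)
        = pmf_mean r \<alpha> + pmf_mean s \<beta> + lam * (1 - (\<integral>z. Q z \<partial>count_space UNIV))"
      using L Q_int integrable_pmf[of UNIV \<pi>] integral_pmf[where M=\<pi> and X=UNIV] by simp
    moreover have "lam * (1 - (\<integral>z. Q z \<partial>count_space UNIV)) \<ge> 0" using lam Q_le by simp
    ultimately show ?thesis
      using True by (simp add: ext_sum_eq_integral)
  qed
  then show "ereal (pmf_mean r \<alpha> + pmf_mean s \<beta>)
      \<le> transport_cost c \<pi> + ereal lam * coupling_entropy r s \<pi>"
    by (simp add: transport_cost_def coupling_entropy_def E_def C_def)
qed

section \<open>The Gibbs coupling and equality in duality\<close>

lemma pmf_bind_map_Pair: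
  "pmf (bind_pmf r (\<lambda>x. map_pmf (Pair x) (\<kappa> x))) (x, y) = pmf r x * pmf (\<kappa> x) y"
proof -
  have *: "pmf (map_pmf (Pair x') (\<kappa> x')) (x, y) = pmf (\<kappa> x) y * indicator {x} x'" for x'
    by (cases "x' = x") (auto simp: pmf_map_inj' inj_on_def intro: pmf_map_outside)
  have "ennreal (pmf (bind_pmf r (\<lambda>x. map_pmf (Pair x) (\<kappa> x))) (x, y)) = ennreal (pmf r x * pmf (\<kappa> x) y)"
    by (simp add: ennreal_pmf_bind * ennreal_mult ennreal_indicator nn_integral_cmult emeasure_pmf_single mult.commute)
  then show ?thesis by simp
qed

text \<open>The Gibbs kernel is a density with respect to the product law. Disintegrating along
  \<open>X\<close> makes the first marginal evident, disintegrating along \<open>Y\<close> the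
  second; both constructions have the same point masses, hence are one coupling.\<close>

lemma schroedinger_coupling:
  assumes "schroedinger lam c r s \<alpha> \<beta>"
  obtains \<pi> where "\<pi> \<in> couplings r s"
    "\<And>x y. pmf \<pi> (x, y) = gibbs lam c \<alpha> \<beta> x y * (pmf r x * pmf s y)"
proof -
  have ker: "\<exists>\<kappa>. \<forall>x y. pmf (\<kappa> x) y = f x y * pmf q y"
    if "\<And>x. pmf_mean q (f x) = 1" "\<And>x y. 0 \<le> f x y"
    for q :: "'c pmf" and f :: "'d \<Rightarrow> 'c \<Rightarrow> real"
  proof (intro exI allI)
    fix x y
    show "pmf (embed_pmf (\<lambda>y. f x y * pmf q y)) y = f x y * pmf q y"
    proof (rule pmf_embed_pmf)
      have "(\<integral>\<^sup>+y. ennreal (f x y * pmf q y) \<partial>count_space UNIV) = (\<integral>\<^sup>+y. ennreal (f x y) \<partial>measure_pmf q)"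
        using that by (simp add: nn_integral_measure_pmf ennreal_mult' mult.commute)
      then show "(\<integral>\<^sup>+y. ennreal (f x y * pmf q y) \<partial>count_space UNIV) = 1"
        using nn_integral_eq_1_of_expectation[OF that] by simp
    qed (use that in auto)
  qed
  obtain \<kappa> where \<kappa>: "\<And>x y. pmf (\<kappa> x) y = gibbs lam c \<alpha> \<beta> x y * pmf s y"
    using ker[of s "gibbs lam c \<alpha> \<beta>"] assms by (auto simp: schroedinger_def gibbs_nonneg)
  obtain \<kappa>' where \<kappa>': "\<And>x y. pmf (\<kappa>' y) x = gibbs lam c \<alpha> \<beta> x y * pmf r x"
    using ker[of r "\<lambda>y x. gibbs lam c \<alpha> \<beta> x y"] assms by (auto simp: schroedinger_def gibbs_nonneg)
  define \<pi> where "\<pi> = bind_pmf r (\<lambda>x. map_pmf (Pair x) (\<kappa> x))"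
  define \<pi>' where "\<pi>' = map_pmf prod.swap (bind_pmf s (\<lambda>y. map_pmf (Pair y) (\<kappa>' y)))"
  have \<pi>: "pmf \<pi> (x, y) = gibbs lam c \<alpha> \<beta> x y * (pmf r x * pmf s y)" for x y
    by (simp add: \<pi>_def pmf_bind_map_Pair \<kappa> mult_ac)
  have "pmf \<pi>' (x, y) = gibbs lam c \<alpha> \<beta> x y * (pmf r x * pmf s y)" for x y
    using pmf_map_inj'[of prod.swap "bind_pmf s (\<lambda>y. map_pmf (Pair y) (\<kappa>' y))" "(y, x)"]
    by (simp add: \<pi>'_def pmf_bind_map_Pair \<kappa>' mult_ac)
  then have eq: "\<pi> = \<pi>'" using \<pi> by (intro pmf_eqI) (metis surj_pair)
  have "map_pmf fst \<pi> = r"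
    by (simp add: \<pi>_def map_bind_pmf pmf.map_comp comp_def map_pmf_const bind_return_pmf')
  moreover have "map_pmf snd \<pi> = s"
    unfolding eq by (simp add: \<pi>'_def map_bind_pmf pmf.map_comp comp_def map_pmf_const bind_return_pmf')
  ultimately show ?thesis using that \<pi> by (simp add: couplings_def)
qed

text \<open>The log-density of the Gibbs coupling is \<open>(\<alpha> + \<beta> - c) / lam\<close>,
  so in its primal value the cost cancels and the integral of \<open>\<alpha> + \<beta>\<close>
  remains, which depends on the marginals alone. Weak duality is the other inequality.\<close>

lemma EROT_eq_dual:
  assumes lam: "0 < lam" and dom: "dominating c cX_lo cX_hi cY_lo cY_hi"
    and cX: "pmf_integrable r cX_lo" "pmf_integrable r cX_hi"
    and cY: "pmf_integrable s cY_lo" "pmf_integrable s cY_hi"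
    and ab: "pmf_integrable r \<alpha>" "pmf_integrable s \<beta>"
    and schr: "schroedinger lam c r s \<alpha> \<beta>"
  shows "EROT lam c r s = ereal (pmf_mean r \<alpha> + pmf_mean s \<beta>)"
proof (rule antisym)
  obtain \<pi> where \<pi>: "\<pi> \<in> couplings r s"
    "\<And>x y. pmf \<pi> (x, y) = gibbs lam c \<alpha> \<beta> x y * (pmf r x * pmf s y)"
    using schroedinger_coupling[OF schr] by blast
  let ?c = "\<lambda>z. c (fst z) (snd z)"
  have c_int: "pmf_integrable \<pi> ?c"
  proof (rule integrable_measure_pmf_bound)
    show "pmf_integrable \<pi> (\<lambda>z. (\<bar>cX_lo (fst z)\<bar> + \<bar>cX_hi (fst z)\<bar>) + (\<bar>cY_lo (snd z)\<bar> + \<bar>cY_hi (snd z)\<bar>))"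
      using integral_coupling_sum(1)[OF \<pi>(1), of "\<lambda>x. \<bar>cX_lo x\<bar> + \<bar>cX_hi x\<bar>" "\<lambda>y. \<bar>cY_lo y\<bar> + \<bar>cY_hi y\<bar>"] cX cY
      by simp
    fix z
    have "cX_lo (fst z) + cY_lo (snd z) \<le> ?c z" "?c z \<le> cX_hi (fst z) + cY_hi (snd z)"
      using dom by (auto simp: dominating_def)
    then show "\<bar>?c z\<bar> \<le> (\<bar>cX_lo (fst z)\<bar> + \<bar>cX_hi (fst z)\<bar>) + (\<bar>cY_lo (snd z)\<bar> + \<bar>cY_hi (snd z)\<bar>)"
      by linarith
  qed
  let ?l = "\<lambda>z. (\<alpha> (fst z) + \<beta> (snd z) - ?c z) / lam"
  have l_int: "pmf_integrable \<pi> ?l"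
    using c_int integral_coupling_sum(1)[OF \<pi>(1) ab] by simp
  \<comment> \<open>Where the product law vanishes both sides are 0 because of the leading factor;
    elsewhere the logarithm undoes the exponential.\<close>
  have "pmf \<pi> (x, y) * ln (pmf \<pi> (x, y) / (pmf r x * pmf s y)) = pmf \<pi> (x, y) * ?l (x, y)" for x y
    using \<pi>(2)[of x y] by (cases "pmf r x * pmf s y = 0") (auto simp: gibbs_def)
  then have "(\<lambda>(x, y). pmf \<pi> (x, y) * ln (pmf \<pi> (x, y) / (pmf r x * pmf s y))) = (\<lambda>z. pmf \<pi> z * ?l z)"
    by (auto simp only: fun_eq_iff split: prod.split)
  then have "coupling_entropy r s \<pi> = ext_sum (\<lambda>z. pmf \<pi> z * ?l z)"
    by (simp only: coupling_entropy_def)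
  also have "\<dots> = ereal (pmf_mean \<pi> ?l)"
    using l_int by (subst ext_sum_eq_integral) (simp_all add: integrable_measure_pmf_iff integral_measure_pmf_count_space)
  finally have ent: "coupling_entropy r s \<pi> = ereal (pmf_mean \<pi> ?l)" .
  have "(\<lambda>(x, y). c x y * pmf \<pi> (x, y)) = (\<lambda>z. pmf \<pi> z * ?c z)"
    by (simp add: fun_eq_iff mult.commute)
  then have cost: "transport_cost c \<pi> = ereal (pmf_mean \<pi> ?c)"
    unfolding transport_cost_def using c_int
    by (simp add: ext_sum_eq_integral integrable_measure_pmf_iff integral_measure_pmf_count_space)
  have "transport_cost c \<pi> + ereal lam * coupling_entropy r s \<pi>
      = ereal (pmf_mean r \<alpha> + pmf_mean s \<beta>)"
    using c_int integral_coupling_sum[OF \<pi>(1) ab] lam by (simp add: ent cost)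
  then show "EROT lam c r s \<le> ereal (pmf_mean r \<alpha> + pmf_mean s \<beta>)"
    unfolding EROT_def using INF_lower[OF \<pi>(1), of "\<lambda>\<pi>. transport_cost c \<pi> + ereal lam * coupling_entropy r s \<pi>"]
    by (simp only:)
  have "(\<integral>\<^sup>+x. \<integral>\<^sup>+y. ennreal (gibbs lam c \<alpha> \<beta> x y) \<partial>measure_pmf s \<partial>measure_pmf r) \<le> 1"
    using schr by (simp add: schroedinger_def nn_integral_eq_1_of_expectation gibbs_nonneg)
  then show "ereal (pmf_mean r \<alpha> + pmf_mean s \<beta>) \<le> EROT lam c r s"
    by (rule EROT_ge_dual[OF lam dom cX(1) cY(1) ab])
qed

section \<open>The dual functional, its symmetry and its first order condition\<close>

lemma ext_sum_swap: "ext_sum (\<lambda>z. f (prod.swap z)) = ext_sum f"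
  using nn_integral_count_space_swap[of "\<lambda>z. ennreal (f z)"] nn_integral_count_space_swap[of "\<lambda>z. ennreal (- f z)"]
  by (simp add: ext_sum_def)

lemma EROT_dual_swap: "EROT_dual lam (\<lambda>y x. c x y) s r \<beta> \<alpha> = EROT_dual lam c r s \<alpha> \<beta>"
  unfolding EROT_dual_def
  by (subst ext_sum_swap[symmetric]) (simp add: case_prod_unfold add.commute mult.commute)

lemma EROT_potentials_swap:
  "EROT_potentials lam (\<lambda>y x. c x y) s r \<beta> \<alpha> \<longleftrightarrow> EROT_potentials lam c r s \<alpha> \<beta>"
  by (auto simp: EROT_potentials_def EROT_dual_swap[of lam c s r])

lemma EROT_dual_eq:
  fixes lam c \<alpha> \<beta> r s
  defines "Q \<equiv> \<lambda>(x, y). gibbs lam c \<alpha> \<beta> x y * (pmf r x * pmf s y)"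
  assumes "0 < lam"
  shows "EROT_dual lam c r s \<alpha> \<beta> =
    (if integrable (count_space UNIV) Q
     then ereal (pmf_mean r \<alpha> + pmf_mean s \<beta> - lam * ((\<integral>z. Q z \<partial>count_space UNIV) - 1))
     else - \<infinity>)"
proof -
  let ?g = "\<lambda>(x, y). pmf r x * pmf s y"
  have dual: "EROT_dual lam c r s \<alpha> \<beta> = ereal (pmf_mean r \<alpha> + pmf_mean s \<beta>)
      - ereal lam * ext_sum (\<lambda>z. Q z - ?g z)"
    by (simp add: EROT_dual_def Q_def gibbs_def case_prod_unfold)
  show ?thesis
  proof (cases "integrable (count_space UNIV) Q")
    case True
    then have "integrable (count_space UNIV) (\<lambda>z. Q z - ?g z)"
      using integrable_pair_pmf_weights by (rule Bochner_Integration.integrable_diff)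
    then show ?thesis
      using True integrable_pair_pmf_weights[of r s] integral_pair_pmf_weights[of r s]
      by (simp add: dual ext_sum_eq_integral)
  next
    case False
    have "\<not> integrable (count_space UNIV) (\<lambda>z. Q z - ?g z)"
    proof
      assume "integrable (count_space UNIV) (\<lambda>z. Q z - ?g z)"
      from Bochner_Integration.integrable_add[OF this integrable_pair_pmf_weights[of r s]] False show False by simp
    qed
    moreover have "(\<integral>\<^sup>+z. ennreal (- (Q z - ?g z)) \<partial>count_space UNIV)
        \<le> (\<integral>\<^sup>+z. ennreal (case z of (x, y) \<Rightarrow> 1 * (pmf r x * pmf s y)) \<partial>count_space UNIV)"
      by (intro nn_integral_mono ennreal_leI) (auto simp: Q_def gibbs_nonneg)
    moreover have "\<dots> < \<top>"
      by (subst nn_integral_pair_pmf_count_space) simp_all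
    ultimately have "ext_sum (\<lambda>z. Q z - ?g z) = \<infinity>"
      by (intro ext_sum_eq_infinity) (auto intro: le_less_trans)
    then show ?thesis using False \<open>0 < lam\<close> by (simp add: dual)
  qed
qed

text \<open>First order condition: the dual objective is perturbed along \<open>\<alpha> + t 1\<^bsub>x0\<^esub>\<close>, and the value of \<open>t\<close>
  maximising it in closed form turns the optimality of \<open>\<alpha>\<close> into an equality case of \<open>ln u \<le> u - 1\<close>.\<close>
lemma EROT_potentials_imp_marginal:
  assumes lam: "0 < lam" and dom: "dominating c cX_lo cX_hi cY_lo cY_hi"
    and lo: "pmf_integrable r cX_lo" "pmf_integrable s cY_lo"
    and pot: "EROT_potentials lam c r s \<alpha> \<beta>" and x0: "x0 \<in> set_pmf r"
  shows "pmf_mean s (\<lambda>y. gibbs lam c \<alpha> \<beta> x0 y) = 1"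
proof -
  define Q where "Q = (\<lambda>\<alpha> \<beta> (x, y). gibbs lam c \<alpha> \<beta> x y * (pmf r x * pmf s y))"
  have D: "EROT_dual lam c r s a b =
      (if integrable (count_space UNIV) (Q a b)
       then ereal (pmf_mean r a + pmf_mean s b - lam * ((\<integral>z. Q a b z \<partial>count_space UNIV) - 1))
       else - \<infinity>)" for a b
    unfolding Q_def by (rule EROT_dual_eq[OF lam])
  have ab: "pmf_integrable r \<alpha>" "pmf_integrable s \<beta>"
    and max: "\<And>\<alpha>' \<beta>'. pmf_integrable r \<alpha>' \<Longrightarrow> pmf_integrable s \<beta>' \<Longrightarrow>
        EROT_dual lam c r s \<alpha>' \<beta>' \<le> EROT_dual lam c r s \<alpha> \<beta>"
    using pot by (auto simp: EROT_potentials_def l1_space_def)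
  have Q0: "0 \<le> Q a b z" for a b z by (auto simp: Q_def gibbs_nonneg split: prod.split)
  \<comment> \<open>The lower dominating functions have Gibbs kernel at most 1, so they are a
    competitor with finite dual value; a maximiser must then have finite Gibbs mass too.\<close>
  have "integrable (count_space UNIV) (Q cX_lo cY_lo)"
  proof (rule Bochner_Integration.integrable_bound[OF integrable_pair_pmf_weights[of r s]])
    show "AE z in count_space UNIV. norm (Q cX_lo cY_lo z) \<le> norm (case z of (x, y) \<Rightarrow> pmf r x * pmf s y)"
      using dom lam by (intro AE_I2) (auto simp: Q_def gibbs_def dominating_def abs_mult
          intro!: mult_left_le_one_le divide_nonpos_pos)
  qed simp
  then have Qi: "integrable (count_space UNIV) (Q \<alpha> \<beta>)"
    using max[OF lo] D[of \<alpha> \<beta>] D[of cX_lo cY_lo] by (auto split: if_splits)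
  let ?I = "\<lambda>z. indicator {x0} (fst z) * Q \<alpha> \<beta> z"
  define m where "m = (\<integral>z. ?I z \<partial>count_space UNIV)"
  define r0 where "r0 = pmf r x0"
  have r0: "0 < r0" using x0 by (simp add: r0_def pmf_positive)
  have Ii: "integrable (count_space UNIV) ?I"
    by (rule Bochner_Integration.integrable_bound[OF Qi]) (auto split: split_indicator)
  have "ennreal m = (\<integral>\<^sup>+z. ennreal (?I z) \<partial>count_space UNIV)"
    unfolding m_def using Ii Q0 by (subst nn_integral_eq_integral) auto
  also have "\<dots> = (\<integral>\<^sup>+z. ennreal (case z of (x, y) \<Rightarrow> (indicator {x0} x * gibbs lam c \<alpha> \<beta> x y) * (pmf r x * pmf s y)) \<partial>count_space UNIV)"
    by (intro nn_integral_cong arg_cong[where f=ennreal]) (auto simp: Q_def)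
  also have "\<dots> = (\<integral>\<^sup>+x. \<integral>\<^sup>+y. ennreal (indicator {x0} x * gibbs lam c \<alpha> \<beta> x y) \<partial>measure_pmf s \<partial>measure_pmf r)"
    by (rule nn_integral_pair_pmf_count_space) (simp add: gibbs_nonneg)
  also have "\<dots> = (\<integral>\<^sup>+x. (\<integral>\<^sup>+y. ennreal (gibbs lam c \<alpha> \<beta> x0 y) \<partial>measure_pmf s) * indicator {x0} x \<partial>measure_pmf r)"
    by (intro nn_integral_cong) (auto split: split_indicator)
  also have "\<dots> = (\<integral>\<^sup>+y. ennreal (gibbs lam c \<alpha> \<beta> x0 y) \<partial>measure_pmf s) * ennreal r0"
    by (simp add: nn_integral_cmult emeasure_pmf_single r0_def)
  finally have m_eq: "(\<integral>\<^sup>+y. ennreal (gibbs lam c \<alpha> \<beta> x0 y) \<partial>measure_pmf s) * ennreal r0 = ennreal m" by simp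
  have m0: "0 \<le> m" unfolding m_def using Q0 by (intro integral_nonneg_AE AE_I2) auto
  \<comment> \<open>As \<open>x0\<close> has positive mass, finiteness of the row mass
    \<open>m\<close> forces the integral over \<open>s\<close> at this single point to be
    finite.\<close>
  have gi: "pmf_integrable s (\<lambda>y. gibbs lam c \<alpha> \<beta> x0 y)"
  proof (rule integrableI_bounded)
    have "(\<integral>\<^sup>+y. ennreal (gibbs lam c \<alpha> \<beta> x0 y) \<partial>measure_pmf s) \<noteq> \<top>"
      using m_eq r0 by (auto simp: ennreal_top_mult)
    then show "(\<integral>\<^sup>+y. ennreal (norm (gibbs lam c \<alpha> \<beta> x0 y)) \<partial>measure_pmf s) < \<infinity>"
      by (simp add: less_top gibbs_nonneg)
  qed simp
  define Z where "Z = pmf_mean s (\<lambda>y. gibbs lam c \<alpha> \<beta> x0 y)"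
  have "0 < Z"
  proof -
    have "Z \<noteq> 0"
      unfolding Z_def using integral_nonneg_eq_0_iff_AE[OF gi]
      by (auto simp: gibbs_nonneg AE_measure_pmf_iff gibbs_pos less_imp_neq[symmetric] set_pmf_not_empty)
    moreover have "0 \<le> Z" unfolding Z_def by (intro integral_nonneg_AE AE_I2) (simp add: gibbs_nonneg)
    ultimately show ?thesis by simp
  qed
  have "ennreal (Z * r0) = ennreal m"
    using m_eq gi r0 by (simp add: nn_integral_eq_integral gibbs_nonneg Z_def ennreal_mult'')
  then have m: "m = Z * r0" using m0 r0 \<open>0 < Z\<close> by (simp add: ennreal_inj)
  define t where "t = - lam * ln Z"
  define \<alpha>' where "\<alpha>' = (\<lambda>x. \<alpha> x + t * indicator {x0} x)"
  have expt: "exp (t / lam) = 1 / Z" using lam \<open>0 < Z\<close> by (simp add: t_def exp_minus inverse_eq_divide)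
  have gibbs': "gibbs lam c \<alpha>' \<beta> x y = (if x = x0 then 1 / Z else 1) * gibbs lam c \<alpha> \<beta> x y" for x y
  proof (cases "x = x0")
    case True
    then have "(\<alpha>' x + \<beta> y - c x y) / lam = t / lam + (\<alpha> x + \<beta> y - c x y) / lam"
      by (simp add: \<alpha>'_def add_divide_distrib diff_divide_distrib)
    then show ?thesis unfolding gibbs_def expt[symmetric] by (simp only: exp_add True simp_thms if_True)
  qed (simp add: gibbs_def \<alpha>'_def)
  have Q': "Q \<alpha>' \<beta> z = Q \<alpha> \<beta> z + (1 / Z - 1) * ?I z" for z
    unfolding Q_def by (cases z, cases "fst z = x0") (simp_all add: gibbs' left_diff_distrib)
  have ind: "pmf_integrable r (\<lambda>x. t * indicator {x0} x)"
    by (rule integrable_measure_pmf_bound[where w="\<lambda>_. \<bar>t\<bar>"]) (simp_all split: split_indicator)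
  have \<alpha>': "pmf_integrable r \<alpha>'" "pmf_mean r \<alpha>' = pmf_mean r \<alpha> + t * r0"
    unfolding \<alpha>'_def using Bochner_Integration.integrable_add[OF ab(1) ind] Bochner_Integration.integral_add[OF ab(1) ind]
    by (simp_all add: r0_def measure_pmf_single)
  have Qi': "integrable (count_space UNIV) (Q \<alpha>' \<beta>)"
    unfolding Q' using Qi Ii by simp
  have mass: "(\<integral>z. Q \<alpha>' \<beta> z \<partial>count_space UNIV) = (\<integral>z. Q \<alpha> \<beta> z \<partial>count_space UNIV) + (1 / Z - 1) * m"
    unfolding Q' m_def using Qi Ii by simp
  have "t * r0 \<le> lam * ((\<integral>z. Q \<alpha>' \<beta> z \<partial>count_space UNIV) - (\<integral>z. Q \<alpha> \<beta> z \<partial>count_space UNIV))"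
    using max[OF \<alpha>'(1) ab(2)] \<alpha>'(2) Qi Qi' D[of \<alpha> \<beta>] D[of \<alpha>' \<beta>] by (simp add: algebra_simps)
  also have "\<dots> = lam * r0 * (1 - Z)" using \<open>0 < Z\<close> by (simp add: mass m algebra_simps)
  finally have "(lam * r0) * (Z - 1) \<le> (lam * r0) * ln Z" by (simp add: t_def algebra_simps)
  then have "Z - 1 \<le> ln Z" using lam r0 by (simp add: mult_le_cancel_left_pos)
  then have "ln Z = Z - 1" using ln_le_minus_one[OF \<open>0 < Z\<close>] by simp
  then show ?thesis using ln_eq_minus_one[OF \<open>0 < Z\<close>] by (simp add: Z_def)
qed

section \<open>Bounds on potentials\<close>

lemma weight_C_ge_1: "1 \<le> weight_C lo hi a"
  by (simp add: weight_C_def)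

lemma weight_phi_pos: "0 < weight_phi lam lo hi a"
  by (simp add: weight_phi_def)

lemma expectation_pos:
  assumes "pmf_integrable p f" "\<And>x. 0 < f x"
  shows "0 < pmf_mean p (f :: 'a \<Rightarrow> real)"
proof -
  have "pmf_mean p f \<noteq> 0"
    using integral_nonneg_eq_0_iff_AE[OF assms(1)] assms(2)
    by (auto simp: less_imp_le AE_measure_pmf_iff less_imp_neq[symmetric] set_pmf_not_empty)
  moreover have "0 \<le> pmf_mean p f"
    by (intro integral_nonneg_AE AE_I2) (simp add: assms(2) less_imp_le)
  ultimately show ?thesis by simp
qed

text \<open>Jensen's inequality, by integrating the tangent line of the exponential at the
  mean.\<close>

lemma expectation_exp_ge:
  assumes "pmf_integrable p Z" "pmf_integrable p (\<lambda>x. exp (- Z x))"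
  shows "exp (- pmf_mean p Z) \<le> pmf_mean p (\<lambda>x. exp (- Z x :: real))"
proof -
  let ?m = "pmf_mean p Z"
  have "pmf_mean p (\<lambda>x. exp (- ?m) * (1 - Z x + ?m)) \<le> pmf_mean p (\<lambda>x. exp (- Z x))"
  proof (intro integral_mono assms)
    fix x
    have "1 - Z x + ?m \<le> exp (?m - Z x)" using exp_ge_add_one_self[of "?m - Z x"] by linarith
    then have "exp (- ?m) * (1 - Z x + ?m) \<le> exp (- ?m) * exp (?m - Z x)" by simp
    then show "exp (- ?m) * (1 - Z x + ?m) \<le> exp (- Z x)" by (simp flip: exp_add)
  qed (use assms in auto)
  then show ?thesis using assms by simp
qed

text \<open>The upper bound on \<open>c\<close> separates variables: the kernel dominates a function
  of \<open>x\<close> times a function of \<open>y\<close>, so the second marginal equation bounds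
  \<open>\<beta>\<close> above by \<open>cY_hi\<close> plus a constant. The set \<open>S\<close>
  covers both an equation known everywhere and one known only on the support.\<close>

lemma marginal_upper_bound:
  assumes lam: "0 < lam" and dom: "dominating c cX_lo cX_hi cY_lo cY_hi"
    and E2: "\<And>y. y \<in> S \<Longrightarrow> pmf_mean r (\<lambda>x. gibbs lam c \<alpha> \<beta> x y) = 1" and S: "S \<noteq> {}"
  defines "h \<equiv> \<lambda>x. exp ((\<alpha> x - cX_hi x) / lam)"
  shows "pmf_integrable r h" "0 < pmf_mean r h"
    "\<And>y. y \<in> S \<Longrightarrow> exp ((\<beta> y - cY_hi y) / lam) * pmf_mean r h \<le> 1"
    "\<And>x y. h x * exp ((\<beta> y - cY_hi y) / lam) \<le> gibbs lam c \<alpha> \<beta> x y"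
proof -
  have gi: "pmf_integrable r (\<lambda>x. gibbs lam c \<alpha> \<beta> x y)" if "y \<in> S" for y
    using E2[OF that] by (rule integrable_of_expectation_eq_1)
  show h_le: "h x * exp ((\<beta> y - cY_hi y) / lam) \<le> gibbs lam c \<alpha> \<beta> x y" for x y
  proof -
    have "c x y \<le> cX_hi x + cY_hi y" using dom by (auto simp: dominating_def)
    then show ?thesis
      using lam by (simp add: h_def gibbs_def flip: exp_add add_divide_distrib) (simp add: divide_right_mono)
  qed
  obtain y0 where y0: "y0 \<in> S" using S by blast
  show h_int: "pmf_integrable r h"
  proof (rule integrable_measure_pmf_bound[OF integrable_mult_right[OF gi[OF y0]]])
    fix x
    show "\<bar>h x\<bar> \<le> exp ((cY_hi y0 - \<beta> y0) / lam) * gibbs lam c \<alpha> \<beta> x y0"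
      using mult_left_mono[OF h_le[of x y0], of "exp ((cY_hi y0 - \<beta> y0) / lam)"]
      by (simp add: h_def mult.left_commute flip: exp_add add_divide_distrib)
  qed
  show "0 < pmf_mean r h" by (intro expectation_pos h_int) (simp add: h_def)
  show "exp ((\<beta> y - cY_hi y) / lam) * pmf_mean r h \<le> 1" if "y \<in> S" for y
  proof -
    have "pmf_mean r (\<lambda>x. h x * exp ((\<beta> y - cY_hi y) / lam)) \<le> 1"
      unfolding E2[OF that, symmetric] by (intro integral_mono h_le gi that integrable_mult_left h_int)
    then show ?thesis by (simp add: mult.commute)
  qed
qed

text \<open>The normalisation \<open>a\<close> makes \<open>exp ((\<beta> - cY_lo - a) / lam)\<close> a probability density with respect to \<open>s\<close>;
  its density is at most \<open>exp (K / lam)\<close> times the weight \<open>\<phi>\<close>, so half of its mass sits on the finite set \<open>B\<close>.\<close>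
lemma schroedinger_bounds:
  assumes lam: "0 < lam" and dom: "dominating c cX_lo cX_hi cY_lo cY_hi"
    and cX: "pmf_integrable r cX_lo" "pmf_integrable r cX_hi"
    and phi: "pmf_integrable s (weight_phi lam cY_lo cY_hi)"
    and schr: "schroedinger lam c r s \<alpha> \<beta>"
    and K: "pmf_mean r (\<lambda>x. cX_hi x - cX_lo x) \<le> K"
    and tail: "pmf_mean s (\<lambda>y. indicator (- B) y * weight_phi lam cY_lo cY_hi y) \<le> exp (- K / lam) / 4"
    and R: "\<And>y. y \<in> B \<Longrightarrow> weight_phi lam cY_lo cY_hi y \<le> R" "0 < R"
  obtains a where "\<And>x. cX_lo x \<le> \<alpha> x + a" "\<And>x. \<alpha> x + a \<le> cX_hi x + lam * ln (2 * R)"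
    "\<And>y. \<beta> y \<le> cY_hi y + a + K" "\<exists>y\<in>B. cY_lo y + a - lam * ln 2 \<le> \<beta> y"
proof -
  let ?\<phi> = "weight_phi lam cY_lo cY_hi"
  have c: "cX_lo x + cY_lo y \<le> c x y" "c x y \<le> cX_hi x + cY_hi y" for x y
    using dom by (auto simp: dominating_def)
  have E1: "pmf_mean s (\<lambda>y. gibbs lam c \<alpha> \<beta> x y) = 1"
    and E2: "pmf_mean r (\<lambda>x. gibbs lam c \<alpha> \<beta> x y) = 1" for x y
    using schr by (auto simp: schroedinger_def)
  have gi: "pmf_integrable s (\<lambda>y. gibbs lam c \<alpha> \<beta> x y)"
    "pmf_integrable r (\<lambda>x. gibbs lam c \<alpha> \<beta> x y)" for x y
    using E1 E2 integrable_of_expectation_eq_1 by blast+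
  define h where "h = (\<lambda>x. exp ((\<alpha> x - cX_hi x) / lam))"
  note half = marginal_upper_bound[OF lam dom, of UNIV r \<alpha> \<beta>, OF E2]
  have h_int: "pmf_integrable r h"
    and h_le: "h x * exp ((\<beta> y - cY_hi y) / lam) \<le> gibbs lam c \<alpha> \<beta> x y" for x y
    using half by (auto simp: h_def)
  define m where "m = pmf_mean r h"
  have m: "0 < m" and \<beta>_m: "exp ((\<beta> y - cY_hi y) / lam) * m \<le> 1" for y
    using half by (auto simp: h_def m_def)
  define g where "g y = exp ((\<beta> y - cY_lo y) / lam)" for y
  have g_eq: "g y = exp ((\<beta> y - cY_hi y) / lam) * ?\<phi> y" for y
    by (simp add: g_def weight_phi_def flip: exp_add add_divide_distrib)
  have g_int: "pmf_integrable s g"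
  proof (rule integrable_measure_pmf_bound[OF integrable_mult_right[OF phi]])
    fix y
    have "exp ((\<beta> y - cY_hi y) / lam) \<le> 1 / m" using \<beta>_m[of y] m by (simp add: field_simps)
    then show "\<bar>g y\<bar> \<le> 1 / m * ?\<phi> y"
      unfolding g_eq by (simp add: abs_mult less_imp_le[OF weight_phi_pos] mult_right_mono del: times_divide_eq_left)
  qed
  define A where "A = pmf_mean s g"
  have A: "0 < A" unfolding A_def by (intro expectation_pos g_int) (simp add: g_def)
  define a where "a = lam * ln A"
  have expa: "exp (a / lam) = A" using lam A by (simp add: a_def)
  have lower: "cX_lo x \<le> \<alpha> x + a" for x
  proof -
    have "1 \<le> pmf_mean s (\<lambda>y. exp ((\<alpha> x - cX_lo x) / lam) * g y)"
      unfolding E1[of x, symmetric]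
    proof (intro integral_mono gi integrable_mult_right g_int)
      fix y show "gibbs lam c \<alpha> \<beta> x y \<le> exp ((\<alpha> x - cX_lo x) / lam) * g y"
        using c(1)[of x y] lam by (simp add: g_def gibbs_def flip: exp_add add_divide_distrib) (simp add: divide_right_mono)
    qed
    also have "\<dots> = exp ((\<alpha> x - cX_lo x + a) / lam)"
      using g_int by (simp add: A_def[symmetric] expa exp_add add_divide_distrib)
    finally show ?thesis using lam by (simp add: zero_le_divide_iff)
  qed
  \<comment> \<open>The lower bound on \<open>\<alpha> + a\<close> makes \<open>h\<close> at least
    \<open>exp (- a / lam)\<close> times \<open>exp (- (cX_hi - cX_lo) / lam)\<close>. By Jensen, a
    bound \<open>K\<close> on the mean of \<open>cX_hi - cX_lo\<close> suffices to keep
    \<open>m\<close> away from 0.\<close>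
  have m_ge: "exp (- ((a + K) / lam)) \<le> m"
  proof -
    let ?Z = "\<lambda>x. (cX_hi x - cX_lo x) / lam"
    have le: "exp (- ?Z x) \<le> exp (a / lam) * h x" for x
      using lower[of x] lam by (simp add: h_def flip: exp_add add_divide_distrib) (simp add: field_simps)
    have eZ: "pmf_integrable r (\<lambda>x. exp (- ?Z x))"
      using le by (intro integrable_measure_pmf_bound[OF integrable_mult_right[OF h_int, of "exp (a / lam)"]]) simp
    have Z: "pmf_integrable r ?Z" using cX by simp
    have "- K / lam \<le> - pmf_mean r ?Z"
      using K lam cX by (simp add: divide_right_mono)
    then have "exp (- K / lam) \<le> exp (- pmf_mean r ?Z)" by simp
    also have "\<dots> \<le> pmf_mean r (\<lambda>x. exp (- ?Z x))"
      by (rule expectation_exp_ge[OF Z eZ])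
    also have "\<dots> \<le> pmf_mean r (\<lambda>x. exp (a / lam) * h x)"
      by (intro integral_mono eZ integrable_mult_right h_int le)
    also have "\<dots> = exp (a / lam) * m" using h_int by (simp add: m_def)
    finally have "exp (- a / lam) * exp (- K / lam) \<le> exp (- a / lam) * (exp (a / lam) * m)"
      by (intro mult_left_mono) auto
    moreover have "exp (- a / lam) * exp (- K / lam) = exp (- ((a + K) / lam))"
      by (simp add: add_divide_distrib flip: exp_add)
    moreover have "exp (- a / lam) * (exp (a / lam) * m) = m"
      by (simp add: exp_minus)
    ultimately show ?thesis by (simp only:)
  qed
  have \<beta>_exp: "exp ((\<beta> y - cY_hi y) / lam) \<le> exp ((a + K) / lam)" for y
  proof -
    have "exp ((\<beta> y - cY_hi y) / lam) * exp (- ((a + K) / lam)) \<le> 1"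
      using order_trans[OF mult_left_mono[OF m_ge exp_ge_zero] \<beta>_m] .
    then have "exp ((\<beta> y - cY_hi y) / lam) * exp (- ((a + K) / lam)) * exp ((a + K) / lam) \<le> 1 * exp ((a + K) / lam)"
      by (intro mult_right_mono) auto
    then show ?thesis by (simp add: mult.assoc exp_minus)
  qed
  have upper: "\<beta> y \<le> cY_hi y + a + K" for y
    using \<beta>_exp[of y] lam by (simp add: divide_le_cancel)
  have gB_int: "pmf_integrable s (\<lambda>y. indicator B y * g y)"
    "pmf_integrable s (\<lambda>y. indicator (- B) y * g y)"
    by (intro integrable_measure_pmf_bound[OF g_int]; auto simp: g_def split: split_indicator)+
  have \<phi>B_int: "pmf_integrable s (\<lambda>y. indicator (- B) y * ?\<phi> y)"
    by (intro integrable_measure_pmf_bound[OF phi]) (auto simp: weight_phi_def split: split_indicator)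
  define b where "b = pmf_mean s (\<lambda>y. indicator B y * g y)"
  \<comment> \<open>The factor \<open>exp (- K / lam)\<close> in the tail hypothesis cancels the
    \<open>exp (K / lam)\<close> in the bound on \<open>g\<close>, and its 1/4 leaves three quarters
    of the mass \<open>A\<close> on \<open>B\<close>.\<close>
  have b_ge: "3 / 4 * A \<le> b"
  proof -
    have "pmf_mean s (\<lambda>y. indicator (- B) y * g y)
        \<le> pmf_mean s (\<lambda>y. exp ((a + K) / lam) * (indicator (- B) y * ?\<phi> y))"
    proof (intro integral_mono gB_int integrable_mult_right \<phi>B_int)
      fix y show "indicator (- B) y * g y \<le> exp ((a + K) / lam) * (indicator (- B) y * ?\<phi> y)"
        unfolding g_eq using \<beta>_exp[of y] by (auto simp: mult_right_mono weight_phi_def split: split_indicator)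
    qed
    also have "\<dots> \<le> exp ((a + K) / lam) * (exp (- K / lam) / 4)"
      using tail by simp
    also have "\<dots> = A / 4" by (simp add: expa[symmetric] add_divide_distrib exp_add exp_minus)
    finally have "pmf_mean s (\<lambda>y. indicator (- B) y * g y) \<le> A / 4" .
    moreover have "A = pmf_mean s (\<lambda>y. indicator B y * g y + indicator (- B) y * g y)"
      unfolding A_def by (intro Bochner_Integration.integral_cong) (auto split: split_indicator)
    moreover have "\<dots> = b + pmf_mean s (\<lambda>y. indicator (- B) y * g y)"
      unfolding b_def by (rule Bochner_Integration.integral_add[OF gB_int])
    ultimately show ?thesis by simp
  qed
  \<comment> \<open>Otherwise \<open>g\<close> would be at most \<open>A / 2\<close> on all of
    \<open>B\<close>, and so would its mass there, against the three quarters just shown;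
    \<open>lam * ln 2\<close> encodes the factor one half.\<close>
  have ex: "\<exists>y\<in>B. cY_lo y + a - lam * ln 2 \<le> \<beta> y"
  proof (rule ccontr)
    assume "\<not> ?thesis"
    then have *: "\<beta> y - cY_lo y \<le> a - lam * ln 2" if "y \<in> B" for y using that by force
    have "g y \<le> A / 2" if "y \<in> B" for y
    proof -
      have "(\<beta> y - cY_lo y) / lam \<le> (a - lam * ln 2) / lam"
        using *[OF that] lam by (simp add: divide_right_mono)
      then have "g y \<le> exp (a / lam - ln 2)" using lam by (simp add: g_def diff_divide_distrib)
      then show ?thesis by (simp add: exp_diff expa)
    qed
    then have "b \<le> pmf_mean s (\<lambda>y. A / 2)"
      unfolding b_def using A by (intro integral_mono gB_int) (auto split: split_indicator)
    then show False using b_ge A by simp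
  qed
  \<comment> \<open>Restricting the first marginal equation to \<open>B\<close> replaces the
    exponential weight by its bound \<open>R\<close> there; the mass of at least
    \<open>A / 2\<close> on \<open>B\<close> gives the constant \<open>2 * R\<close>.\<close>
  have "\<alpha> x + a \<le> cX_hi x + lam * ln (2 * R)" for x
  proof -
    have "h x * (b / R) = pmf_mean s (\<lambda>y. h x / R * (indicator B y * g y))"
      using gB_int by (simp add: b_def)
    also have "\<dots> \<le> 1"
      unfolding E1[of x, symmetric]
    proof (intro integral_mono gi integrable_mult_right gB_int)
      fix y
      have "h x / R * (indicator B y * g y) \<le> h x * exp ((\<beta> y - cY_hi y) / lam)"
      proof (cases "y \<in> B")
        case True
        then have "g y \<le> exp ((\<beta> y - cY_hi y) / lam) * R"
          unfolding g_eq using R by (intro mult_left_mono) auto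
        then have "h x * g y \<le> h x * (exp ((\<beta> y - cY_hi y) / lam) * R)"
          by (intro mult_left_mono) (auto simp: h_def)
        then show ?thesis using True R(2) by (simp add: field_simps)
      qed (simp add: h_def)
      then show "h x / R * (indicator B y * g y) \<le> gibbs lam c \<alpha> \<beta> x y"
        using h_le[of x y] by linarith
    qed
    finally have "h x * (b / R) \<le> 1" .
    moreover have "h x * (A / (2 * R)) \<le> h x * (b / R)"
      using b_ge A R(2) by (intro mult_left_mono) (auto simp: h_def field_simps)
    ultimately have "h x * A \<le> 2 * R" using R(2) by (simp add: field_simps)
    then have "exp ((\<alpha> x - cX_hi x + a) / lam) \<le> exp (ln (2 * R))"
      using R(2) by (simp add: h_def expa[symmetric] add_divide_distrib exp_add)
    then show ?thesis using lam by (simp add: field_simps)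
  qed
  then show thesis using that lower upper ex by blast
qed

lemma finite_tail:
  fixes w :: "'a::countable \<Rightarrow> real"
  assumes w: "integrable M w" and M: "sets M = UNIV" and e: "0 < e"
  obtains B where "finite B" "(\<integral>x. indicator (- B) x * w x \<partial>M) < e"
proof -
  let ?B = "\<lambda>k. {x. to_nat x < (k::nat)}"
  have meas: "f \<in> borel_measurable M" for f :: "'a \<Rightarrow> real"
    by (auto simp: measurable_def M)
  have "(\<lambda>k. (\<integral>x. indicator (- ?B k) x * w x \<partial>M)) \<longlonglongrightarrow> (\<integral>x. 0 \<partial>M)"
  proof (rule integral_dominated_convergence[where w="\<lambda>x. \<bar>w x\<bar>"])
    show "AE x in M. (\<lambda>k. indicator (- ?B k) x * w x) \<longlonglongrightarrow> 0"
    proof (intro AE_I2 tendsto_eventually)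
      fix x show "eventually (\<lambda>k. indicator (- ?B k) x * w x = 0) sequentially"
        by (rule eventually_mono[OF eventually_gt_at_top[of "to_nat x"]]) auto
    qed
  qed (use w meas in \<open>auto split: split_indicator\<close>)
  then have "eventually (\<lambda>k. (\<integral>x. indicator (- ?B k) x * w x \<partial>M) < e) sequentially"
    using e by (intro order_tendstoD) auto
  then obtain k where "(\<integral>x. indicator (- ?B k) x * w x \<partial>M) < e"
    using eventually_happens by force
  moreover have "finite (?B k)"
    using finite_vimageI[of "{..<k}" to_nat] by (simp add: vimage_def)
  ultimately show thesis using that by blast
qed

section \<open>Bounds uniform over neighbourhoods in weighted \<open>l1\<close>\<close>

lemma expectation_le_wdist:
  fixes f :: "'a \<Rightarrow> real"
  assumes w: "\<And>x. \<bar>f x\<bar> \<le> w x" and q: "pmf_integrable q w" and d: "wdist w p q \<le> ennreal d" "0 \<le> d"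
  shows "pmf_integrable p w" "pmf_mean p f \<le> pmf_mean q f + d"
proof -
  show i: "pmf_integrable p w"
    using q d w by (intro integrable_of_wdist_finite[OF _ q]) (auto intro: le_less_trans order_trans[OF abs_ge_zero])
  have "ennreal \<bar>pmf_mean p f - pmf_mean q f\<bar> \<le> ennreal d"
    using abs_integral_diff_le_wdist[OF i q w] d(1) by (rule order_trans)
  then show "pmf_mean p f \<le> pmf_mean q f + d"
    using d(2) by simp
qed

text \<open>The constants in \<open>schroedinger_bounds\<close> see the laws only through a mean on
  \<open>X\<close> and a tail on \<open>Y\<close>. Both are stable in weighted \<open>l1\<close>, so
  one finite \<open>B\<close> and one \<open>K\<close> serve a whole neighbourhood; only the shift
  \<open>a\<close> depends on the solution.\<close>

lemma schroedinger_uniform_bounds: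
  fixes c :: "'x \<Rightarrow> 'y::countable \<Rightarrow> real"
  assumes lam: "0 < lam" and dom: "dominating c cX_lo cX_hi cY_lo cY_hi"
    and V: "pmf_integrable r V" "\<And>x. weight_C cX_lo cX_hi x \<le> V x"
    and U: "pmf_integrable s U" "\<And>y. weight_phi lam cY_lo cY_hi y \<le> U y"
  obtains K \<delta> :: real and B where "0 \<le> K" "0 < \<delta>" "finite B"
    "\<And>r' s' \<alpha> \<beta>. wdist V r' r < ennreal \<delta> \<Longrightarrow> wdist U s' s < ennreal \<delta> \<Longrightarrow> schroedinger lam c r' s' \<alpha> \<beta> \<Longrightarrow>
      \<exists>a. (\<forall>x. cX_lo x \<le> \<alpha> x + a \<and> \<alpha> x + a \<le> cX_hi x + K) \<and> (\<forall>y. \<beta> y \<le> cY_hi y + a + K) \<and>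
          (\<exists>y\<in>B. cY_lo y + a - K \<le> \<beta> y)"
proof -
  \<comment> \<open>The added 1 absorbs the change of the mean from \<open>r\<close> to
    \<open>r'\<close>. The 8 below allots one eighth to the tail under \<open>s\<close> and one
    eighth to the change to \<open>s'\<close>, together the quarter that
    \<open>schroedinger_bounds\<close> asks for.\<close>
  define K1 where "K1 = pmf_mean r (\<lambda>x. cX_hi x - cX_lo x) + 1"
  define e where "e = exp (- K1 / lam) / 8"
  have e: "0 < e" by (simp add: e_def)
  obtain B where B: "finite B" "pmf_mean s (\<lambda>y. indicator (- B) y * U y) < e"
    using finite_tail[OF U(1) sets_measure_pmf e] by blast
  \<comment> \<open>The inserted 1 keeps \<open>R\<close> positive even if \<open>B\<close> is
    empty.\<close>
  define R where "R = Max (insert 1 (weight_phi lam cY_lo cY_hi ` B))"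
  have R1: "1 \<le> R" and R: "\<And>y. y \<in> B \<Longrightarrow> weight_phi lam cY_lo cY_hi y \<le> R"
    using B(1) by (auto simp: R_def)
  define K where "K = Max {K1, lam * ln (2 * R), lam * ln 2, 0}"
  have K: "0 \<le> K" "K1 \<le> K" "lam * ln (2 * R) \<le> K" "lam * ln 2 \<le> K" by (auto simp: K_def)
  define \<delta> where "\<delta> = min 1 e"
  have V0: "0 \<le> V x" and Vabs: "\<bar>cX_hi x - cX_lo x\<bar> \<le> V x" "\<bar>cX_hi x\<bar> \<le> V x" "\<bar>cX_lo x\<bar> \<le> V x" for x
    using V(2)[of x] by (auto simp: weight_C_def)
  have U0: "0 \<le> U y" for y using U(2)[of y] weight_phi_pos[of lam cY_lo cY_hi y] by linarith
  show thesis
  proof (rule that[of K \<delta> B])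
    fix r' s' \<alpha> \<beta>
    assume r': "wdist V r' r < ennreal \<delta>" and s': "wdist U s' s < ennreal \<delta>" and schr: "schroedinger lam c r' s' \<alpha> \<beta>"
    have "wdist V r' r \<le> ennreal 1" "wdist U s' s \<le> ennreal e"
      using order_trans[OF less_imp_le[OF r'] ennreal_leI[of \<delta> 1]] order_trans[OF less_imp_le[OF s'] ennreal_leI[of \<delta> e]]
      by (simp_all add: \<delta>_def)
    note r' = expectation_le_wdist[OF Vabs(1) V(1) this(1) zero_le_one] and s' = expectation_le_wdist(1)[OF _ U(1) this(2)]
      and s'' = expectation_le_wdist(2)[OF _ U(1) this(2)]
    have Ui: "pmf_integrable s' U" using s'[of "\<lambda>_. 0"] U0 e by auto
    have "pmf_mean s' (\<lambda>y. indicator (- B) y * U y) \<le> pmf_mean s (\<lambda>y. indicator (- B) y * U y) + e"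
      using U0 e by (intro s'') (auto split: split_indicator)
    moreover have "pmf_mean s' (\<lambda>y. indicator (- B) y * weight_phi lam cY_lo cY_hi y)
        \<le> pmf_mean s' (\<lambda>y. indicator (- B) y * U y)"
      using U(2) U0 weight_phi_pos[of lam cY_lo cY_hi]
      by (intro integral_mono integrable_measure_pmf_bound[OF Ui]) (auto simp: less_imp_le split: split_indicator)
    ultimately have tl: "pmf_mean s' (\<lambda>y. indicator (- B) y * weight_phi lam cY_lo cY_hi y) \<le> exp (- K1 / lam) / 4"
      using B(2) by (simp add: e_def)
    have cX: "pmf_integrable r' cX_lo" "pmf_integrable r' cX_hi"
      using Vabs by (auto intro: integrable_measure_pmf_bound[OF r'(1)])
    have ph: "pmf_integrable s' (weight_phi lam cY_lo cY_hi)"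
      using U(2) weight_phi_pos[of lam cY_lo cY_hi] by (intro integrable_measure_pmf_bound[OF Ui]) (simp add: less_imp_le)
    have k1: "pmf_mean r' (\<lambda>x. cX_hi x - cX_lo x) \<le> K1"
      using r'(2) by (simp add: K1_def)
    have R0: "0 < R" using R1 by simp
    obtain a where a: "\<And>x. cX_lo x \<le> \<alpha> x + a" "\<And>x. \<alpha> x + a \<le> cX_hi x + lam * ln (2 * R)"
      "\<And>y. \<beta> y \<le> cY_hi y + a + K1" "\<exists>y\<in>B. cY_lo y + a - lam * ln 2 \<le> \<beta> y"
      using schroedinger_bounds[OF lam dom cX ph schr k1 tl R R0] by blast
    show "\<exists>a. (\<forall>x. cX_lo x \<le> \<alpha> x + a \<and> \<alpha> x + a \<le> cX_hi x + K) \<and> (\<forall>y. \<beta> y \<le> cY_hi y + a + K) \<and>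
          (\<exists>y\<in>B. cY_lo y + a - K \<le> \<beta> y)"
    proof (intro exI[of _ a] conjI allI)
      show "\<alpha> x + a \<le> cX_hi x + K" for x using a(2)[of x] K(3) by linarith
      show "\<beta> y \<le> cY_hi y + a + K" for y using a(3)[of y] K(2) by linarith
      show "\<exists>y\<in>B. cY_lo y + a - K \<le> \<beta> y" using a(4) K(4) by force
    qed (rule a(1))
  qed (use K B(1) e in \<open>auto simp: \<delta>_def\<close>)
qed

section \<open>Existence, compactness and uniqueness of potentials\<close>

text \<open>Truncation is conditioning on growing finite sets. All of them contain one fixed atom
  \<open>x0\<close>, so the normalising constants stay above \<open>pmf p x0\<close>, which provides
  the majorant for dominated convergence.\<close>

lemma pmf_truncations:
  fixes p :: "'a::countable pmf"
  assumes w: "\<And>x. 0 \<le> w x" "pmf_integrable p w"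
  obtains q where "\<And>k. finite (set_pmf (q k))" "(\<lambda>k. wdist w (q k) p) \<longlonglongrightarrow> 0"
proof -
  obtain x0 where x0: "x0 \<in> set_pmf p" using set_pmf_not_empty[of p] by blast
  define A where "A k = {x::'a. to_nat x < Suc (to_nat x0) + k}" for k
  define q where "q k = cond_pmf p (A k)" for k
  have A0: "x0 \<in> A k" for k by (simp add: A_def)
  then have ne: "set_pmf p \<inter> A k \<noteq> {}" for k using x0 by blast
  have fin: "finite (A k)" for k
    using finite_vimageI[of "{..<Suc (to_nat x0) + k}" to_nat] by (simp add: A_def vimage_def)
  have q: "pmf (q k) x = (if x \<in> A k then pmf p x / measure p (A k) else 0)" for k x
    unfolding q_def by (rule pmf_cond[OF ne])
  have m: "pmf p x0 \<le> measure p (A k)" "measure p (A k) \<le> 1" for k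
    using measure_pmf.finite_measure_mono[of "{x0}" "A k" p] A0 by (auto simp: measure_pmf_single)
  have p0: "0 < pmf p x0" using x0 by (simp add: pmf_positive)
  have "incseq A" by (auto simp: A_def incseq_def)
  moreover have "(\<Union>k. A k) = UNIV"
  proof -
    have "x \<in> A (to_nat x)" for x by (simp add: A_def)
    then show ?thesis by blast
  qed
  ultimately have lim1: "(\<lambda>k. measure p (A k)) \<longlonglongrightarrow> 1"
    using measure_pmf.finite_Lim_measure_incseq[of A p] by simp
  have "(\<lambda>k. wdist w (q k) p) \<longlonglongrightarrow> nn_integral (count_space UNIV) (\<lambda>x::'a. 0)"
    unfolding wdist_def
  proof (rule nn_integral_dominated_convergence[where u'="\<lambda>_. 0" and w="\<lambda>x. ennreal (w x * (1 + 1 / pmf p x0)) * ennreal (pmf p x)"])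
    fix k
    show "AE x in count_space UNIV. ennreal (w x * \<bar>pmf (q k) x - pmf p x\<bar>) \<le> ennreal (w x * (1 + 1 / pmf p x0)) * ennreal (pmf p x)"
    proof (intro AE_I2)
      fix x
      have "pmf p x / measure p (A k) \<le> pmf p x / pmf p x0"
        using m[of k] p0 by (intro divide_left_mono mult_pos_pos) auto
      moreover have "\<bar>(if b then u else 0) - t\<bar> \<le> t + v" if "0 \<le> u" "u \<le> v" "0 \<le> t" for b and u v t :: real
        using that by auto
      ultimately have "\<bar>pmf (q k) x - pmf p x\<bar> \<le> pmf p x + pmf p x / pmf p x0"
        unfolding q by simp
      then have "\<bar>pmf (q k) x - pmf p x\<bar> \<le> (1 + 1 / pmf p x0) * pmf p x"
        by (simp add: distrib_right)
      then have "w x * \<bar>pmf (q k) x - pmf p x\<bar> \<le> w x * ((1 + 1 / pmf p x0) * pmf p x)"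
        using w(1) by (rule mult_left_mono)
      then show "ennreal (w x * \<bar>pmf (q k) x - pmf p x\<bar>) \<le> ennreal (w x * (1 + 1 / pmf p x0)) * ennreal (pmf p x)"
        using w(1)[of x] p0 by (simp add: mult.assoc flip: ennreal_mult)
    qed
  next
    have "(\<integral>\<^sup>+x. ennreal (w x * (1 + 1 / pmf p x0)) * ennreal (pmf p x) \<partial>count_space UNIV)
        = (\<integral>\<^sup>+x. ennreal (w x * (1 + 1 / pmf p x0)) \<partial>measure_pmf p)"
      by (simp add: nn_integral_measure_pmf mult.commute)
    also have "\<dots> < \<infinity>"
      using integrable_mult_left[OF w(2), of "1 + 1 / pmf p x0"] w(1) p0
      unfolding integrable_iff_bounded by (simp add: abs_mult)
    finally show "(\<integral>\<^sup>+x. ennreal (w x * (1 + 1 / pmf p x0)) * ennreal (pmf p x) \<partial>count_space UNIV) < \<infinity>" .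
  next
    show "AE x in count_space UNIV. (\<lambda>k. ennreal (w x * \<bar>pmf (q k) x - pmf p x\<bar>)) \<longlonglongrightarrow> 0"
    proof (intro AE_I2)
      fix x
      have "(\<lambda>k. pmf p x / measure p (A k)) \<longlonglongrightarrow> pmf p x / 1"
        by (intro tendsto_intros lim1) simp
      moreover have "eventually (\<lambda>k. pmf (q k) x = pmf p x / measure p (A k)) sequentially"
        by (rule eventually_mono[OF eventually_ge_at_top[of "to_nat x"]]) (auto simp: q A_def)
      ultimately have "(\<lambda>k. pmf (q k) x) \<longlonglongrightarrow> pmf p x"
        by (simp add: tendsto_cong)
      then have "(\<lambda>k. ennreal (w x * \<bar>pmf (q k) x - pmf p x\<bar>)) \<longlonglongrightarrow> ennreal (w x * \<bar>pmf p x - pmf p x\<bar>)"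
        by (intro tendsto_intros)
      then show "(\<lambda>k. ennreal (w x * \<bar>pmf (q k) x - pmf p x\<bar>)) \<longlonglongrightarrow> 0" by simp
    qed
  qed auto
  moreover have "finite (set_pmf (q k))" for k
    unfolding q_def using fin[of k] by (simp add: set_cond_pmf[OF ne])
  ultimately show thesis using that[of q] by simp
qed

text \<open>The box is compact by Tychonoff; a product over a countable index is first countable, so
  compactness yields convergent subsequences.\<close>

lemma pointwise_bounded_subseq:
  fixes f :: "nat \<Rightarrow> 'a::countable \<Rightarrow> real"
  assumes "\<And>k x. \<bar>f k x\<bar> \<le> b x"
  obtains h g where "strict_mono h" "\<And>x. (\<lambda>k. f (h k) x) \<longlonglongrightarrow> g x"
proof -
  let ?S = "Pi\<^sub>E UNIV (\<lambda>x. {- b x..b x})"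
  have "compactin (product_topology (\<lambda>_. euclidean) UNIV) ?S"
    by (simp add: compactin_PiE)
  then have "compact ?S" by (simp add: euclidean_product_topology)
  then have "seq_compact ?S" by (rule compact_imp_seq_compact)
  moreover have "f k \<in> ?S" for k
    using assms[of k] by (auto simp: PiE_iff abs_le_iff minus_le_iff)
  ultimately obtain g h where h: "strict_mono h" "(f \<circ> h) \<longlonglongrightarrow> g"
    by (metis seq_compactE)
  have "(\<lambda>k. f (h k) x) \<longlonglongrightarrow> g x" for x
    using continuous_on_tendsto_compose[OF continuous_on_product_coordinates[of x] h(2)] by (simp add: comp_def)
  then show thesis using that h(1) by blast
qed

section \<open>From dual maximisers to solutions of the Schroedinger system\<close>

lemma schroedinger_shift:
  "schroedinger lam c r s \<alpha> \<beta> \<Longrightarrow> schroedinger lam c r s (\<lambda>x. \<alpha> x - t) (\<lambda>y. \<beta> y + t)"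
  by (simp add: schroedinger_def gibbs_def)

text \<open>Off the supports the equation itself defines the potential: the value is the entropic
  c-transform of the other potential. Altering \<open>\<alpha>\<close> outside the support of
  \<open>r\<close> leaves integrals over \<open>r\<close> unchanged, so the equations that held
  before survive.\<close>

lemma schroedinger_extend:
  assumes lam: "0 < lam"
    and E1: "\<And>x. x \<in> set_pmf r \<Longrightarrow> pmf_mean s (\<lambda>y. gibbs lam c \<alpha> \<beta> x y) = 1"
    and E2: "\<And>y. y \<in> set_pmf s \<Longrightarrow> pmf_mean r (\<lambda>x. gibbs lam c \<alpha> \<beta> x y) = 1"
    and i1: "\<And>x. pmf_integrable s (\<lambda>y. gibbs lam c (\<lambda>_. 0) \<beta> x y)"
    and i2: "\<And>y. pmf_integrable r (\<lambda>x. gibbs lam c \<alpha> (\<lambda>_. 0) x y)"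
  obtains \<alpha>' \<beta>' where "\<And>x. x \<in> set_pmf r \<Longrightarrow> \<alpha>' x = \<alpha> x" "\<And>y. y \<in> set_pmf s \<Longrightarrow> \<beta>' y = \<beta> y"
    "schroedinger lam c r s \<alpha>' \<beta>'"
proof -
  define \<alpha>' where "\<alpha>' x = (if x \<in> set_pmf r then \<alpha> x else
      - lam * ln (pmf_mean s (\<lambda>y. gibbs lam c (\<lambda>_. 0) \<beta> x y)))" for x
  define \<beta>' where "\<beta>' y = (if y \<in> set_pmf s then \<beta> y else
      - lam * ln (pmf_mean r (\<lambda>x. gibbs lam c \<alpha> (\<lambda>_. 0) x y)))" for y
  have split: "gibbs lam c a b x y = exp (a x / lam) * gibbs lam c (\<lambda>_. 0) b x y"
    "gibbs lam c a b x y = exp (b y / lam) * gibbs lam c a (\<lambda>_. 0) x y" for a b x y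
    by (simp_all add: gibbs_def diff_divide_distrib add_divide_distrib flip: exp_add)
  have "pmf_mean s (\<lambda>y. gibbs lam c \<alpha>' \<beta>' x y) = 1" for x
  proof -
    have "pmf_mean s (\<lambda>y. gibbs lam c \<alpha>' \<beta>' x y) = pmf_mean s (\<lambda>y. gibbs lam c \<alpha>' \<beta> x y)"
      by (intro integral_cong_AE) (auto simp: AE_measure_pmf_iff \<beta>'_def gibbs_def)
    also have "\<dots> = 1"
    proof (cases "x \<in> set_pmf r")
      case True
      then have "gibbs lam c \<alpha>' \<beta> x y = gibbs lam c \<alpha> \<beta> x y" for y by (simp add: gibbs_def \<alpha>'_def)
      then show ?thesis using E1[OF True] by simp
    next
      case False
      have "0 < pmf_mean s (\<lambda>y. gibbs lam c (\<lambda>_. 0) \<beta> x y)"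
        by (intro expectation_pos i1 gibbs_pos)
      then show ?thesis
        unfolding split(1)[of \<alpha>'] using False lam by (simp add: \<alpha>'_def exp_minus)
    qed
    finally show ?thesis .
  qed
  moreover have "pmf_mean r (\<lambda>x. gibbs lam c \<alpha>' \<beta>' x y) = 1" for y
  proof -
    have "pmf_mean r (\<lambda>x. gibbs lam c \<alpha>' \<beta>' x y) = pmf_mean r (\<lambda>x. gibbs lam c \<alpha> \<beta>' x y)"
      by (intro integral_cong_AE) (auto simp: AE_measure_pmf_iff \<alpha>'_def gibbs_def)
    also have "\<dots> = 1"
    proof (cases "y \<in> set_pmf s")
      case True
      then have "gibbs lam c \<alpha> \<beta>' x y = gibbs lam c \<alpha> \<beta> x y" for x by (simp add: gibbs_def \<beta>'_def)
      then show ?thesis using E2[OF True] by simp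
    next
      case False
      have "0 < pmf_mean r (\<lambda>x. gibbs lam c \<alpha> (\<lambda>_. 0) x y)"
        by (intro expectation_pos i2 gibbs_pos)
      then show ?thesis
        unfolding split(2)[of \<alpha> \<beta>'] using False lam by (simp add: \<beta>'_def exp_minus)
    qed
    finally show ?thesis .
  qed
  ultimately show thesis
    using that[of \<alpha>' \<beta>'] by (simp add: schroedinger_def \<alpha>'_def \<beta>'_def)
qed

text \<open>Supplies the integrability for \<open>schroedinger_extend\<close>: the second marginal
  equation bounds \<open>\<beta>\<close> by \<open>cY_hi\<close> plus a constant on the support, and
  the lower bound on \<open>c\<close> then leaves a multiple of the exponential weight.\<close>

lemma integrable_gibbs_of_marginal:
  assumes lam: "0 < lam" and dom: "dominating c cX_lo cX_hi cY_lo cY_hi"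
    and E2: "\<And>y. y \<in> set_pmf s \<Longrightarrow> pmf_mean r (\<lambda>x. gibbs lam c \<alpha> \<beta> x y) = 1"
    and phi: "pmf_integrable s (weight_phi lam cY_lo cY_hi)"
  shows "pmf_integrable s (\<lambda>y. gibbs lam c (\<lambda>_. 0) \<beta> x y)"
proof -
  define m where "m = pmf_mean r (\<lambda>x. exp ((\<alpha> x - cX_hi x) / lam))"
  note half = marginal_upper_bound[OF lam dom E2 set_pmf_not_empty[of s], folded m_def]
  have "pmf_integrable s (\<lambda>y. exp (- cX_lo x / lam) * (1 / m * weight_phi lam cY_lo cY_hi y))"
    using phi by simp
  then show ?thesis
  proof (rule Bochner_Integration.integrable_bound)
    show "AE y in measure_pmf s. norm (gibbs lam c (\<lambda>_. 0) \<beta> x y)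
        \<le> norm (exp (- cX_lo x / lam) * (1 / m * weight_phi lam cY_lo cY_hi y))"
      unfolding AE_measure_pmf_iff
    proof
      fix y assume y: "y \<in> set_pmf s"
      have "exp ((\<beta> y - cY_hi y) / lam) \<le> 1 / m" using half(2) half(3)[OF _ y] by (simp add: field_simps)
      then have "exp (- cX_lo x / lam) * (exp ((\<beta> y - cY_hi y) / lam) * weight_phi lam cY_lo cY_hi y)
          \<le> exp (- cX_lo x / lam) * (1 / m * weight_phi lam cY_lo cY_hi y)"
        by (intro mult_left_mono mult_right_mono) (auto simp: weight_phi_def)
      moreover have "(cX_lo x + cY_lo y) / lam \<le> c x y / lam"
        using dom lam by (intro divide_right_mono) (auto simp: dominating_def)
      then have "gibbs lam c (\<lambda>_. 0) \<beta> x y \<le> exp (- cX_lo x / lam) * (exp ((\<beta> y - cY_hi y) / lam) * weight_phi lam cY_lo cY_hi y)"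
        by (simp add: weight_phi_def gibbs_def add_divide_distrib diff_divide_distrib flip: exp_add)
      ultimately show "norm (gibbs lam c (\<lambda>_. 0) \<beta> x y)
        \<le> norm (exp (- cX_lo x / lam) * (1 / m * weight_phi lam cY_lo cY_hi y))"
        using half(2) gibbs_pos[of lam c "\<lambda>_. 0" \<beta> x y] weight_phi_pos[of lam cY_lo cY_hi y] by (simp add: abs_mult)
    qed
  qed simp
qed

text \<open>By shift invariance \<open>\<alpha>\<close> may be normalised to be nonpositive with maximum 0; the objective then tends
  to \<open>-\<infinity>\<close> with \<open>min \<alpha>\<close>, so a maximiser over a large box is a global one.\<close>
lemma finite_potentials_exist:
  fixes c :: "'x \<Rightarrow> 'y \<Rightarrow> real" and r :: "'x pmf" and s :: "'y pmf"
  assumes lam: "0 < lam" and fr: "finite (set_pmf r)" and fs: "finite (set_pmf s)"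
  obtains \<alpha> \<beta> where "EROT_potentials lam c r s \<alpha> \<beta>"
proof -
  let ?A = "set_pmf r" and ?B = "set_pmf s"
  define Z where "Z \<alpha> y = (\<Sum>x\<in>?A. exp ((\<alpha> x - c x y) / lam) * pmf r x)" for \<alpha> y
  \<comment> \<open>The dual objective with \<open>\<beta>\<close> eliminated: for given
    \<open>\<alpha>\<close> the best value at \<open>y\<close> is
    \<open>- lam * ln (Z \<alpha> y)\<close>.\<close>
  define \<Psi> where "\<Psi> \<alpha> = (\<Sum>x\<in>?A. \<alpha> x * pmf r x) + (\<Sum>y\<in>?B. (- lam * ln (Z \<alpha> y)) * pmf s y)" for \<alpha>
  have pos: "0 < pmf r x" if "x \<in> ?A" for x using that by (rule pmf_positive)
  have Z_ge: "exp ((\<alpha> x - c x y) / lam) * pmf r x \<le> Z \<alpha> y" if "x \<in> ?A" for \<alpha> x y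
    unfolding Z_def using fr that by (intro member_le_sum) auto
  have Z_pos: "0 < Z \<alpha> y" for \<alpha> y
    unfolding Z_def using fr pos set_pmf_not_empty by (intro sum_pos) auto
  have sum1: "(\<Sum>x\<in>?A. pmf r x) = 1" "(\<Sum>y\<in>?B. pmf s y) = 1"
    using fr fs by (simp_all add: sum_pmf_eq_1)
  have shift: "\<Psi> (\<lambda>x. \<alpha> x - t) = \<Psi> \<alpha>" for \<alpha> t
  proof -
    have "Z (\<lambda>x. \<alpha> x - t) y = exp (- t / lam) * Z \<alpha> y" for y
      unfolding Z_def sum_distrib_left
      by (intro sum.cong refl) (simp add: diff_divide_distrib flip: exp_add mult.assoc)
    then have *: "- lam * ln (Z (\<lambda>x. \<alpha> x - t) y) = t + (- lam * ln (Z \<alpha> y))" for y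
      using Z_pos[of \<alpha> y] lam by (simp add: ln_mult algebra_simps)
    have "(\<Sum>x\<in>?A. (\<alpha> x - t) * pmf r x) = (\<Sum>x\<in>?A. \<alpha> x * pmf r x) - t"
      using sum1 by (simp add: left_diff_distrib sum_subtractf flip: sum_distrib_left)
    moreover have "(\<Sum>y\<in>?B. (t + (- lam * ln (Z \<alpha> y))) * pmf s y) = t + (\<Sum>y\<in>?B. (- lam * ln (Z \<alpha> y)) * pmf s y)"
      using sum1 by (simp only: distrib_right sum.distrib flip: sum_distrib_left)
    ultimately show ?thesis unfolding \<Psi>_def * by simp
  qed
  have cong: "\<Psi> \<alpha> = \<Psi> \<alpha>'" if "\<And>x. x \<in> ?A \<Longrightarrow> \<alpha> x = \<alpha>' x" for \<alpha> \<alpha>'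
    using that by (simp add: \<Psi>_def Z_def cong: sum.cong)
  define \<rho> where "\<rho> = Min (pmf r ` ?A)"
  have \<rho>: "0 < \<rho>" "\<And>x. x \<in> ?A \<Longrightarrow> \<rho> \<le> pmf r x"
    using fr pos by (simp_all add: \<rho>_def Min_gr_iff set_pmf_not_empty)
  define D where "D = (\<Sum>y\<in>?B. (\<Sum>x\<in>?A. \<bar>c x y\<bar> + \<bar>lam * ln (pmf r x)\<bar>) * pmf s y)"
  \<comment> \<open>Chosen so that \<open>D - \<rho> * L\<close> is at most the value of
    \<open>\<Psi>\<close> at 0; a normalised function below \<open>- L\<close> somewhere on the
    support then cannot beat the zero function.\<close>
  define L where "L = \<bar>(D - \<Psi> (\<lambda>_. 0)) / \<rho>\<bar>"
  \<comment> \<open>In the linear part all terms are nonpositive and the one at \<open>x\<close> is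
    at most \<open>\<rho> * \<alpha> x\<close>. The point \<open>xM\<close> with value 0 keeps
    \<open>Z\<close> away from 0 and thus bounds the logarithmic part by \<open>D\<close>.\<close>
  have coercive: "\<Psi> \<alpha> \<le> D + \<rho> * \<alpha> x" if "\<And>x. x \<in> ?A \<Longrightarrow> \<alpha> x \<le> 0" "x \<in> ?A" "xM \<in> ?A" "\<alpha> xM = 0" for \<alpha> x xM
  proof -
    have "(\<Sum>x'\<in>?A - {x}. \<alpha> x' * pmf r x') \<le> 0"
      using that(1) by (intro sum_nonpos mult_nonpos_nonneg) auto
    then have "(\<Sum>x\<in>?A. \<alpha> x * pmf r x) \<le> \<alpha> x * pmf r x"
      using sum.remove[OF fr that(2), of "\<lambda>x. \<alpha> x * pmf r x"] by linarith
    also have "\<dots> \<le> \<rho> * \<alpha> x" using mult_left_mono_neg[OF \<rho>(2)[OF that(2)] that(1)[OF that(2)]] by (simp add: mult.commute)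
    finally have 1: "(\<Sum>x\<in>?A. \<alpha> x * pmf r x) \<le> \<rho> * \<alpha> x" .
    have "(\<Sum>y\<in>?B. (- lam * ln (Z \<alpha> y)) * pmf s y) \<le> D"
      unfolding D_def
    proof (intro sum_mono mult_right_mono pmf_nonneg)
      fix y
      have "ln (exp ((\<alpha> xM - c xM y) / lam) * pmf r xM) \<le> ln (Z \<alpha> y)"
        using Z_ge[OF that(3)] pos[OF that(3)] by (intro ln_mono) auto
      then have "- c xM y / lam + ln (pmf r xM) \<le> ln (Z \<alpha> y)"
        using pos[OF that(3)] that(4) by (simp add: ln_mult)
      then have "lam * (- c xM y / lam + ln (pmf r xM)) \<le> lam * ln (Z \<alpha> y)"
        using lam by (intro mult_left_mono) auto
      moreover have "lam * (- c xM y / lam + ln (pmf r xM)) = lam * ln (pmf r xM) - c xM y"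
        using lam by (simp add: field_simps)
      ultimately have "- lam * ln (Z \<alpha> y) \<le> c xM y - lam * ln (pmf r xM)"
        by simp
      also have "\<dots> \<le> \<bar>c xM y\<bar> + \<bar>lam * ln (pmf r xM)\<bar>" by simp
      also have "\<dots> \<le> (\<Sum>x\<in>?A. \<bar>c x y\<bar> + \<bar>lam * ln (pmf r x)\<bar>)"
        using fr that(3) by (intro member_le_sum[where f="\<lambda>x. \<bar>c x y\<bar> + \<bar>lam * ln (pmf r x)\<bar>"]) auto
      finally show "- lam * ln (Z \<alpha> y) \<le> (\<Sum>x\<in>?A. \<bar>c x y\<bar> + \<bar>lam * ln (pmf r x)\<bar>)" .
    qed
    with 1 show ?thesis by (simp add: \<Psi>_def)
  qed
  let ?S = "Pi\<^sub>E UNIV (\<lambda>x. {- L..L})"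
  have "compactin (product_topology (\<lambda>_. euclidean) UNIV) ?S"
    by (simp add: compactin_PiE)
  then have "compact ?S" by (simp add: euclidean_product_topology)
  moreover have "(\<lambda>_. 0) \<in> ?S" by (auto simp: L_def)
  moreover have "continuous_on ?S \<Psi>"
    unfolding \<Psi>_def Z_def
    using continuous_on_subset[OF continuous_on_product_coordinates, of ?S]
    by (intro continuous_intros) (use Z_pos lam in \<open>auto simp: Z_def less_imp_neq[symmetric]\<close>)
  ultimately obtain a where a: "a \<in> ?S" "\<And>\<alpha>. \<alpha> \<in> ?S \<Longrightarrow> \<Psi> \<alpha> \<le> \<Psi> a"
    using continuous_attains_sup[of ?S \<Psi>] by blast
  have max: "\<Psi> \<alpha> \<le> \<Psi> a" for \<alpha>
  proof -
    define M where "M = Max (\<alpha> ` ?A)"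
    have M: "\<And>x. x \<in> ?A \<Longrightarrow> \<alpha> x \<le> M" using fr by (simp add: M_def)
    have "M \<in> \<alpha> ` ?A" unfolding M_def using fr set_pmf_not_empty by (intro Max_in) auto
    then obtain xM where xM: "xM \<in> ?A" "\<alpha> xM = M" by auto
    \<comment> \<open>Coordinates outside the support do not influence \<open>\<Psi>\<close>; they
      are set to 0 because the compact box restricts every coordinate.\<close>
    define \<alpha>1 where "\<alpha>1 x = (if x \<in> ?A then \<alpha> x - M else 0)" for x
    have eq: "\<Psi> \<alpha> = \<Psi> \<alpha>1" using shift[of \<alpha> M] cong[of \<alpha>1 "\<lambda>x. \<alpha> x - M"] by (simp add: \<alpha>1_def)
    have neg: "\<alpha>1 x \<le> 0" for x using M by (simp add: \<alpha>1_def)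
    show ?thesis
    proof (cases "\<forall>x\<in>?A. - L \<le> \<alpha>1 x")
      case True
      have L0: "0 \<le> L" by (simp add: L_def)
      have "- L \<le> \<alpha>1 x" for x using True L0 by (cases "x \<in> ?A") (auto simp: \<alpha>1_def)
      moreover have "\<alpha>1 x \<le> L" for x using neg[of x] L0 by linarith
      ultimately have "\<alpha>1 \<in> ?S" by (simp add: PiE_iff)
      then show ?thesis unfolding eq by (rule a(2))
    next
      case False
      then obtain x where x: "x \<in> ?A" "\<alpha>1 x < - L" by auto
      have "\<alpha>1 xM = 0" using xM by (simp add: \<alpha>1_def)
      then have "\<Psi> \<alpha>1 \<le> D + \<rho> * \<alpha>1 x"
        by (intro coercive[OF neg x(1) xM(1)])
      also have "\<dots> \<le> D + \<rho> * (- L)" using x(2) \<rho>(1) by (intro add_left_mono mult_left_mono) auto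
      also have "\<dots> \<le> D + \<rho> * (- ((D - \<Psi> (\<lambda>_. 0)) / \<rho>))"
        unfolding L_def using \<rho>(1) by (intro add_left_mono mult_left_mono) (simp_all only: neg_le_iff_le abs_ge_self less_imp_le)
      also have "\<dots> = \<Psi> (\<lambda>_. 0)" using \<rho>(1) by simp
      also have "\<dots> \<le> \<Psi> a" by (rule a(2)) (auto simp: L_def)
      finally show ?thesis unfolding eq .
    qed
  qed
  define Q where "Q = (\<lambda>\<alpha> \<beta> (x, y). gibbs lam c \<alpha> \<beta> x y * (pmf r x * pmf s y))"
  have Q_eq: "integrable (count_space UNIV) (Q \<alpha> \<beta>)"
    "(\<integral>z. Q \<alpha> \<beta> z \<partial>count_space UNIV) = (\<Sum>y\<in>?B. exp (\<beta> y / lam) * Z \<alpha> y * pmf s y)" for \<alpha> \<beta>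
  proof -
    let ?g = "\<lambda>z. gibbs lam c \<alpha> \<beta> (fst z) (snd z)"
    have Q: "Q \<alpha> \<beta> = (\<lambda>z. pmf (pair_pmf r s) z * ?g z)"
      by (auto simp: Q_def fun_eq_iff pmf_pair)
    have fin: "finite (set_pmf (pair_pmf r s))" using fr fs by simp
    show "integrable (count_space UNIV) (Q \<alpha> \<beta>)"
      using integrable_measure_pmf_finite[OF fin, of ?g] by (simp only: Q integrable_measure_pmf_iff)
    have "(\<integral>z. Q \<alpha> \<beta> z \<partial>count_space UNIV) = pmf_mean (pair_pmf r s) ?g"
      by (simp only: Q integral_measure_pmf_count_space)
    also have "\<dots> = (\<Sum>z\<in>?A \<times> ?B. pmf (pair_pmf r s) z * ?g z)"
      using fr fs by (subst integral_measure_pmf[where A="?A \<times> ?B"]) auto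
    also have "\<dots> = (\<Sum>x\<in>?A. \<Sum>y\<in>?B. pmf r x * pmf s y * gibbs lam c \<alpha> \<beta> x y)"
      by (simp add: sum.cartesian_product pmf_pair_pmf_eq case_prod_unfold)
    also have "\<dots> = (\<Sum>y\<in>?B. \<Sum>x\<in>?A. pmf r x * pmf s y * gibbs lam c \<alpha> \<beta> x y)"
      by (rule sum.swap)
    also have "\<dots> = (\<Sum>y\<in>?B. exp (\<beta> y / lam) * Z \<alpha> y * pmf s y)"
      unfolding Z_def sum_distrib_left sum_distrib_right
    proof (intro sum.cong refl)
      fix x y
      have "gibbs lam c \<alpha> \<beta> x y = exp (\<beta> y / lam) * exp ((\<alpha> x - c x y) / lam)"
        by (simp add: gibbs_def diff_divide_distrib add_divide_distrib flip: exp_add)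
      then show "pmf r x * pmf s y * gibbs lam c \<alpha> \<beta> x y = exp (\<beta> y / lam) * (exp ((\<alpha> x - c x y) / lam) * pmf r x) * pmf s y"
        by simp
    qed
    finally show "(\<integral>z. Q \<alpha> \<beta> z \<partial>count_space UNIV) = (\<Sum>y\<in>?B. exp (\<beta> y / lam) * Z \<alpha> y * pmf s y)" .
  qed
  have er: "pmf_mean r \<alpha> = (\<Sum>x\<in>?A. \<alpha> x * pmf r x)" for \<alpha>
    using fr by (subst integral_measure_pmf_real[where A="?A"]) auto
  have es: "pmf_mean s \<beta> = (\<Sum>y\<in>?B. \<beta> y * pmf s y)" for \<beta>
    using fs by (subst integral_measure_pmf_real[where A="?B"]) auto
  have dual: "EROT_dual lam c r s \<alpha> \<beta> =
      ereal ((\<Sum>x\<in>?A. \<alpha> x * pmf r x) + (\<Sum>y\<in>?B. (\<beta> y - lam * (exp (\<beta> y / lam) * Z \<alpha> y - 1)) * pmf s y))" for \<alpha> \<beta>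
  proof -
    have "(\<Sum>y\<in>?B. (\<beta> y - lam * (exp (\<beta> y / lam) * Z \<alpha> y - 1)) * pmf s y)
        = (\<Sum>y\<in>?B. \<beta> y * pmf s y - lam * (exp (\<beta> y / lam) * Z \<alpha> y * pmf s y) + lam * pmf s y)"
      by (intro sum.cong refl) (simp add: algebra_simps)
    also have "\<dots> = (\<Sum>y\<in>?B. \<beta> y * pmf s y) - lam * ((\<Sum>y\<in>?B. exp (\<beta> y / lam) * Z \<alpha> y * pmf s y) - 1)"
      by (simp only: sum.distrib sum_subtractf sum1 right_diff_distrib flip: sum_distrib_left)
    finally show ?thesis
      using EROT_dual_eq[OF lam, of c r s \<alpha> \<beta>, folded Q_def] Q_eq[of \<alpha> \<beta>] by (simp add: er es Q_def)
  qed
  define b where "b y = - lam * ln (Z a y)" for y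
  have "exp (b y / lam) * Z a y = 1" for y
    using Z_pos[of a y] lam by (simp add: b_def exp_minus)
  then have ab: "EROT_dual lam c r s a b = ereal (\<Psi> a)"
    by (simp add: dual \<Psi>_def b_def)
  have "EROT_dual lam c r s \<alpha> \<beta> \<le> ereal (\<Psi> \<alpha>)" for \<alpha> \<beta>
  proof -
    have "\<beta> y - lam * (exp (\<beta> y / lam) * Z \<alpha> y - 1) \<le> - lam * ln (Z \<alpha> y)" for y
    proof -
      have "1 + (\<beta> y / lam + ln (Z \<alpha> y)) \<le> exp (\<beta> y / lam + ln (Z \<alpha> y))" by (rule exp_ge_add_one_self)
      also have "\<dots> = exp (\<beta> y / lam) * Z \<alpha> y" using Z_pos[of \<alpha> y] by (simp add: exp_add)
      finally have "lam * (1 + (\<beta> y / lam + ln (Z \<alpha> y))) \<le> lam * (exp (\<beta> y / lam) * Z \<alpha> y)"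
        using lam by (intro mult_left_mono) auto
      then show ?thesis using lam by (simp add: algebra_simps)
    qed
    then show ?thesis unfolding dual \<Psi>_def ereal_less_eq
      by (intro add_left_mono sum_mono mult_right_mono pmf_nonneg)
  qed
  then have "EROT_dual lam c r s \<alpha> \<beta> \<le> EROT_dual lam c r s a b" for \<alpha> \<beta>
    unfolding ab using max[of \<alpha>] by (meson ereal_less_eq(3) order_trans)
  then have "EROT_potentials lam c r s a b"
    using fr fs by (simp add: EROT_potentials_def l1_space_def integrable_measure_pmf_finite)
  then show thesis by (rule that)
qed

lemma nn_integral_pmf_swap:
  fixes f :: "'x \<Rightarrow> 'y \<Rightarrow> ennreal"
  shows "(\<integral>\<^sup>+x. \<integral>\<^sup>+y. f x y \<partial>measure_pmf s \<partial>measure_pmf r) = (\<integral>\<^sup>+y. \<integral>\<^sup>+x. f x y \<partial>measure_pmf r \<partial>measure_pmf s)"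
proof -
  have "(\<integral>\<^sup>+x. \<integral>\<^sup>+y. f x y \<partial>measure_pmf s \<partial>measure_pmf r) = (\<integral>\<^sup>+z. f (fst z) (snd z) \<partial>pair_pmf r s)"
    by (simp add: nn_integral_pair_pmf')
  also have "\<dots> = (\<integral>\<^sup>+z. f (snd z) (fst z) \<partial>pair_pmf s r)"
    by (subst pair_commute_pmf) (simp add: case_prod_unfold)
  finally show ?thesis by (simp add: nn_integral_pair_pmf')
qed

lemma le_weight_C:
  assumes "t \<le> weight_C lo hi x - 1 + L" "0 \<le> L"
  shows "t \<le> (L + 1) * weight_C lo hi x"
  using assms mult_left_mono[OF weight_C_ge_1[of lo hi x] assms(2)] by (simp add: distrib_right)

text \<open>The \<open>c\<close>-collection bounds \<open>\<alpha>\<close> from both sides and uses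
  the exponential weight on \<open>Y\<close>; the \<open>d\<close>-collection does the same for
  \<open>\<beta>\<close> with the exponential weight on \<open>X\<close>. This is why
  \<open>CX\<close> and \<open>CY\<close> come from different collections.\<close>

locale erot_costs =
  fixes lam :: real and c :: "'x::countable \<Rightarrow> 'y::countable \<Rightarrow> real"
    and cX_lo cX_hi dX_lo dX_hi :: "'x \<Rightarrow> real" and cY_lo cY_hi dY_lo dY_hi :: "'y \<Rightarrow> real"
  assumes lam: "0 < lam"
    and dom_c: "dominating c cX_lo cX_hi cY_lo cY_hi"
    and dom_d: "dominating c dX_lo dX_hi dY_lo dY_hi"
begin

abbreviation "CX \<equiv> weight_C cX_lo cX_hi"
abbreviation "CY \<equiv> weight_C dY_lo dY_hi"
abbreviation "schr \<equiv> schroedinger lam c"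
abbreviation "cost p q \<equiv> real_of_ereal (EROT lam c p q)"

definition WX :: "'x \<Rightarrow> real" where
  "WX x = CX x + weight_C dX_lo dX_hi x + weight_phi lam dX_lo dX_hi x"

definition WY :: "'y \<Rightarrow> real" where
  "WY y = weight_C cY_lo cY_hi y + CY y + weight_phi lam cY_lo cY_hi y"

lemma WX_ge:
  "CX x \<le> WX x" "weight_C dX_lo dX_hi x \<le> WX x" "weight_phi lam dX_lo dX_hi x \<le> WX x" "0 \<le> WX x"
  using weight_C_ge_1[of cX_lo cX_hi x] weight_C_ge_1[of dX_lo dX_hi x] weight_phi_pos[of lam dX_lo dX_hi x]
  by (simp_all add: WX_def)

lemma WY_ge:
  "weight_C cY_lo cY_hi y \<le> WY y" "CY y \<le> WY y" "weight_phi lam cY_lo cY_hi y \<le> WY y" "0 \<le> WY y"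
  using weight_C_ge_1[of cY_lo cY_hi y] weight_C_ge_1[of dY_lo dY_hi y] weight_phi_pos[of lam cY_lo cY_hi y]
  by (simp_all add: WY_def)

text \<open>Fixing \<open>\<alpha> x0 = 0\<close> bounds the shifts of both applications of
  \<open>schroedinger_uniform_bounds\<close>: \<open>a\<close> by evaluating at \<open>x0\<close>,
  and \<open>b\<close> by combining \<open>x0\<close> with the point of \<open>B\<close> where
  \<open>\<beta>\<close> is not too small. The last two one-sided bounds later dominate the Gibbs
  kernel by the exponential weights.\<close>

lemma potential_bounds:
  assumes r: "pmf_integrable r WX" and s: "pmf_integrable s WY"
  obtains K \<delta> :: real where "0 \<le> K" "0 < \<delta>"
    "\<And>r' s' \<alpha> \<beta>. wdist WX r' r < ennreal \<delta> \<Longrightarrow> wdist WY s' s < ennreal \<delta> \<Longrightarrow> schr r' s' \<alpha> \<beta> \<Longrightarrow> \<alpha> x0 = 0 \<Longrightarrow>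
      (\<forall>x. \<bar>\<alpha> x\<bar> \<le> K * CX x) \<and> (\<forall>y. \<bar>\<beta> y\<bar> \<le> K * CY y) \<and>
      (\<forall>x. \<alpha> x \<le> dX_hi x + K) \<and> (\<forall>y. \<beta> y \<le> cY_hi y + K)"
proof -
  obtain K1 \<delta>1 B where 1: "0 \<le> K1" "0 < \<delta>1" "finite B"
    "\<And>r' s' \<alpha> \<beta>. wdist WX r' r < ennreal \<delta>1 \<Longrightarrow> wdist WY s' s < ennreal \<delta>1 \<Longrightarrow> schr r' s' \<alpha> \<beta> \<Longrightarrow>
      \<exists>a. (\<forall>x. cX_lo x \<le> \<alpha> x + a \<and> \<alpha> x + a \<le> cX_hi x + K1) \<and> (\<forall>y. \<beta> y \<le> cY_hi y + a + K1) \<and>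
          (\<exists>y\<in>B. cY_lo y + a - K1 \<le> \<beta> y)"
    by (rule schroedinger_uniform_bounds[OF lam dom_c r WX_ge(1) s WY_ge(3)]) (rule that)
  obtain K2 \<delta>2 B2 where 2: "0 \<le> K2" "0 < \<delta>2" "finite B2"
    "\<And>s' r' \<beta> \<alpha>. wdist WY s' s < ennreal \<delta>2 \<Longrightarrow> wdist WX r' r < ennreal \<delta>2 \<Longrightarrow> schroedinger lam (\<lambda>y x. c x y) s' r' \<beta> \<alpha> \<Longrightarrow>
      \<exists>b. (\<forall>y. dY_lo y \<le> \<beta> y + b \<and> \<beta> y + b \<le> dY_hi y + K2) \<and> (\<forall>x. \<alpha> x \<le> dX_hi x + b + K2) \<and>
          (\<exists>x\<in>B2. dX_lo x + b - K2 \<le> \<alpha> x)"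
    by (rule schroedinger_uniform_bounds[OF lam dominating_swap[THEN iffD2, OF dom_d] s WY_ge(2) r WX_ge(3)]) (rule that)
  define A1 where "A1 = \<bar>cX_lo x0\<bar> + \<bar>cX_hi x0\<bar> + K1"
  \<comment> \<open>The good point of \<open>B\<close> varies with the pair of laws and the
    solution, hence the sum over all of \<open>B\<close>.\<close>
  define A2 where "A2 = \<bar>dX_hi x0\<bar> + (\<Sum>y\<in>B. \<bar>dY_hi y\<bar> + \<bar>cY_lo y\<bar>) + K1 + K2 + A1"
  define K where "K = (K1 + K2 + A1 + A2) + 1"
  have "0 \<le> (\<Sum>y\<in>B. \<bar>dY_hi y\<bar> + \<bar>cY_lo y\<bar>)" by (intro sum_nonneg) auto
  then have nonneg: "0 \<le> A1" "0 \<le> A2" using 1(1) 2(1) by (auto simp: A1_def A2_def)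
  show thesis
  proof (rule that[of K "min \<delta>1 \<delta>2"])
    fix r' s' \<alpha> \<beta>
    assume r': "wdist WX r' r < ennreal (min \<delta>1 \<delta>2)" and s': "wdist WY s' s < ennreal (min \<delta>1 \<delta>2)"
      and schr: "schr r' s' \<alpha> \<beta>" and x0: "\<alpha> x0 = 0"
    have less: "wdist WX r' r < ennreal \<delta>1" "wdist WY s' s < ennreal \<delta>1" "wdist WX r' r < ennreal \<delta>2" "wdist WY s' s < ennreal \<delta>2"
      using less_le_trans[OF r' ennreal_leI] less_le_trans[OF s' ennreal_leI] by simp_all
    obtain a y0 where a: "\<And>x. cX_lo x \<le> \<alpha> x + a" "\<And>x. \<alpha> x + a \<le> cX_hi x + K1" "\<And>y. \<beta> y \<le> cY_hi y + a + K1"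
      "y0 \<in> B" "cY_lo y0 + a - K1 \<le> \<beta> y0"
      using 1(4)[OF less(1,2) schr] by blast
    obtain b where b: "\<And>y. dY_lo y \<le> \<beta> y + b" "\<And>y. \<beta> y + b \<le> dY_hi y + K2" "\<And>x. \<alpha> x \<le> dX_hi x + b + K2"
      using 2(4)[OF less(4,3) schroedinger_swap[THEN iffD2, OF schr]] by blast
    have "\<bar>dY_hi y0\<bar> + \<bar>cY_lo y0\<bar> \<le> (\<Sum>y\<in>B. \<bar>dY_hi y\<bar> + \<bar>cY_lo y\<bar>)"
      using 1(3) a(4) by (intro member_le_sum[where f="\<lambda>y. \<bar>dY_hi y\<bar> + \<bar>cY_lo y\<bar>"]) auto
    moreover have a_le: "\<bar>a\<bar> \<le> A1" using a(1)[of x0] a(2)[of x0] x0 1(1) by (auto simp: A1_def)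
    moreover have "0 \<le> (\<Sum>y\<in>B. \<bar>dY_hi y\<bar> + \<bar>cY_lo y\<bar>)" by (intro sum_nonneg) auto
    ultimately have b_le: "\<bar>b\<bar> \<le> A2"
      using b(3)[of x0] b(2)[of y0] a(5) x0 1(1) 2(1) unfolding A2_def by linarith
    show "(\<forall>x. \<bar>\<alpha> x\<bar> \<le> K * CX x) \<and> (\<forall>y. \<bar>\<beta> y\<bar> \<le> K * CY y) \<and>
      (\<forall>x. \<alpha> x \<le> dX_hi x + K) \<and> (\<forall>y. \<beta> y \<le> cY_hi y + K)"
    proof (intro conjI allI)
      fix x
      have "\<bar>\<alpha> x\<bar> \<le> CX x - 1 + (K1 + K2 + A1 + A2)"
        using a(1,2)[of x] a_le nonneg 1(1) 2(1) by (auto simp: weight_C_def)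
      then show "\<bar>\<alpha> x\<bar> \<le> K * CX x"
        unfolding K_def using nonneg 1(1) 2(1) by (intro le_weight_C) auto
      show "\<alpha> x \<le> dX_hi x + K" using b(3)[of x] b_le nonneg 1(1) 2(1) unfolding K_def by linarith
    next
      fix y
      have "\<bar>\<beta> y\<bar> \<le> CY y - 1 + (K1 + K2 + A1 + A2)"
        using b(1,2)[of y] b_le nonneg 1(1) 2(1) by (auto simp: weight_C_def)
      then show "\<bar>\<beta> y\<bar> \<le> K * CY y"
        unfolding K_def using nonneg 1(1) 2(1) by (intro le_weight_C) auto
      show "\<beta> y \<le> cY_hi y + K" using a(3)[of y] a_le nonneg 1(1) 2(1) unfolding K_def by linarith
    qed
  qed (use 1 2 nonneg in \<open>auto simp: K_def\<close>)
qed

text \<open>Growth bounds give pointwise compactness. With one variable fixed, the potential in that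
  variable is bounded and the other one is bounded above by its dominating function, so the kernels
  are dominated by a multiple of \<open>WY\<close> or \<open>WX\<close> and the equations pass to
  the limit although the laws move.\<close>

lemma schroedinger_subsequence_limit:
  assumes r: "pmf_integrable r WX" and s: "pmf_integrable s WY"
    and rk: "(\<lambda>k. wdist WX (rk k) r) \<longlonglongrightarrow> 0" and sk: "(\<lambda>k. wdist WY (sk k) s) \<longlonglongrightarrow> 0"
    and schr: "\<And>k. schr (rk k) (sk k) (\<alpha> k) (\<beta> k)" and x0: "\<And>k. \<alpha> k x0 = 0"
  obtains h :: "nat \<Rightarrow> nat" and a b where "strict_mono h" "\<And>x. (\<lambda>k. \<alpha> (h k) x) \<longlonglongrightarrow> a x" "\<And>y. (\<lambda>k. \<beta> (h k) y) \<longlonglongrightarrow> b y"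
    "schr r s a b" "a x0 = 0"
proof -
  obtain K \<delta> where K: "0 \<le> K" "0 < \<delta>"
    "\<And>r' s' \<alpha> \<beta>. wdist WX r' r < ennreal \<delta> \<Longrightarrow> wdist WY s' s < ennreal \<delta> \<Longrightarrow> schr r' s' \<alpha> \<beta> \<Longrightarrow> \<alpha> x0 = 0 \<Longrightarrow>
      (\<forall>x. \<bar>\<alpha> x\<bar> \<le> K * CX x) \<and> (\<forall>y. \<bar>\<beta> y\<bar> \<le> K * CY y) \<and>
      (\<forall>x. \<alpha> x \<le> dX_hi x + K) \<and> (\<forall>y. \<beta> y \<le> cY_hi y + K)"
    by (rule potential_bounds[OF r s, of x0]) (rule that)
  have "eventually (\<lambda>k. wdist WX (rk k) r < ennreal \<delta> \<and> wdist WY (sk k) s < ennreal \<delta>) sequentially"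
    using rk sk K(2) by (intro eventually_conj order_tendstoD(2)) auto
  then obtain N where N: "\<And>k. N \<le> k \<Longrightarrow> wdist WX (rk k) r < ennreal \<delta>" "\<And>k. N \<le> k \<Longrightarrow> wdist WY (sk k) s < ennreal \<delta>"
    by (auto simp: eventually_sequentially)
  have bound: "\<bar>\<alpha> k x\<bar> \<le> K * CX x" "\<bar>\<beta> k y\<bar> \<le> K * CY y"
    "\<alpha> k x \<le> dX_hi x + K" "\<beta> k y \<le> cY_hi y + K" if "N \<le> k" for k x y
    using K(3)[OF N(1)[OF that] N(2)[OF that] schr x0] by auto
  \<comment> \<open>Both potentials are packed into one function on the sum type, so that one
    subsequence serves both; the offset \<open>N\<close> skips the indices at which the bounds may
    fail.\<close>
  define f where "f k = case_sum (\<alpha> (N + k)) (\<beta> (N + k))" for k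
  have f_le: "\<bar>f k z\<bar> \<le> case_sum (\<lambda>x. K * CX x) (\<lambda>y. K * CY y) z" for k z
    by (cases z) (simp_all add: f_def bound)
  obtain h g where h: "strict_mono h" "\<And>z. (\<lambda>k. f (h k) z) \<longlonglongrightarrow> g z"
    using pointwise_bounded_subseq[of f, OF f_le] by blast
  define h' where "h' k = N + h k" for k
  define a where "a x = g (Inl x)" for x
  define b where "b y = g (Inr y)" for y
  have h': "strict_mono h'" "\<And>k. N \<le> h' k" using h(1) by (auto simp: h'_def strict_mono_def)
  have a: "(\<lambda>k. \<alpha> (h' k) x) \<longlonglongrightarrow> a x" for x using h(2)[of "Inl x"] by (simp add: f_def h'_def a_def)
  have b: "(\<lambda>k. \<beta> (h' k) y) \<longlonglongrightarrow> b y" for y using h(2)[of "Inr y"] by (simp add: f_def h'_def b_def)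
  have gib: "(\<lambda>k. gibbs lam c (\<alpha> (h' k)) (\<beta> (h' k)) x y) \<longlonglongrightarrow> gibbs lam c a b x y" for x y
    unfolding gibbs_def using lam by (intro tendsto_intros a b) auto
  have c: "cX_lo x + cY_lo y \<le> c x y" "dX_lo x + dY_lo y \<le> c x y" for x y
    using dom_c dom_d by (auto simp: dominating_def)
  have "pmf_mean s (\<lambda>y. gibbs lam c a b x y) = 1" for x
  proof -
    define R where "R = exp ((K * CX x + K - cX_lo x) / lam)"
    have "(\<lambda>k. pmf_mean (sk (h' k)) (\<lambda>y. gibbs lam c (\<alpha> (h' k)) (\<beta> (h' k)) x y))
        \<longlonglongrightarrow> pmf_mean s (\<lambda>y. gibbs lam c a b x y)"
    proof (rule tendsto_expectation_wdist[where w="\<lambda>y. R * WY y"])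
      show "pmf_integrable s (\<lambda>y. R * WY y)" using s by simp
      have "(\<lambda>k. ennreal R * wdist WY (sk (h' k)) s) \<longlonglongrightarrow> ennreal R * 0"
        by (intro ennreal_tendsto_cmult LIMSEQ_subseq_LIMSEQ[OF sk h'(1), unfolded comp_def]) simp
      then show "(\<lambda>k. wdist (\<lambda>y. R * WY y) (sk (h' k)) s) \<longlonglongrightarrow> 0"
        by (simp add: wdist_cmult R_def)
      fix k y
      have "\<alpha> (h' k) x + \<beta> (h' k) y - c x y
          \<le> (K * CX x + K - cX_lo x) + (cY_hi y - cY_lo y)"
        using bound(1)[OF h'(2), of k x] bound(4)[OF h'(2), of k y] c(1)[of x y] by linarith
      then have "(\<alpha> (h' k) x + \<beta> (h' k) y - c x y) / lam
          \<le> ((K * CX x + K - cX_lo x) + (cY_hi y - cY_lo y)) / lam"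
        using lam by (intro divide_right_mono) auto
      then have "gibbs lam c (\<alpha> (h' k)) (\<beta> (h' k)) x y \<le> R * weight_phi lam cY_lo cY_hi y"
        unfolding gibbs_def R_def weight_phi_def exp_add[symmetric] add_divide_distrib[symmetric] exp_le_cancel_iff .
      also have "\<dots> \<le> R * WY y" by (intro mult_left_mono WY_ge) (simp add: R_def)
      finally show "\<bar>gibbs lam c (\<alpha> (h' k)) (\<beta> (h' k)) x y\<bar> \<le> R * WY y"
        using gibbs_pos[of lam c "\<alpha> (h' k)" "\<beta> (h' k)" x y] by simp
    qed (rule gib)
    then show ?thesis using schr by (simp add: schroedinger_def LIMSEQ_const_iff)
  qed
  moreover have "pmf_mean r (\<lambda>x. gibbs lam c a b x y) = 1" for y
  proof -
    define R where "R = exp ((K * CY y + K - dY_lo y) / lam)"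
    have "(\<lambda>k. pmf_mean (rk (h' k)) (\<lambda>x. gibbs lam c (\<alpha> (h' k)) (\<beta> (h' k)) x y))
        \<longlonglongrightarrow> pmf_mean r (\<lambda>x. gibbs lam c a b x y)"
    proof (rule tendsto_expectation_wdist[where w="\<lambda>x. R * WX x"])
      show "pmf_integrable r (\<lambda>x. R * WX x)" using r by simp
      have "(\<lambda>k. ennreal R * wdist WX (rk (h' k)) r) \<longlonglongrightarrow> ennreal R * 0"
        by (intro ennreal_tendsto_cmult LIMSEQ_subseq_LIMSEQ[OF rk h'(1), unfolded comp_def]) simp
      then show "(\<lambda>k. wdist (\<lambda>x. R * WX x) (rk (h' k)) r) \<longlonglongrightarrow> 0"
        by (simp add: wdist_cmult R_def)
      fix k x
      have "\<alpha> (h' k) x + \<beta> (h' k) y - c x y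
          \<le> (K * CY y + K - dY_lo y) + (dX_hi x - dX_lo x)"
        using bound(2)[OF h'(2), of k y] bound(3)[OF h'(2), of k x] c(2)[of x y] by linarith
      then have "(\<alpha> (h' k) x + \<beta> (h' k) y - c x y) / lam
          \<le> ((K * CY y + K - dY_lo y) + (dX_hi x - dX_lo x)) / lam"
        using lam by (intro divide_right_mono) auto
      then have "gibbs lam c (\<alpha> (h' k)) (\<beta> (h' k)) x y \<le> R * weight_phi lam dX_lo dX_hi x"
        unfolding gibbs_def R_def weight_phi_def exp_add[symmetric] add_divide_distrib[symmetric] exp_le_cancel_iff .
      also have "\<dots> \<le> R * WX x" by (intro mult_left_mono WX_ge) (simp add: R_def)
      finally show "\<bar>gibbs lam c (\<alpha> (h' k)) (\<beta> (h' k)) x y\<bar> \<le> R * WX x"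
        using gibbs_pos[of lam c "\<alpha> (h' k)" "\<beta> (h' k)" x y] by simp
    qed (rule gib)
    then show ?thesis using schr by (simp add: schroedinger_def LIMSEQ_const_iff)
  qed
  ultimately have "schr r s a b" by (simp add: schroedinger_def)
  moreover have "a x0 = 0" using a[of x0] x0 by (simp add: LIMSEQ_const_iff)
  ultimately show thesis using that[of h' a b, OF h'(1) a b] by simp
qed

text \<open>Maximality gives the equations on the supports only, one family directly and the other
  by exchanging the roles of \<open>X\<close> and \<open>Y\<close>; the extension lemma completes
  them.\<close>

lemma schroedinger_of_potentials:
  assumes r: "pmf_integrable r WX" and s: "pmf_integrable s WY"
    and pot: "EROT_potentials lam c r s \<alpha> \<beta>"
  obtains a b where "\<And>x. x \<in> set_pmf r \<Longrightarrow> a x = \<alpha> x" "\<And>y. y \<in> set_pmf s \<Longrightarrow> b y = \<beta> y" "schr r s a b"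
proof -
  have lo: "pmf_integrable r cX_lo" "pmf_integrable s cY_lo"
    using WX_ge(1) WY_ge(1)
    by (auto intro!: integrable_measure_pmf_bound[OF r] integrable_measure_pmf_bound[OF s] order_trans[OF _ WX_ge(1)] order_trans[OF _ WY_ge(1)] simp: weight_C_def)
  have "\<bar>weight_phi lam cY_lo cY_hi y\<bar> \<le> WY y" "\<bar>weight_phi lam dX_lo dX_hi x\<bar> \<le> WX x" for x y
    using WX_ge(3)[of x] WY_ge(3)[of y] weight_phi_pos[of lam cY_lo cY_hi y] weight_phi_pos[of lam dX_lo dX_hi x]
    by linarith+
  then have phi: "pmf_integrable s (weight_phi lam cY_lo cY_hi)" "pmf_integrable r (weight_phi lam dX_lo dX_hi)"
    using integrable_measure_pmf_bound[OF s] integrable_measure_pmf_bound[OF r] by blast+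
  have E1: "pmf_mean s (\<lambda>y. gibbs lam c \<alpha> \<beta> x y) = 1" if "x \<in> set_pmf r" for x
    using EROT_potentials_imp_marginal[OF lam dom_c lo pot that] .
  have E2: "pmf_mean r (\<lambda>x. gibbs lam c \<alpha> \<beta> x y) = 1" if "y \<in> set_pmf s" for y
    using EROT_potentials_imp_marginal[OF lam dominating_swap[THEN iffD2, OF dom_c] lo(2,1) EROT_potentials_swap[THEN iffD2, OF pot] that]
    by (simp add: gibbs_swap[of lam c])
  have i1: "pmf_integrable s (\<lambda>y. gibbs lam c (\<lambda>_. 0) \<beta> x y)" for x
    using integrable_gibbs_of_marginal[OF lam dom_c E2 phi(1)] .
  have i2: "pmf_integrable r (\<lambda>x. gibbs lam c \<alpha> (\<lambda>_. 0) x y)" for y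
    using integrable_gibbs_of_marginal[OF lam dominating_swap[THEN iffD2, OF dom_d], of r s \<beta> \<alpha> y] E1 phi(2)
    by (simp add: gibbs_swap[of lam c])
  show thesis using schroedinger_extend[OF lam E1 E2 i1 i2] that by blast
qed

text \<open>Maximisers exist for truncations with finite support; their normalised extensions have a
  limit that solves the system for \<open>(r, s)\<close>.\<close>

lemma schroedinger_exists:
  assumes r: "pmf_integrable r WX" and s: "pmf_integrable s WY"
  obtains \<alpha> \<beta> where "schr r s \<alpha> \<beta>" "\<alpha> x0 = 0"
proof -
  obtain rk where rk: "\<And>k. finite (set_pmf (rk k))" "(\<lambda>k. wdist WX (rk k) r) \<longlonglongrightarrow> 0"
    by (rule pmf_truncations[OF WX_ge(4) r]) (rule that)
  obtain sk where sk: "\<And>k. finite (set_pmf (sk k))" "(\<lambda>k. wdist WY (sk k) s) \<longlonglongrightarrow> 0"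
    by (rule pmf_truncations[OF WY_ge(4) s]) (rule that)
  have ex: "\<forall>k. \<exists>\<alpha> \<beta>. schr (rk k) (sk k) \<alpha> \<beta> \<and> \<alpha> x0 = 0"
  proof
    fix k
    obtain \<alpha> \<beta> where pot: "EROT_potentials lam c (rk k) (sk k) \<alpha> \<beta>"
      by (rule finite_potentials_exist[OF lam rk(1) sk(1)])
    obtain a b where ab: "schr (rk k) (sk k) a b"
      by (rule schroedinger_of_potentials[OF integrable_measure_pmf_finite[OF rk(1)] integrable_measure_pmf_finite[OF sk(1)] pot])
    show "\<exists>\<alpha> \<beta>. schr (rk k) (sk k) \<alpha> \<beta> \<and> \<alpha> x0 = 0"
      by (intro exI[of _ "\<lambda>x. a x - a x0"] exI[of _ "\<lambda>y. b y + a x0"] conjI schroedinger_shift ab) simp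
  qed
  obtain \<alpha> where \<alpha>: "\<forall>k. \<exists>\<beta>. schr (rk k) (sk k) (\<alpha> k) \<beta> \<and> \<alpha> k x0 = 0"
    using choice[OF ex] by blast
  obtain \<beta> where \<beta>: "\<forall>k. schr (rk k) (sk k) (\<alpha> k) (\<beta> k) \<and> \<alpha> k x0 = 0"
    using choice[OF \<alpha>] by blast
  show thesis
    by (rule schroedinger_subsequence_limit[OF r s rk(2) sk(2) \<beta>[THEN spec, THEN conjunct1] \<beta>[THEN spec, THEN conjunct2]]) (rule that)
qed

lemma potential_growth:
  assumes r: "pmf_integrable r WX" and s: "pmf_integrable s WY"
    and schr: "schr r s \<alpha> \<beta>"
  obtains K where "0 \<le> K" "\<And>x. \<bar>\<alpha> x\<bar> \<le> K * CX x" "\<And>y. \<bar>\<beta> y\<bar> \<le> K * CY y"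
proof -
  let ?x = "undefined :: 'x"
  obtain K \<delta> where K: "0 \<le> K" "0 < \<delta>"
    "\<And>r' s' \<alpha> \<beta>. wdist WX r' r < ennreal \<delta> \<Longrightarrow> wdist WY s' s < ennreal \<delta> \<Longrightarrow> schr r' s' \<alpha> \<beta> \<Longrightarrow> \<alpha> ?x = 0 \<Longrightarrow>
      (\<forall>x. \<bar>\<alpha> x\<bar> \<le> K * CX x) \<and> (\<forall>y. \<bar>\<beta> y\<bar> \<le> K * CY y) \<and>
      (\<forall>x. \<alpha> x \<le> dX_hi x + K) \<and> (\<forall>y. \<beta> y \<le> cY_hi y + K)"
    by (rule potential_bounds[OF r s, of ?x]) (rule that)
  have *: "\<bar>\<alpha> x - \<alpha> ?x\<bar> \<le> K * CX x" "\<bar>\<beta> y + \<alpha> ?x\<bar> \<le> K * CY y" for x y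
    using K(3)[OF _ _ schroedinger_shift[OF schr, of "\<alpha> ?x"]] K(2) by (auto simp: wdist_self)
  let ?K = "K + \<bar>\<alpha> ?x\<bar>"
  have le: "\<bar>\<alpha> ?x\<bar> \<le> \<bar>\<alpha> ?x\<bar> * weight_C lo hi z" for lo hi :: "'c \<Rightarrow> real" and z
    using mult_left_mono[OF weight_C_ge_1, of "\<bar>\<alpha> ?x\<bar>"] by simp
  show thesis
  proof (rule that[of ?K])
    show "\<bar>\<alpha> x\<bar> \<le> ?K * CX x" for x
      using *(1)[of x] le[of cX_lo cX_hi x] unfolding distrib_right by linarith
    show "\<bar>\<beta> y\<bar> \<le> ?K * CY y" for y
      using *(2)[of y] le[of dY_lo dY_hi y] unfolding distrib_right by linarith
  qed (use K(1) in simp)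
qed

lemma potentials_integrable:
  assumes r: "pmf_integrable r WX" and s: "pmf_integrable s WY"
    and schr: "schr r s \<alpha> \<beta>"
  shows "pmf_integrable r' WX \<Longrightarrow> pmf_integrable r' \<alpha>"
    and "pmf_integrable s' WY \<Longrightarrow> pmf_integrable s' \<beta>"
proof -
  obtain K where K: "0 \<le> K" "\<And>x. \<bar>\<alpha> x\<bar> \<le> K * CX x" "\<And>y. \<bar>\<beta> y\<bar> \<le> K * CY y"
    by (rule potential_growth[OF r s schr]) (rule that)
  have le: "\<bar>\<alpha> x\<bar> \<le> K * WX x" "\<bar>\<beta> y\<bar> \<le> K * WY y" for x y
    by (rule order_trans[OF K(2) mult_left_mono[OF WX_ge(1) K(1)]], rule order_trans[OF K(3) mult_left_mono[OF WY_ge(2) K(1)]])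
  show "pmf_integrable r' \<alpha>" if "pmf_integrable r' WX"
    by (rule integrable_measure_pmf_bound[OF integrable_mult_right[OF that] le(1)])
  show "pmf_integrable s' \<beta>" if "pmf_integrable s' WY"
    by (rule integrable_measure_pmf_bound[OF integrable_mult_right[OF that] le(2)])
qed

text \<open>For the couplings \<open>\<pi>\<close>, \<open>\<pi>'\<close> of two solutions, \<open>\<integral> (ln \<pi>' - ln \<pi>) d(\<pi>' - \<pi>)\<close> vanishes because the integrand
  only depends on the common marginals, while each summand is nonnegative.\<close>
lemma schroedinger_unique:
  assumes r: "pmf_integrable r WX" and s: "pmf_integrable s WY"
    and S: "schr r s \<alpha> \<beta>" and S': "schr r s \<alpha>' \<beta>'" and x0: "\<alpha>' x0 = \<alpha> x0"
  shows "\<alpha>' = \<alpha>" "\<beta>' = \<beta>"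
proof -
  obtain \<pi> where \<pi>: "\<pi> \<in> couplings r s" "\<And>x y. pmf \<pi> (x, y) = gibbs lam c \<alpha> \<beta> x y * (pmf r x * pmf s y)"
    using schroedinger_coupling[OF S] by blast
  obtain \<pi>' where \<pi>': "\<pi>' \<in> couplings r s" "\<And>x y. pmf \<pi>' (x, y) = gibbs lam c \<alpha>' \<beta>' x y * (pmf r x * pmf s y)"
    using schroedinger_coupling[OF S'] by blast
  define f where "f = (\<lambda>x. \<alpha>' x - \<alpha> x)"
  define g where "g = (\<lambda>y. \<beta>' y - \<beta> y)"
  have fg: "pmf_integrable r f" "pmf_integrable s g"
    unfolding f_def g_def using potentials_integrable[OF r s S] potentials_integrable[OF r s S'] r s
    by (auto intro!: Bochner_Integration.integrable_diff)
  let ?u = "\<lambda>z. f (fst z) + g (snd z)"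
  note u = integral_coupling_sum[OF \<pi>(1) fg, unfolded integrable_measure_pmf_iff integral_measure_pmf_count_space]
  note u' = integral_coupling_sum[OF \<pi>'(1) fg, unfolded integrable_measure_pmf_iff integral_measure_pmf_count_space]
  have ratio: "gibbs lam c \<alpha>' \<beta>' x y = exp ((f x + g y) / lam) * gibbs lam c \<alpha> \<beta> x y" for x y
  proof -
    have "\<alpha>' x + \<beta>' y - c x y = (f x + g y) + (\<alpha> x + \<beta> y - c x y)" by (simp add: f_def g_def)
    then show ?thesis by (simp only: gibbs_def add_divide_distrib[of "f x + g y" "\<alpha> x + \<beta> y - c x y"] exp_add)
  qed
  have diff: "pmf \<pi>' z * ?u z - pmf \<pi> z * ?u z = ((exp (?u z / lam) - 1) * ?u z) * pmf \<pi> z" for z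
    by (cases z) (simp add: \<pi>(2) \<pi>'(2) ratio algebra_simps)
  have nonneg: "0 \<le> (exp (t / lam) - 1) * t" for t
    using lam by (cases "0 \<le> t") (auto simp: mult_nonneg_nonneg mult_nonpos_nonpos divide_nonpos_pos)
  have zero: "(exp (t / lam) - 1) * t = 0 \<Longrightarrow> t = 0" for t using lam by auto
  let ?d = "\<lambda>z. ((exp (?u z / lam) - 1) * ?u z) * pmf \<pi> z"
  have d_int: "integrable (count_space UNIV) ?d"
    unfolding diff[symmetric] by (rule Bochner_Integration.integrable_diff[OF u'(1) u(1)])
  have "(\<integral>z. pmf \<pi>' z * ?u z - pmf \<pi> z * ?u z \<partial>count_space UNIV)
      = (\<integral>z. pmf \<pi>' z * ?u z \<partial>count_space UNIV) - (\<integral>z. pmf \<pi> z * ?u z \<partial>count_space UNIV)"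
    by (rule Bochner_Integration.integral_diff[OF u'(1) u(1)])
  also have "\<dots> = 0" using u(2) u'(2) by linarith
  finally have d_zero: "(\<integral>z. ?d z \<partial>count_space UNIV) = 0" by (simp only: diff)
  have d_nonneg: "AE z in count_space UNIV. 0 \<le> ?d z"
    by (intro AE_I2 mult_nonneg_nonneg[OF nonneg pmf_nonneg])
  have uz: "?d z = 0" for z
    using integral_nonneg_eq_0_iff_AE[OF d_int d_nonneg] d_zero unfolding AE_count_space by blast
  have u0: "f x + g y = 0" if "x \<in> set_pmf r" "y \<in> set_pmf s" for x y
  proof -
    have "0 < pmf \<pi> (x, y)"
      unfolding \<pi>(2) using that by (intro mult_pos_pos gibbs_pos pmf_positive)
    moreover have "((exp ((f x + g y) / lam) - 1) * (f x + g y)) * pmf \<pi> (x, y) = 0"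
      using uz[of "(x, y)"] by (simp only: fst_conv snd_conv)
    ultimately have "(exp ((f x + g y) / lam) - 1) * (f x + g y) = 0"
      using no_zero_divisors[of "(exp ((f x + g y) / lam) - 1) * (f x + g y)" "pmf \<pi> (x, y)"] by linarith
    then show ?thesis by (rule zero)
  qed
  obtain x1 where x1: "x1 \<in> set_pmf r" using set_pmf_not_empty[of r] by blast
  \<comment> \<open>On the support of \<open>s\<close>, \<open>g\<close> equals
    \<open>- f x1\<close>. The first marginal equation at an arbitrary \<open>x\<close> then forces
    \<open>f x = f x1\<close>, so the identity leaves the support and the normalisation point
    \<open>x0\<close> may be any point.\<close>
  have f: "f x = f x1" for x
  proof -
    have "1 = pmf_mean s (\<lambda>y. gibbs lam c \<alpha>' \<beta>' x y)" using S' by (simp add: schroedinger_def)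
    also have "\<dots> = pmf_mean s (\<lambda>y. exp ((f x - f x1) / lam) * gibbs lam c \<alpha> \<beta> x y)"
    proof (intro integral_cong_AE)
      show "AE y in measure_pmf s. gibbs lam c \<alpha>' \<beta>' x y = exp ((f x - f x1) / lam) * gibbs lam c \<alpha> \<beta> x y"
        unfolding AE_measure_pmf_iff
      proof
        fix y assume "y \<in> set_pmf s"
        then have "f x + g y = f x - f x1" using u0[OF x1, of y] by linarith
        then show "gibbs lam c \<alpha>' \<beta>' x y = exp ((f x - f x1) / lam) * gibbs lam c \<alpha> \<beta> x y"
          using ratio[of x y] by (simp only:)
      qed
    qed simp_all
    also have "\<dots> = exp ((f x - f x1) / lam) * pmf_mean s (gibbs lam c \<alpha> \<beta> x)"
      by (rule integral_mult_right_zero)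
    also have "\<dots> = exp ((f x - f x1) / lam)" using S by (simp add: schroedinger_def)
    finally have "exp ((f x - f x1) / lam) = 1" ..
    then have "(f x - f x1) / lam = 0" unfolding exp_eq_one_iff .
    then show ?thesis using lam by (simp only: divide_eq_0_iff eq_iff_diff_eq_0[of "f x"]) simp
  qed
  have f0: "f x = 0" for x using f[of x] f[of x0] x0 by (simp add: f_def)
  then show "\<alpha>' = \<alpha>" by (auto simp: f_def)
  have "g y = 0" for y
  proof -
    have "1 = pmf_mean r (\<lambda>x. gibbs lam c \<alpha>' \<beta>' x y)" using S' by (simp add: schroedinger_def)
    also have "\<dots> = exp (g y / lam)" using S by (simp add: ratio f0 schroedinger_def)
    finally have "exp (g y / lam) = 1" ..
    then have "g y / lam = 0" unfolding exp_eq_one_iff .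
    then show ?thesis using lam by simp
  qed
  then show "\<beta>' = \<beta>" by (auto simp: g_def)
qed

end

section \<open>Linearisation of the optimal value\<close>

text \<open>The weight has the shape of the later bound on \<open>\<alpha>' - \<alpha>\<close>:
  small on a finite set, only bounded outside. Half of \<open>\<eta>\<close> pays for the finite set
  through \<open>\<epsilon>\<close>, half for the tail; the additions of 1 avoid dividing by
  zero.\<close>

lemma small_weight:
  fixes C :: "'a::countable \<Rightarrow> real"
  assumes q: "integrable (count_space UNIV) (\<lambda>x. C x * sqrt (pmf p x))" and C: "\<And>x. 0 \<le> C x"
    and K: "0 \<le> K" and \<eta>: "0 < \<eta>"
  obtains \<epsilon> A where "0 < \<epsilon>" "finite A"
    "(\<integral>\<^sup>+x. ennreal ((if x \<in> A then \<epsilon> * C x else K * C x) * sqrt (pmf p x)) \<partial>count_space UNIV) \<le> ennreal \<eta>"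
proof -
  let ?q = "\<lambda>x. C x * sqrt (pmf p x)"
  define I where "I = (\<integral>x. ?q x \<partial>count_space UNIV)"
  have q0: "0 \<le> ?q x" for x using C by simp
  have I0: "0 \<le> I" unfolding I_def by (intro integral_nonneg_AE AE_I2 q0)
  define \<epsilon> where "\<epsilon> = \<eta> / (2 * (I + 1))"
  have \<epsilon>: "0 < \<epsilon>" "\<epsilon> * I \<le> \<eta> / 2"
    using I0 \<eta> by (auto simp: \<epsilon>_def field_simps)
  have e: "0 < \<eta> / (2 * (K + 1))" using \<eta> K by simp
  obtain A where A: "finite A" "(\<integral>x. indicator (- A) x * ?q x \<partial>count_space UNIV) < \<eta> / (2 * (K + 1))"
    by (rule finite_tail[OF q _ e]) (auto intro: that)
  have ti: "integrable (count_space UNIV) (\<lambda>x. indicator (- A) x * ?q x)"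
    by (rule Bochner_Integration.integrable_bound[OF q]) (auto split: split_indicator)
  have t0: "0 \<le> indicator (- A) x * ?q x" for x using q0[of x] by (simp split: split_indicator)
  have "(\<integral>\<^sup>+x. ennreal ((if x \<in> A then \<epsilon> * C x else K * C x) * sqrt (pmf p x)) \<partial>count_space UNIV)
      \<le> (\<integral>\<^sup>+x. ennreal (\<epsilon> * ?q x + K * (indicator (- A) x * ?q x)) \<partial>count_space UNIV)"
    using \<epsilon>(1) C by (intro nn_integral_mono ennreal_leI) (auto split: split_indicator)
  also have "\<dots> = ennreal (\<integral>x. \<epsilon> * ?q x + K * (indicator (- A) x * ?q x) \<partial>count_space UNIV)"
    using \<epsilon>(1) K q0 t0 by (intro nn_integral_eq_integral Bochner_Integration.integrable_add integrable_mult_right q ti AE_I2 add_nonneg_nonneg mult_nonneg_nonneg t0 C) auto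
  also have "(\<integral>x. \<epsilon> * ?q x + K * (indicator (- A) x * ?q x) \<partial>count_space UNIV)
      = \<epsilon> * I + K * (\<integral>x. indicator (- A) x * ?q x \<partial>count_space UNIV)"
    using q ti by (simp add: I_def)
  also have "ennreal \<dots> \<le> ennreal \<eta>"
  proof (rule ennreal_leI)
    have "K * (\<integral>x. indicator (- A) x * ?q x \<partial>count_space UNIV) \<le> K * (\<eta> / (2 * (K + 1)))"
      using A(2) K by (intro mult_left_mono) auto
    also have "\<dots> \<le> \<eta> / 2" using K \<eta> by (simp add: field_simps)
    finally show "\<epsilon> * I + K * (\<integral>x. indicator (- A) x * ?q x \<partial>count_space UNIV) \<le> \<eta>" using \<epsilon>(2) by simp
  qed
  finally show thesis using that[OF \<epsilon>(1) A(1)] by simp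
qed

lemma ennreal_abs_between:
  fixes D :: real
  assumes "l \<le> D" "D \<le> u" "ennreal \<bar>l\<bar> \<le> W" "ennreal \<bar>u\<bar> \<le> W"
  shows "ennreal \<bar>D\<bar> \<le> W"
proof -
  have "\<bar>D\<bar> \<le> max \<bar>l\<bar> \<bar>u\<bar>" using assms by linarith
  then have "ennreal \<bar>D\<bar> \<le> ennreal (max \<bar>l\<bar> \<bar>u\<bar>)" by (rule ennreal_leI)
  also have "\<dots> \<le> W" using assms(3,4) by (metis max_def)
  finally show ?thesis .
qed

lemma integrable_of_wdist_less:
  assumes "\<And>x. 0 \<le> w x" "pmf_integrable q w" "wdist w p q < ennreal d"
  shows "pmf_integrable p w"
  using assms(3) by (intro integrable_of_wdist_finite[OF assms(1,2)]) (auto intro: less_trans)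

context erot_costs
begin

text \<open>Counterexamples for radii \<open>1 / (k + 1)\<close> would have a subsequence converging
  pointwise to a normalised solution for \<open>(r, s)\<close>. Uniqueness identifies it with
  \<open>(\<alpha>, \<beta>)\<close>, and on finite sets pointwise convergence is uniform.\<close>

lemma potentials_close:
  assumes r: "pmf_integrable r WX" and s: "pmf_integrable s WY"
    and S: "schr r s \<alpha> \<beta>" and x0: "\<alpha> x0 = 0"
    and \<epsilon>: "0 < \<epsilon>" and A: "finite A" and B: "finite B"
  shows "\<exists>\<delta>>0. \<forall>r' s' \<alpha>' \<beta>'. wdist WX r' r < ennreal \<delta> \<longrightarrow> wdist WY s' s < ennreal \<delta> \<longrightarrow>
      schr r' s' \<alpha>' \<beta>' \<longrightarrow> \<alpha>' x0 = 0 \<longrightarrow>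
      (\<forall>x\<in>A. \<bar>\<alpha>' x - \<alpha> x\<bar> \<le> \<epsilon>) \<and> (\<forall>y\<in>B. \<bar>\<beta>' y - \<beta> y\<bar> \<le> \<epsilon>)"
proof (rule ccontr)
  define P where "P \<delta> z = (case z of (r', s', \<alpha>', \<beta>') \<Rightarrow> wdist WX r' r < ennreal \<delta> \<and> wdist WY s' s < ennreal \<delta> \<and>
      schr r' s' \<alpha>' \<beta>' \<and> \<alpha>' x0 = 0 \<and>
      \<not> ((\<forall>x\<in>A. \<bar>\<alpha>' x - \<alpha> x\<bar> \<le> \<epsilon>) \<and> (\<forall>y\<in>B. \<bar>\<beta>' y - \<beta> y\<bar> \<le> \<epsilon>)))" for \<delta> z
  assume "\<not> ?thesis"
  then have "\<exists>z. P \<delta> z" if "0 < \<delta>" for \<delta>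
    using that unfolding P_def by fastforce
  then have "\<forall>k. \<exists>z. P (inverse (real (Suc k))) z" by simp
  then obtain z where z: "\<forall>k. P (inverse (real (Suc k))) (z k)"
    using choice[of "\<lambda>k. P (inverse (real (Suc k)))"] by blast
  define rk where "rk k = fst (z k)" for k
  define sk where "sk k = fst (snd (z k))" for k
  define a where "a k = fst (snd (snd (z k)))" for k
  define b where "b k = snd (snd (snd (z k)))" for k
  have zk: "wdist WX (rk k) r < ennreal (inverse (real (Suc k)))" "wdist WY (sk k) s < ennreal (inverse (real (Suc k)))"
    "schr (rk k) (sk k) (a k) (b k)" "a k x0 = 0"
    "\<not> ((\<forall>x\<in>A. \<bar>a k x - \<alpha> x\<bar> \<le> \<epsilon>) \<and> (\<forall>y\<in>B. \<bar>b k y - \<beta> y\<bar> \<le> \<epsilon>))" for k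
    using z[THEN spec, of k] by (simp_all add: P_def rk_def sk_def a_def b_def case_prod_unfold)
  have e: "(\<lambda>k. ennreal (inverse (real (Suc k)))) \<longlonglongrightarrow> 0"
    using tendsto_ennrealI[OF LIMSEQ_inverse_real_of_nat] by simp
  have rk: "(\<lambda>k. wdist WX (rk k) r) \<longlonglongrightarrow> 0"
    by (rule tendsto_sandwich[OF _ _ tendsto_const e]) (simp, intro always_eventually allI less_imp_le zk(1))
  have sk: "(\<lambda>k. wdist WY (sk k) s) \<longlonglongrightarrow> 0"
    by (rule tendsto_sandwich[OF _ _ tendsto_const e]) (simp, intro always_eventually allI less_imp_le zk(2))
  obtain h a' b' where h: "strict_mono (h :: nat \<Rightarrow> nat)" "\<And>x. (\<lambda>k. a (h k) x) \<longlonglongrightarrow> a' x" "\<And>y. (\<lambda>k. b (h k) y) \<longlonglongrightarrow> b' y"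
    "schr r s a' b'" "a' x0 = 0"
    by (rule schroedinger_subsequence_limit[OF r s rk sk zk(3,4)]) (rule that)
  have eq: "a' = \<alpha>" "b' = \<beta>"
    using schroedinger_unique[OF r s S h(4), of x0] h(5) x0 by simp_all
  have "eventually (\<lambda>k. \<bar>a (h k) x - \<alpha> x\<bar> \<le> \<epsilon>) sequentially" for x
    using tendstoD[OF h(2)[of x] \<epsilon>] by (rule eventually_mono) (simp add: dist_real_def eq)
  moreover have "eventually (\<lambda>k. \<bar>b (h k) y - \<beta> y\<bar> \<le> \<epsilon>) sequentially" for y
    using tendstoD[OF h(3)[of y] \<epsilon>] by (rule eventually_mono) (simp add: dist_real_def eq)
  ultimately have "eventually (\<lambda>k. (\<forall>x\<in>A. \<bar>a (h k) x - \<alpha> x\<bar> \<le> \<epsilon>) \<and> (\<forall>y\<in>B. \<bar>b (h k) y - \<beta> y\<bar> \<le> \<epsilon>)) sequentially"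
    using A B by (intro eventually_conj) (simp_all add: eventually_ball_finite)
  then obtain k where "(\<forall>x\<in>A. \<bar>a (h k) x - \<alpha> x\<bar> \<le> \<epsilon>) \<and> (\<forall>y\<in>B. \<bar>b (h k) y - \<beta> y\<bar> \<le> \<epsilon>)"
    using eventually_happens'[OF sequentially_bot] by blast
  then show False using zk(5)[of "h k"] by blast
qed

section \<open>Weak duality for increments of the optimal value\<close>

lemma cost_bounds_integrable:
  "pmf_integrable r WX \<Longrightarrow> pmf_integrable r cX_lo"
  "pmf_integrable r WX \<Longrightarrow> pmf_integrable r cX_hi"
  "pmf_integrable s WY \<Longrightarrow> pmf_integrable s cY_lo"
  "pmf_integrable s WY \<Longrightarrow> pmf_integrable s cY_hi"
  by (erule integrable_measure_pmf_bound, rule order_trans[OF _ WX_ge(1)] order_trans[OF _ WY_ge(1)], simp add: weight_C_def)+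

lemma EROT_eq:
  assumes "pmf_integrable r WX" "pmf_integrable s WY" "schr r s \<alpha> \<beta>"
  shows "EROT lam c r s = ereal (pmf_mean r \<alpha> + pmf_mean s \<beta>)"
  using assms by (intro EROT_eq_dual[OF lam dom_c] cost_bounds_integrable potentials_integrable[OF assms]) auto

lemma EROT_ge:
  assumes r': "pmf_integrable r' WX" and s': "pmf_integrable s' WY"
    and ab: "pmf_integrable r' \<alpha>" "pmf_integrable s' \<beta>"
    and mass: "(\<forall>x. pmf_mean s' (\<lambda>y. gibbs lam c \<alpha> \<beta> x y) = 1) \<or>
      (\<forall>y. pmf_mean r' (\<lambda>x. gibbs lam c \<alpha> \<beta> x y) = 1)"
  shows "pmf_mean r' \<alpha> + pmf_mean s' \<beta> \<le> cost r' s'"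
proof -
  have "(\<integral>\<^sup>+x. \<integral>\<^sup>+y. ennreal (gibbs lam c \<alpha> \<beta> x y) \<partial>measure_pmf s' \<partial>measure_pmf r') = 1"
    using mass
  proof
    assume "\<forall>x. pmf_mean s' (\<lambda>y. gibbs lam c \<alpha> \<beta> x y) = 1"
    then show ?thesis by (simp add: nn_integral_eq_1_of_expectation gibbs_nonneg)
  next
    assume "\<forall>y. pmf_mean r' (\<lambda>x. gibbs lam c \<alpha> \<beta> x y) = 1"
    then show ?thesis
      by (subst nn_integral_pmf_swap) (simp add: nn_integral_eq_1_of_expectation gibbs_nonneg)
  qed
  then have le: "ereal (pmf_mean r' \<alpha> + pmf_mean s' \<beta>) \<le> EROT lam c r' s'"
    using r' s' ab by (intro EROT_ge_dual[OF lam dom_c] cost_bounds_integrable) auto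
  \<comment> \<open>Existence shows that the optimal value is finite. This matters because
    \<open>real_of_ereal\<close> sends infinite values to 0.\<close>
  obtain a b where "schr r' s' a b"
    by (rule schroedinger_exists[OF r' s', of undefined])
  from le EROT_eq[OF r' s' this] show ?thesis by simp
qed

lemma EROT_increment_X:
  assumes r: "pmf_integrable r WX" and r': "pmf_integrable r' WX" and s: "pmf_integrable s WY"
    and S: "schr r s \<alpha> \<beta>" and S': "schr r' s \<alpha>' \<beta>'"
  shows "pmf_mean r' \<alpha> - pmf_mean r \<alpha> \<le> cost r' s - cost r s"
    and "cost r' s - cost r s \<le> pmf_mean r' \<alpha>' - pmf_mean r \<alpha>'"
proof -
  note i = potentials_integrable[OF r s S] and i' = potentials_integrable[OF r' s S']
  have "pmf_mean r' \<alpha> + pmf_mean s \<beta> \<le> cost r' s"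
    using S by (intro EROT_ge r' s i disjI1) (simp add: schroedinger_def)
  moreover have "pmf_mean r \<alpha>' + pmf_mean s \<beta>' \<le> cost r s"
    using S' by (intro EROT_ge r s i' disjI1) (simp add: schroedinger_def)
  ultimately show "pmf_mean r' \<alpha> - pmf_mean r \<alpha> \<le> cost r' s - cost r s"
    "cost r' s - cost r s \<le> pmf_mean r' \<alpha>' - pmf_mean r \<alpha>'"
    by (simp_all add: EROT_eq[OF r s S] EROT_eq[OF r' s S'])
qed

lemma EROT_increment_Y:
  assumes r: "pmf_integrable r WX" and s: "pmf_integrable s WY" and s': "pmf_integrable s' WY"
    and S: "schr r s \<alpha> \<beta>" and S': "schr r s' \<alpha>' \<beta>'"
  shows "pmf_mean s' \<beta> - pmf_mean s \<beta> \<le> cost r s' - cost r s"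
    and "cost r s' - cost r s \<le> pmf_mean s' \<beta>' - pmf_mean s \<beta>'"
proof -
  note i = potentials_integrable[OF r s S] and i' = potentials_integrable[OF r s' S']
  have "pmf_mean r \<alpha> + pmf_mean s' \<beta> \<le> cost r s'"
    using S by (intro EROT_ge r s' i disjI2) (simp add: schroedinger_def)
  moreover have "pmf_mean r \<alpha>' + pmf_mean s \<beta>' \<le> cost r s"
    using S' by (intro EROT_ge r s i' disjI2) (simp add: schroedinger_def)
  ultimately show "pmf_mean s' \<beta> - pmf_mean s \<beta> \<le> cost r s' - cost r s"
    "cost r s' - cost r s \<le> pmf_mean s' \<beta>' - pmf_mean s \<beta>'"
    by (simp_all add: EROT_eq[OF r s S] EROT_eq[OF r s' S'])
qed

text \<open>Closeness on finite sets is combined with the growth bound elsewhere, where two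
  potentials of size \<open>K\<close> times the weight differ by at most \<open>2 * K\<close> times
  the weight. On the finite sets, \<open>\<epsilon>\<close> is multiplied by a weight at least 1 to
  match \<open>small_weight\<close>.\<close>

lemma potentials_stable:
  assumes r: "pmf_integrable r WX" and s: "pmf_integrable s WY"
    and S: "schr r s \<alpha> \<beta>" and x0: "\<alpha> x0 = 0"
  obtains K where "0 \<le> K"
    "\<And>\<epsilon> A B. 0 < \<epsilon> \<Longrightarrow> finite A \<Longrightarrow> finite B \<Longrightarrow> \<exists>\<delta>>0. \<forall>r' s' \<alpha>' \<beta>'. wdist WX r' r < ennreal \<delta> \<longrightarrow> wdist WY s' s < ennreal \<delta> \<longrightarrow>
      schr r' s' \<alpha>' \<beta>' \<longrightarrow> \<alpha>' x0 = 0 \<longrightarrow>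
      (\<forall>x. \<bar>\<alpha>' x - \<alpha> x\<bar> \<le> (if x \<in> A then \<epsilon> * CX x else K * CX x)) \<and>
      (\<forall>y. \<bar>\<beta>' y - \<beta> y\<bar> \<le> (if y \<in> B then \<epsilon> * CY y else K * CY y))"
proof -
  obtain K \<delta>0 where K: "0 \<le> K" "0 < \<delta>0"
    "\<And>r' s' \<alpha> \<beta>. wdist WX r' r < ennreal \<delta>0 \<Longrightarrow> wdist WY s' s < ennreal \<delta>0 \<Longrightarrow> schr r' s' \<alpha> \<beta> \<Longrightarrow> \<alpha> x0 = 0 \<Longrightarrow>
      (\<forall>x. \<bar>\<alpha> x\<bar> \<le> K * CX x) \<and> (\<forall>y. \<bar>\<beta> y\<bar> \<le> K * CY y) \<and>
      (\<forall>x. \<alpha> x \<le> dX_hi x + K) \<and> (\<forall>y. \<beta> y \<le> cY_hi y + K)"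
    by (rule potential_bounds[OF r s, of x0]) (rule that)
  have base: "\<bar>\<alpha> x\<bar> \<le> K * CX x" "\<bar>\<beta> y\<bar> \<le> K * CY y" for x y
    using K(3)[OF _ _ S x0] K(2) by (auto simp: wdist_self)
  show thesis
  proof (rule that[of "2 * K"])
    fix \<epsilon> A B assume \<epsilon>: "0 < (\<epsilon>::real)" and AB: "finite (A :: 'x set)" "finite (B :: 'y set)"
    obtain \<delta>1 where \<delta>1: "0 < \<delta>1" "\<forall>r' s' \<alpha>' \<beta>'. wdist WX r' r < ennreal \<delta>1 \<longrightarrow> wdist WY s' s < ennreal \<delta>1 \<longrightarrow>
      schr r' s' \<alpha>' \<beta>' \<longrightarrow> \<alpha>' x0 = 0 \<longrightarrow>
      (\<forall>x\<in>A. \<bar>\<alpha>' x - \<alpha> x\<bar> \<le> \<epsilon>) \<and> (\<forall>y\<in>B. \<bar>\<beta>' y - \<beta> y\<bar> \<le> \<epsilon>)"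
      using potentials_close[OF r s S x0 \<epsilon> AB] by (elim exE conjE)
    show "\<exists>\<delta>>0. \<forall>r' s' \<alpha>' \<beta>'. wdist WX r' r < ennreal \<delta> \<longrightarrow> wdist WY s' s < ennreal \<delta> \<longrightarrow>
      schr r' s' \<alpha>' \<beta>' \<longrightarrow> \<alpha>' x0 = 0 \<longrightarrow>
      (\<forall>x. \<bar>\<alpha>' x - \<alpha> x\<bar> \<le> (if x \<in> A then \<epsilon> * CX x else 2 * K * CX x)) \<and>
      (\<forall>y. \<bar>\<beta>' y - \<beta> y\<bar> \<le> (if y \<in> B then \<epsilon> * CY y else 2 * K * CY y))"
    proof (intro exI[of _ "min \<delta>0 \<delta>1"] conjI allI impI)
      fix r' s' \<alpha>' \<beta>'
      assume r': "wdist WX r' r < ennreal (min \<delta>0 \<delta>1)" and s': "wdist WY s' s < ennreal (min \<delta>0 \<delta>1)"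
        and S': "schr r' s' \<alpha>' \<beta>'" and x0': "\<alpha>' x0 = 0"
      have less: "wdist WX r' r < ennreal \<delta>0" "wdist WY s' s < ennreal \<delta>0" "wdist WX r' r < ennreal \<delta>1" "wdist WY s' s < ennreal \<delta>1"
        using less_le_trans[OF r' ennreal_leI] less_le_trans[OF s' ennreal_leI] by simp_all
      note k = K(3)[OF less(1,2) S' x0'] and near = \<delta>1(2)[rule_format, OF less(3,4) S' x0']
      have \<epsilon>C: "\<epsilon> \<le> \<epsilon> * weight_C lo hi z" for lo hi :: "'c \<Rightarrow> real" and z
        using mult_left_mono[OF weight_C_ge_1[of lo hi z], of \<epsilon>] \<epsilon> by simp
      show "\<bar>\<alpha>' x - \<alpha> x\<bar> \<le> (if x \<in> A then \<epsilon> * CX x else 2 * K * CX x)" for x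
      proof (cases "x \<in> A")
        case True
        then have "\<bar>\<alpha>' x - \<alpha> x\<bar> \<le> \<epsilon>" using near by blast
        then show ?thesis using True \<epsilon>C[of cX_lo cX_hi x] by simp
      next
        case False
        have "\<bar>\<alpha>' x\<bar> \<le> K * CX x" using k by blast
        then show ?thesis using False base(1)[of x] by simp
      qed
      show "\<bar>\<beta>' y - \<beta> y\<bar> \<le> (if y \<in> B then \<epsilon> * CY y else 2 * K * CY y)" for y
      proof (cases "y \<in> B")
        case True
        then have "\<bar>\<beta>' y - \<beta> y\<bar> \<le> \<epsilon>" using near by blast
        then show ?thesis using True \<epsilon>C[of dY_lo dY_hi y] by simp
      next
        case False
        have "\<bar>\<beta>' y\<bar> \<le> K * CY y" using k by blast
        then show ?thesis using False base(2)[of y] by simp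
      qed
    qed (use K(2) \<delta>1(1) in simp)
  qed (use K(1) in simp)
qed

lemma integrable_if_weight:
  assumes "pmf_integrable p W" "\<And>x. 0 \<le> C x" "\<And>x. C x \<le> W x" "0 \<le> \<epsilon>" "0 \<le> K"
  shows "pmf_integrable p (\<lambda>x. if x \<in> A then \<epsilon> * C x else K * C x :: real)"
proof (rule integrable_measure_pmf_bound[OF integrable_mult_right[OF assms(1), of "\<epsilon> + K"]])
  fix x
  have "\<bar>if x \<in> A then \<epsilon> * C x else K * C x\<bar> \<le> (\<epsilon> + K) * C x"
    using assms(2)[of x] assms(4,5) by (simp add: distrib_right)
  also have "\<dots> \<le> (\<epsilon> + K) * W x" using assms(3-5) by (intro mult_left_mono) auto
  finally show "\<bar>if x \<in> A then \<epsilon> * C x else K * C x\<bar> \<le> (\<epsilon> + K) * W x" .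
qed

text \<open>After subtracting the linear term, the sandwich leaves a remainder between 0 and the
  pairing of \<open>\<alpha>' - \<alpha>\<close> with \<open>r' - r\<close>. The weight
  \<open>v\<close> is fixed before \<open>r'\<close>, so it may be used with a random
  \<open>r'\<close>.\<close>

lemma EROT_expansion_X:
  assumes r: "pmf_integrable r WX" and s: "pmf_integrable s WY"
    and S: "schr r s \<alpha> \<beta>" and x0: "\<alpha> x0 = 0"
    and q: "integrable (count_space UNIV) (\<lambda>x. CX x * sqrt (pmf r x))" and \<eta>: "0 < \<eta>"
  obtains \<delta> v where "0 < \<delta>" "\<And>x. 0 \<le> v x" "(\<integral>\<^sup>+x. ennreal (v x * sqrt (pmf r x)) \<partial>count_space UNIV) \<le> ennreal \<eta>"
    "\<And>r'. wdist WX r' r < ennreal \<delta> \<Longrightarrow>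
      ennreal \<bar>cost r' s - cost r s
        - (pmf_mean r' \<alpha> - pmf_mean r \<alpha>)\<bar> \<le> wdist v r' r"
proof -
  have C0: "0 \<le> CX x" for x using weight_C_ge_1[of cX_lo cX_hi x] by linarith
  obtain K where K: "0 \<le> K"
    "\<And>\<epsilon> A B. 0 < \<epsilon> \<Longrightarrow> finite A \<Longrightarrow> finite B \<Longrightarrow> \<exists>\<delta>>0. \<forall>r' s' \<alpha>' \<beta>'. wdist WX r' r < ennreal \<delta> \<longrightarrow> wdist WY s' s < ennreal \<delta> \<longrightarrow>
      schr r' s' \<alpha>' \<beta>' \<longrightarrow> \<alpha>' x0 = 0 \<longrightarrow>
      (\<forall>x. \<bar>\<alpha>' x - \<alpha> x\<bar> \<le> (if x \<in> A then \<epsilon> * CX x else K * CX x)) \<and>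
      (\<forall>y. \<bar>\<beta>' y - \<beta> y\<bar> \<le> (if y \<in> B then \<epsilon> * CY y else K * CY y))"
    by (rule potentials_stable[OF r s S x0]) (rule that)
  obtain \<epsilon> A where A: "0 < \<epsilon>" "finite A"
    "(\<integral>\<^sup>+x. ennreal ((if x \<in> A then \<epsilon> * CX x else K * CX x) * sqrt (pmf r x)) \<partial>count_space UNIV) \<le> ennreal \<eta>"
    by (rule small_weight[OF q C0 K(1) \<eta>]) (rule that)
  obtain \<delta> where \<delta>: "0 < \<delta>" "\<forall>r' s' \<alpha>' \<beta>'. wdist WX r' r < ennreal \<delta> \<longrightarrow> wdist WY s' s < ennreal \<delta> \<longrightarrow>
      schr r' s' \<alpha>' \<beta>' \<longrightarrow> \<alpha>' x0 = 0 \<longrightarrow>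
      (\<forall>x. \<bar>\<alpha>' x - \<alpha> x\<bar> \<le> (if x \<in> A then \<epsilon> * CX x else K * CX x)) \<and>
      (\<forall>y. \<bar>\<beta>' y - \<beta> y\<bar> \<le> (if y \<in> {} then \<epsilon> * CY y else K * CY y))"
    using K(2)[OF A(1,2) finite.emptyI] by (elim exE conjE)
  let ?v = "\<lambda>x. if x \<in> A then \<epsilon> * CX x else K * CX x"
  show thesis
  proof (rule that[of \<delta> ?v])
    show "0 \<le> ?v x" for x using C0 A(1) K(1) by simp
    fix r' assume near: "wdist WX r' r < ennreal \<delta>"
    have r': "pmf_integrable r' WX" by (rule integrable_of_wdist_less[OF WX_ge(4) r near])
    obtain \<alpha>' \<beta>' where S': "schr r' s \<alpha>' \<beta>'" "\<alpha>' x0 = 0"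
      by (rule schroedinger_exists[OF r' s, of x0])
    have bound: "\<bar>\<alpha>' x - \<alpha> x\<bar> \<le> ?v x" for x
      using \<delta>(2)[rule_format, OF near _ S'] \<delta>(1) by (simp add: wdist_self)
    note inc = EROT_increment_X[OF r r' s S S'(1)]
    have diff: "ennreal \<bar>pmf_mean r' (\<lambda>x. \<alpha>' x - \<alpha> x) - pmf_mean r (\<lambda>x. \<alpha>' x - \<alpha> x)\<bar> \<le> wdist ?v r' r"
      using A(1) K(1) C0 by (intro abs_integral_diff_le_wdist bound integrable_if_weight[where W=WX] r r' WX_ge) auto
    have eq: "pmf_mean p (\<lambda>x. \<alpha>' x - \<alpha> x) = pmf_mean p \<alpha>' - pmf_mean p \<alpha>"
      if "pmf_integrable p WX" for p
      by (intro Bochner_Integration.integral_diff potentials_integrable(1)[OF r s S that] potentials_integrable(1)[OF r' s S'(1) that])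
    show "ennreal \<bar>cost r' s - cost r s
        - (pmf_mean r' \<alpha> - pmf_mean r \<alpha>)\<bar> \<le> wdist ?v r' r"
    proof (rule ennreal_abs_between[OF _ _ _ diff])
      show "0 \<le> cost r' s - cost r s - (pmf_mean r' \<alpha> - pmf_mean r \<alpha>)"
        using inc(1) by linarith
      show "cost r' s - cost r s - (pmf_mean r' \<alpha> - pmf_mean r \<alpha>)
          \<le> pmf_mean r' (\<lambda>x. \<alpha>' x - \<alpha> x) - pmf_mean r (\<lambda>x. \<alpha>' x - \<alpha> x)"
        unfolding eq[OF r] eq[OF r'] using inc(2) by linarith
    qed simp
  qed (use \<delta> A in auto)
qed

text \<open>The base law \<open>r'\<close> moves, so neither end of the sandwich is the linear term
  itself: both the potential of \<open>(r', s)\<close> and that of \<open>(r', s')\<close> have to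
  be compared with \<open>\<beta>\<close>, with the same weight \<open>v\<close>.\<close>

lemma EROT_expansion_Y:
  assumes r: "pmf_integrable r WX" and s: "pmf_integrable s WY"
    and S: "schr r s \<alpha> \<beta>" and x0: "\<alpha> x0 = 0"
    and q: "integrable (count_space UNIV) (\<lambda>y. CY y * sqrt (pmf s y))" and \<eta>: "0 < \<eta>"
  obtains \<delta> v where "0 < \<delta>" "\<And>y. 0 \<le> v y" "(\<integral>\<^sup>+y. ennreal (v y * sqrt (pmf s y)) \<partial>count_space UNIV) \<le> ennreal \<eta>"
    "\<And>r' s'. wdist WX r' r < ennreal \<delta> \<Longrightarrow> wdist WY s' s < ennreal \<delta> \<Longrightarrow>
      ennreal \<bar>cost r' s' - cost r' s
        - (pmf_mean s' \<beta> - pmf_mean s \<beta>)\<bar> \<le> wdist v s' s"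
proof -
  have C0: "0 \<le> CY y" for y using weight_C_ge_1[of dY_lo dY_hi y] by linarith
  obtain K where K: "0 \<le> K"
    "\<And>\<epsilon> A B. 0 < \<epsilon> \<Longrightarrow> finite A \<Longrightarrow> finite B \<Longrightarrow> \<exists>\<delta>>0. \<forall>r' s' \<alpha>' \<beta>'. wdist WX r' r < ennreal \<delta> \<longrightarrow> wdist WY s' s < ennreal \<delta> \<longrightarrow>
      schr r' s' \<alpha>' \<beta>' \<longrightarrow> \<alpha>' x0 = 0 \<longrightarrow>
      (\<forall>x. \<bar>\<alpha>' x - \<alpha> x\<bar> \<le> (if x \<in> A then \<epsilon> * CX x else K * CX x)) \<and>
      (\<forall>y. \<bar>\<beta>' y - \<beta> y\<bar> \<le> (if y \<in> B then \<epsilon> * CY y else K * CY y))"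
    by (rule potentials_stable[OF r s S x0]) (rule that)
  obtain \<epsilon> B where B: "0 < \<epsilon>" "finite B"
    "(\<integral>\<^sup>+y. ennreal ((if y \<in> B then \<epsilon> * CY y else K * CY y) * sqrt (pmf s y)) \<partial>count_space UNIV) \<le> ennreal \<eta>"
    by (rule small_weight[OF q C0 K(1) \<eta>]) (rule that)
  obtain \<delta> where \<delta>: "0 < \<delta>" "\<forall>r' s' \<alpha>' \<beta>'. wdist WX r' r < ennreal \<delta> \<longrightarrow> wdist WY s' s < ennreal \<delta> \<longrightarrow>
      schr r' s' \<alpha>' \<beta>' \<longrightarrow> \<alpha>' x0 = 0 \<longrightarrow>
      (\<forall>x. \<bar>\<alpha>' x - \<alpha> x\<bar> \<le> (if x \<in> {} then \<epsilon> * CX x else K * CX x)) \<and>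
      (\<forall>y. \<bar>\<beta>' y - \<beta> y\<bar> \<le> (if y \<in> B then \<epsilon> * CY y else K * CY y))"
    using K(2)[OF B(1) finite.emptyI B(2)] by (elim exE conjE)
  let ?v = "\<lambda>y. if y \<in> B then \<epsilon> * CY y else K * CY y"
  show thesis
  proof (rule that[of \<delta> ?v])
    show "0 \<le> ?v y" for y using C0 B(1) K(1) by simp
    fix r' s' assume near: "wdist WX r' r < ennreal \<delta>" "wdist WY s' s < ennreal \<delta>"
    have r': "pmf_integrable r' WX" by (rule integrable_of_wdist_less[OF WX_ge(4) r near(1)])
    have s': "pmf_integrable s' WY" by (rule integrable_of_wdist_less[OF WY_ge(4) s near(2)])
    obtain \<alpha>1 \<beta>1 where S1: "schr r' s \<alpha>1 \<beta>1" "\<alpha>1 x0 = 0"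
      by (rule schroedinger_exists[OF r' s, of x0])
    obtain \<alpha>2 \<beta>2 where S2: "schr r' s' \<alpha>2 \<beta>2" "\<alpha>2 x0 = 0"
      by (rule schroedinger_exists[OF r' s', of x0])
    have bound: "\<bar>\<beta>1 y - \<beta> y\<bar> \<le> ?v y" "\<bar>\<beta>2 y - \<beta> y\<bar> \<le> ?v y" for y
      using \<delta>(2)[rule_format, OF near(1) _ S1] \<delta>(2)[rule_format, OF near(1,2) S2] \<delta>(1) by (simp_all add: wdist_self)
    note inc = EROT_increment_Y[OF r' s s' S1(1) S2(1)]
    have v: "pmf_integrable p ?v" if "pmf_integrable p WY" for p
      using B(1) K(1) C0 that by (intro integrable_if_weight[where W=WY] WY_ge) auto
    note diff = abs_integral_diff_le_wdist[OF v[OF s'] v[OF s] bound(1)] abs_integral_diff_le_wdist[OF v[OF s'] v[OF s] bound(2)]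
    have eq: "pmf_mean p (\<lambda>y. \<beta>1 y - \<beta> y) = pmf_mean p \<beta>1 - pmf_mean p \<beta>"
      "pmf_mean p (\<lambda>y. \<beta>2 y - \<beta> y) = pmf_mean p \<beta>2 - pmf_mean p \<beta>"
      if "pmf_integrable p WY" for p
      by (intro Bochner_Integration.integral_diff potentials_integrable(2)[OF r s S that] potentials_integrable(2)[OF r' s S1(1) that]
          potentials_integrable(2)[OF r' s' S2(1) that])+
    show "ennreal \<bar>cost r' s' - cost r' s
        - (pmf_mean s' \<beta> - pmf_mean s \<beta>)\<bar> \<le> wdist ?v s' s"
      by (rule ennreal_abs_between[OF _ _ diff]; use inc in \<open>simp only: eq[OF s] eq[OF s']; linarith\<close>)
  qed (use \<delta> B in auto)
qed

end

section \<open>Convergence in probability and characteristic functions\<close>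

text \<open>Convergence to 0 in probability. Measurability is kept out of the definition and
  demanded only eventually, since the empirical law of an empty sample is unspecified.\<close>

definition conv0 :: "'w measure \<Rightarrow> (nat \<Rightarrow> 'w \<Rightarrow> real) \<Rightarrow> bool" where
  "conv0 M f \<longleftrightarrow> (\<forall>e>0. (\<lambda>k. measure M {w \<in> space M. e < \<bar>f k w\<bar>}) \<longlonglongrightarrow> 0)"

lemma (in prob_space) conv0_add:
  assumes f: "conv0 M f" "\<forall>\<^sub>F k in sequentially. f k \<in> borel_measurable M"
    and g: "conv0 M g" "\<forall>\<^sub>F k in sequentially. g k \<in> borel_measurable M"
  shows "conv0 M (\<lambda>k w. f k w + g k w)"
  unfolding conv0_def
proof (intro allI impI)
  fix e :: real assume e: "0 < e"
  have "(\<lambda>k. measure M {w \<in> space M. e / 2 < \<bar>f k w\<bar>} + measure M {w \<in> space M. e / 2 < \<bar>g k w\<bar>}) \<longlonglongrightarrow> 0 + 0"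
    using f(1)[unfolded conv0_def, rule_format, OF half_gt_zero[OF e]] g(1)[unfolded conv0_def, rule_format, OF half_gt_zero[OF e]]
    by (rule tendsto_add)
  then have lim: "(\<lambda>k. measure M {w \<in> space M. e / 2 < \<bar>f k w\<bar>} + measure M {w \<in> space M. e / 2 < \<bar>g k w\<bar>}) \<longlonglongrightarrow> 0"
    by simp
  have "\<forall>\<^sub>F k in sequentially. measure M {w \<in> space M. e < \<bar>f k w + g k w\<bar>}
      \<le> measure M {w \<in> space M. e / 2 < \<bar>f k w\<bar>} + measure M {w \<in> space M. e / 2 < \<bar>g k w\<bar>}"
    using f(2) g(2)
  proof eventually_elim
    case (elim k)
    note [measurable] = elim
    show ?case by (rule order_trans[OF finite_measure_mono measure_Un_le]) auto
  qed
  then show "(\<lambda>k. measure M {w \<in> space M. e < \<bar>f k w + g k w\<bar>}) \<longlonglongrightarrow> 0"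
    by (intro tendsto_sandwich[OF _ _ tendsto_const lim]) auto
qed

lemma (in prob_space) conv0_mono:
  assumes "conv0 M g" "\<forall>\<^sub>F k in sequentially. g k \<in> borel_measurable M" "\<And>k w. w \<in> space M \<Longrightarrow> \<bar>f k w\<bar> \<le> \<bar>g k w\<bar>"
  shows "conv0 M f"
  unfolding conv0_def
proof (intro allI impI)
  fix e :: real assume e: "0 < e"
  have lim: "(\<lambda>k. measure M {w \<in> space M. e < \<bar>g k w\<bar>}) \<longlonglongrightarrow> 0"
    using assms(1) e by (simp add: conv0_def)
  have "\<forall>\<^sub>F k in sequentially. measure M {w \<in> space M. e < \<bar>f k w\<bar>} \<le> measure M {w \<in> space M. e < \<bar>g k w\<bar>}"
    using assms(2)
  proof eventually_elim
    case (elim k)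
    note [measurable] = elim
    show ?case using assms(3) by (intro finite_measure_mono) (auto intro: less_le_trans)
  qed
  then show "(\<lambda>k. measure M {w \<in> space M. e < \<bar>f k w\<bar>}) \<longlonglongrightarrow> 0"
    by (intro tendsto_sandwich[OF _ _ tendsto_const lim]) auto
qed

lemma (in prob_space) measure_ge_le_nn_integral:
  assumes f[measurable]: "f \<in> borel_measurable M" and e: "0 < e" and I: "(\<integral>\<^sup>+w. f w \<partial>M) \<le> ennreal c" "0 \<le> c"
  shows "measure M {w \<in> space M. ennreal e \<le> f w} \<le> c / e"
proof -
  have "emeasure M {w \<in> space M. ennreal e \<le> f w} \<le> emeasure M {w \<in> space M. 1 \<le> ennreal (1 / e) * f w}"
  proof (intro emeasure_mono subsetI)
    fix w assume w: "w \<in> {w \<in> space M. ennreal e \<le> f w}"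
    have "1 = ennreal (1 / e) * ennreal e" using e by (simp flip: ennreal_mult)
    also have "\<dots> \<le> ennreal (1 / e) * f w" using w by (intro mult_left_mono) auto
    finally show "w \<in> {w \<in> space M. 1 \<le> ennreal (1 / e) * f w}" using w by simp
  qed simp
  also have "\<dots> \<le> ennreal (1 / e) * (\<integral>\<^sup>+w. f w * indicator (space M) w \<partial>M)"
    by (intro nn_integral_Markov_inequality) auto
  also have "(\<integral>\<^sup>+w. f w * indicator (space M) w \<partial>M) = (\<integral>\<^sup>+w. f w \<partial>M)"
    by (intro nn_integral_cong) simp
  also have "ennreal (1 / e) * (\<integral>\<^sup>+w. f w \<partial>M) \<le> ennreal (1 / e) * ennreal c"
    using I(1) by (intro mult_left_mono) auto
  also have "\<dots> = ennreal (c / e)" using e I(2) by (simp flip: ennreal_mult)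
  finally show ?thesis using e I(2) by (simp add: emeasure_eq_measure)
qed

text \<open>Chebyshev's inequality. It serves to replace converging random-variable coefficients by
  their limits when second moments are bounded.\<close>

lemma (in prob_space) conv0_null_sequence_mult:
  assumes g: "\<And>k. g k \<in> borel_measurable M" "\<And>k. (\<integral>\<^sup>+w. ennreal ((g k w)\<^sup>2) \<partial>M) \<le> ennreal V" "0 \<le> V"
    and a: "a \<longlonglongrightarrow> 0"
  shows "conv0 M (\<lambda>k w. a k * g k w)"
  unfolding conv0_def
proof (intro allI impI)
  fix e :: real assume e: "0 < e"
  note [measurable] = g(1)
  have "(\<lambda>k. (a k)\<^sup>2 * V / e\<^sup>2) \<longlonglongrightarrow> 0\<^sup>2 * V / e\<^sup>2"
    using e by (intro tendsto_intros a) auto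
  then have lim: "(\<lambda>k. (a k)\<^sup>2 * V / e\<^sup>2) \<longlonglongrightarrow> 0" by simp
  have "measure M {w \<in> space M. e < \<bar>a k * g k w\<bar>} \<le> (a k)\<^sup>2 * V / e\<^sup>2" for k
  proof -
    have "measure M {w \<in> space M. e < \<bar>a k * g k w\<bar>} \<le> measure M {w \<in> space M. ennreal (e\<^sup>2) \<le> ennreal ((a k * g k w)\<^sup>2)}"
    proof (intro finite_measure_mono subsetI)
      fix w assume "w \<in> {w \<in> space M. e < \<bar>a k * g k w\<bar>}"
      then have "w \<in> space M" "e\<^sup>2 \<le> \<bar>a k * g k w\<bar>\<^sup>2" using e power_mono[of e "\<bar>a k * g k w\<bar>" 2] by simp_all
      then show "w \<in> {w \<in> space M. ennreal (e\<^sup>2) \<le> ennreal ((a k * g k w)\<^sup>2)}" by (simp add: ennreal_leI)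
    qed simp
    also have "\<dots> \<le> ((a k)\<^sup>2 * V) / e\<^sup>2"
    proof (rule measure_ge_le_nn_integral)
      have "(\<integral>\<^sup>+w. ennreal ((a k * g k w)\<^sup>2) \<partial>M) = ennreal ((a k)\<^sup>2) * (\<integral>\<^sup>+w. ennreal ((g k w)\<^sup>2) \<partial>M)"
        by (simp add: power_mult_distrib ennreal_mult nn_integral_cmult)
      also have "\<dots> \<le> ennreal ((a k)\<^sup>2) * ennreal V" using g(2) by (intro mult_left_mono) auto
      finally show "(\<integral>\<^sup>+w. ennreal ((a k * g k w)\<^sup>2) \<partial>M) \<le> ennreal ((a k)\<^sup>2 * V)"
        using g(3) by (simp add: ennreal_mult)
    qed (use e g(3) in auto)
    finally show ?thesis .
  qed
  then show "(\<lambda>k. measure M {w \<in> space M. e < \<bar>a k * g k w\<bar>}) \<longlonglongrightarrow> 0"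
    by (intro tendsto_sandwich[OF _ _ tendsto_const lim]) auto
qed

lemma char_normal_law:
  "char (normal_law 0 v) t = exp (- ((sqrt v * t)\<^sup>2) / 2)"
proof -
  have "char (normal_law 0 v) t = char std_normal_distribution (sqrt v * t)"
    unfolding char_def normal_law_def
    by (subst integral_distr) (simp_all add: mult_ac)
  then show ?thesis by (simp add: char_std_normal_distribution)
qed

lemma real_distribution_normal_law: "real_distribution (normal_law \<mu> v)"
proof -
  interpret std: real_distribution std_normal_distribution by (rule real_dist_normal_dist)
  show ?thesis unfolding normal_law_def by (rule std.real_distribution_distr) simp
qed

text \<open>Slutsky's lemma for characteristic functions: the integrands differ by at most
  \<open>\<bar>t\<bar> * e\<close> where \<open>Y\<close> and \<open>Z\<close> are within
  \<open>e\<close>, and by at most 2 on the remaining event.\<close>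

lemma (in prob_space) char_tendsto_of_conv0:
  assumes Y: "\<And>k. Y k \<in> borel_measurable M" and Z: "\<And>k. Z k \<in> borel_measurable M"
    and d: "conv0 M (\<lambda>k w. Y k w - Z k w)" and lim: "(\<lambda>k. char (distr M borel (Z k)) t) \<longlonglongrightarrow> L"
  shows "(\<lambda>k. char (distr M borel (Y k)) t) \<longlonglongrightarrow> L"
proof -
  note [measurable] = Y Z
  let ?D = "\<lambda>k e. {w \<in> space M. e < \<bar>Y k w - Z k w\<bar>}"
  have bound: "cmod (char (distr M borel (Y k)) t - char (distr M borel (Z k)) t) \<le> \<bar>t\<bar> * e + 2 * measure M (?D k e)"
    if "0 < e" for k e
  proof -
    have i: "integrable M (\<lambda>w. iexp (t * Y k w))" "integrable M (\<lambda>w. iexp (t * Z k w))"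
      by (auto intro!: integrable_const_bound[where B=1])
    have ind: "integrable M (\<lambda>w. 2 * indicator (?D k e) w :: real)"
      by (intro integrable_const_bound[where B=2]) (auto split: split_indicator)
    have "char (distr M borel (Y k)) t - char (distr M borel (Z k)) t = (CLINT w|M. iexp (t * Y k w) - iexp (t * Z k w))"
      using i by (simp add: char_def integral_distr)
    also have "cmod \<dots> \<le> (\<integral>w. cmod (iexp (t * Y k w) - iexp (t * Z k w)) \<partial>M)"
      by (rule integral_norm_bound)
    also have "\<dots> \<le> (\<integral>w. \<bar>t\<bar> * e + 2 * indicator (?D k e) w \<partial>M)"
    proof (intro integral_mono_AE AE_I2)
      fix w assume w: "w \<in> space M"
      have "iexp (t * Y k w) - iexp (t * Z k w) = iexp (t * Z k w) * (iexp (t * (Y k w - Z k w)) - 1)"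
        by (simp add: right_diff_distrib flip: exp_add)
      then have eq: "cmod (iexp (t * Y k w) - iexp (t * Z k w)) = cmod (iexp (t * (Y k w - Z k w)) - 1)"
        by (simp only: norm_mult norm_exp_i_times mult_1_left)
      have le1: "cmod (iexp (t * (Y k w - Z k w)) - 1) \<le> \<bar>t * (Y k w - Z k w)\<bar>"
        using iexp_approx1[of "t * (Y k w - Z k w)" 0] by simp
      have le2: "cmod (iexp (t * (Y k w - Z k w)) - 1) \<le> 2"
        using norm_triangle_ineq4[of "iexp (t * (Y k w - Z k w))" 1] by (simp add: norm_exp_i_times)
      show "cmod (iexp (t * Y k w) - iexp (t * Z k w)) \<le> \<bar>t\<bar> * e + 2 * indicator (?D k e) w"
      proof (cases "w \<in> ?D k e")
        case True
        then show ?thesis using le2 that unfolding eq by (auto intro: add_increasing)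
      next
        case False
        then have "\<bar>t\<bar> * \<bar>Y k w - Z k w\<bar> \<le> \<bar>t\<bar> * e" using w by (intro mult_left_mono) auto
        then show ?thesis using False le1 unfolding eq by (simp add: abs_mult)
      qed
    qed (use i ind in \<open>auto intro!: Bochner_Integration.integrable_add\<close>)
    also have "\<dots> = \<bar>t\<bar> * e + 2 * measure M (?D k e)"
      using ind by (subst Bochner_Integration.integral_add) (auto simp: prob_space)
    finally show ?thesis .
  qed
  have "(\<lambda>k. char (distr M borel (Y k)) t - char (distr M borel (Z k)) t) \<longlonglongrightarrow> 0"
  proof (rule tendstoI)
    fix \<epsilon> :: real assume \<epsilon>: "0 < \<epsilon>"
    define e where "e = \<epsilon> / (2 * (\<bar>t\<bar> + 1))"
    have e: "0 < e" "\<bar>t\<bar> * e \<le> \<epsilon> / 2" using \<epsilon> by (auto simp: e_def field_simps)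
    have "eventually (\<lambda>k. measure M (?D k e) < \<epsilon> / 4) sequentially"
      using d e(1) \<epsilon> unfolding conv0_def by (intro order_tendstoD(2)[where y=0]) auto
    then show "eventually (\<lambda>k. dist (char (distr M borel (Y k)) t - char (distr M borel (Z k)) t) 0 < \<epsilon>) sequentially"
    proof eventually_elim
      case (elim k)
      then show ?case using bound[OF e(1), of k] e(2) by simp
    qed
  qed
  from tendsto_add[OF this lim] show ?thesis by simp
qed

lemma (in prob_space) expectation_sum_square:
  fixes B :: "nat \<Rightarrow> 'a \<Rightarrow> real"
  assumes ind: "indep_vars (\<lambda>_. borel) B UNIV" and sq: "\<And>i. integrable M (\<lambda>w. (B i w)\<^sup>2)"
    and mean: "\<And>i. expectation (B i) = 0"
  shows "integrable M (\<lambda>w. (\<Sum>i<n. B i w)\<^sup>2) \<and> expectation (\<lambda>w. (\<Sum>i<n. B i w)\<^sup>2) = (\<Sum>i<n. expectation (\<lambda>w. (B i w)\<^sup>2))"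
proof (induction n)
  case (Suc n)
  have rv [measurable]: "random_variable borel (B i)" for i using ind by (simp add: indep_vars_def2)
  have int: "integrable M (B i)" for i by (rule square_integrable_imp_integrable[OF rv sq])
  have "indep_vars (\<lambda>_. borel) B (insert n {..<n})" by (rule indep_vars_subset[OF ind]) auto
  then have "indep_var borel (B n) borel (\<lambda>w. \<Sum>i<n. B i w)" by (intro indep_vars_sum) auto
  then have prod: "integrable M (\<lambda>w. B n w * (\<Sum>i<n. B i w))" "expectation (\<lambda>w. B n w * (\<Sum>i<n. B i w)) = 0"
    using indep_var_integrable[of "B n" "\<lambda>w. \<Sum>i<n. B i w"] indep_var_lebesgue_integral[of "B n" "\<lambda>w. \<Sum>i<n. B i w"] int mean by auto
  have "(\<Sum>i<Suc n. B i w)\<^sup>2 = (\<Sum>i<n. B i w)\<^sup>2 + (2 * (B n w * (\<Sum>i<n. B i w)) + (B n w)\<^sup>2)" for w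
    by (simp add: power2_sum)
  then show ?case using Suc prod sq[of n] by simp
qed simp

section \<open>Empirical measures\<close>

locale iid_sequence = prob_space M for M :: "'w measure" +
  fixes p :: "'a::countable pmf" and X :: "nat \<Rightarrow> 'w \<Rightarrow> 'a"
  assumes iid: "iid_sample M p X"
begin

lemma X_indep: "indep_vars (\<lambda>_. count_space UNIV) X UNIV"
  and X_distr: "distr M (count_space UNIV) (X i) = measure_pmf p"
  using iid by (auto simp: iid_sample_def)

lemma X_measurable [measurable]: "X i \<in> M \<rightarrow>\<^sub>M count_space UNIV"
  using X_indep by (simp add: indep_vars_def2)

lemma expectation_X:
  fixes f :: "'a \<Rightarrow> real"
  shows "expectation (\<lambda>w. f (X i w)) = pmf_mean p f"
    and "integrable M (\<lambda>w. f (X i w)) \<longleftrightarrow> pmf_integrable p f"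
  by (subst X_distr[of i, symmetric], subst integral_distr integrable_distr_eq, simp_all)+

text \<open>Lists over a countable type are countable, so every function of the first
  \<open>k\<close> observations becomes measurable; this is what makes the optimal value at an
  empirical law a random variable.\<close>

lemma sample_list_measurable: "(\<lambda>w. map (\<lambda>i. X i w) [0..<k]) \<in> M \<rightarrow>\<^sub>M count_space UNIV"
proof (induction k)
  case (Suc k)
  have "(\<lambda>w. map (\<lambda>i. X i w) [0..<k] @ [X k w]) \<in> M \<rightarrow>\<^sub>M count_space UNIV"
    by (rule measurable_compose_countable[where f="\<lambda>xs w. xs @ [X k w]", OF _ Suc]) simp
  then show ?case by simp
qed simp

lemma empirical_eq_sample_list:
  assumes "0 < n"
  shows "empirical X n w = map_pmf (\<lambda>i. map (\<lambda>i. X i w) [0..<n] ! i) (pmf_of_set {..<n})"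
proof -
  have "{..<n} \<noteq> {}" using assms by auto
  then show ?thesis unfolding empirical_def by (intro map_pmf_cong refl) simp
qed

text \<open>The second occurrence of \<open>w\<close> allows functions of two empirical laws to be
  treated one argument at a time.\<close>

lemma empirical_measurable_Pair:
  assumes n: "0 < n" and f: "\<And>q. (\<lambda>w. f q w) \<in> M \<rightarrow>\<^sub>M N"
  shows "(\<lambda>w. f (empirical X n w) w) \<in> M \<rightarrow>\<^sub>M N"
  unfolding empirical_eq_sample_list[OF n]
  by (rule measurable_compose_countable[where f="\<lambda>xs w. f (map_pmf (\<lambda>i. xs ! i) (pmf_of_set {..<n})) w",
        OF f sample_list_measurable])

lemma empirical_function_measurable:
  assumes "0 < n" "\<And>q. f q \<in> space N"
  shows "(\<lambda>w. f (empirical X n w)) \<in> M \<rightarrow>\<^sub>M N"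
  by (rule empirical_measurable_Pair[OF assms(1)]) (simp add: assms(2))

lemma empirical_expectation:
  assumes "0 < n"
  shows "pmf_mean (empirical X n w) f = (\<Sum>i<n. f (X i w)) / real n"
proof -
  have "{..<n} \<noteq> {}" using assms by auto
  then show ?thesis by (simp add: empirical_def integral_pmf_of_set)
qed

lemma pmf_eq_expectation: "pmf q x = pmf_mean q (indicator {x})"
  by (simp add: measure_pmf_single)

section \<open>Moments of the empirical fluctuations and their limit\<close>

definition fluct :: "('a \<Rightarrow> real) \<Rightarrow> nat \<Rightarrow> 'w \<Rightarrow> real" where
  "fluct f n w = sqrt (real n) * (pmf_mean (empirical X n w) f - pmf_mean p f)"

lemma fluct_eq:
  "fluct f n w = (\<Sum>i<n. f (X i w) - pmf_mean p f) / sqrt (real n)"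
proof (cases "n = 0")
  case False
  then have "fluct f n w = sqrt (real n) * ((\<Sum>i<n. f (X i w) - pmf_mean p f) / real n)"
    by (simp add: fluct_def empirical_expectation sum_subtractf diff_divide_distrib)
  also have "\<dots> = (\<Sum>i<n. f (X i w) - pmf_mean p f) / sqrt (real n)"
    using False by (simp add: field_simps real_sqrt_mult_self flip: real_sqrt_mult)
  finally show ?thesis .
qed (simp add: fluct_def)

lemma fluct_measurable [measurable]: "fluct f n \<in> borel_measurable M"
  unfolding fluct_eq[abs_def] by measurable

lemma centered_indep: "indep_vars (\<lambda>_. borel) (\<lambda>i w. f (X i w) - m :: real) UNIV"
  using indep_vars_compose2[OF X_indep, of "\<lambda>_ x. f x - m" "\<lambda>_. borel"] by simp

lemma fluct_square:
  assumes f: "pmf_integrable p (\<lambda>x. (f x)\<^sup>2)"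
  shows "integrable M (\<lambda>w. (fluct f n w)\<^sup>2)" "0 < n \<Longrightarrow> expectation (\<lambda>w. (fluct f n w)\<^sup>2) = pmf_var p f"
proof -
  let ?m = "pmf_mean p f"
  have f1: "pmf_integrable p f" by (rule measure_pmf.square_integrable_imp_integrable[OF _ f]) simp
  have "pmf_integrable p (\<lambda>x. (f x - ?m)\<^sup>2)"
    using f f1 by (simp add: power2_diff)
  then have sq: "integrable M (\<lambda>w. (f (X i w) - ?m)\<^sup>2)" for i
    using expectation_X(2)[of "\<lambda>x. (f x - ?m)\<^sup>2" i] by simp
  have mean: "expectation (\<lambda>w. f (X i w) - ?m) = 0" for i
    using expectation_X(1)[of "\<lambda>x. f x - ?m" i] f1 by simp
  have var: "expectation (\<lambda>w. (f (X i w) - ?m)\<^sup>2) = pmf_var p f" for i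
    using expectation_X(1)[of "\<lambda>x. (f x - ?m)\<^sup>2" i] by simp
  note sum = expectation_sum_square[OF centered_indep[of f ?m] sq mean, of n]
  have eq: "(fluct f n w)\<^sup>2 = (\<Sum>i<n. f (X i w) - ?m)\<^sup>2 / real n" for w
    by (simp add: fluct_eq power_divide)
  show "integrable M (\<lambda>w. (fluct f n w)\<^sup>2)"
    unfolding eq using sum by simp
  show "expectation (\<lambda>w. (fluct f n w)\<^sup>2) = pmf_var p f" if "0 < n"
    unfolding eq using sum that by (simp add: var)
qed

lemma nn_fluct_square_le:
  assumes f: "pmf_integrable p (\<lambda>x. (f x)\<^sup>2)"
  shows "(\<integral>\<^sup>+w. ennreal ((fluct f n w)\<^sup>2) \<partial>M) \<le> ennreal (pmf_var p f)"
proof (cases "n = 0")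
  case False
  then show ?thesis using fluct_square[OF f, of n] by (simp add: nn_integral_eq_integral)
qed (simp add: fluct_def)

text \<open>The first bound has the right rate and comes from the binomial variance; the second has
  no rate but is summable against any integrable weight, and so acts as a majorant.\<close>

lemma nn_abs_diff_pmf:
  assumes n: "0 < n"
  shows "(\<integral>\<^sup>+w. ennreal \<bar>pmf (empirical X n w) x - pmf p x\<bar> \<partial>M) \<le> ennreal (sqrt (pmf p x) / sqrt (real n))"
    and "(\<integral>\<^sup>+w. ennreal \<bar>pmf (empirical X n w) x - pmf p x\<bar> \<partial>M) \<le> ennreal (2 * pmf p x)"
proof -
  let ?f = "indicator {x} :: 'a \<Rightarrow> real"
  have fsq: "(\<lambda>y. (?f y)\<^sup>2) = ?f" by (auto split: split_indicator)
  have f: "pmf_integrable p (\<lambda>y. (?f y)\<^sup>2)"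
    unfolding fsq by (rule integrable_measure_pmf_bound[of p "\<lambda>_. 1"]) (auto split: split_indicator)
  have fl: "\<bar>pmf (empirical X n w) x - pmf p x\<bar> = \<bar>fluct ?f n w\<bar> / sqrt (real n)" for w
    using n by (simp add: fluct_def abs_mult measure_pmf_single)
  have int1: "integrable M (fluct ?f n)"
    by (rule square_integrable_imp_integrable[OF _ fluct_square(1)[OF f]]) simp
  have abs_int: "integrable M (\<lambda>w. \<bar>fluct ?f n w\<bar>)" using int1 by simp
  \<comment> \<open>The square of the first absolute moment is at most the second moment, read off
    from nonnegativity of the variance of the absolute value.\<close>
  have "(expectation (\<lambda>w. \<bar>fluct ?f n w\<bar>))\<^sup>2 \<le> expectation (\<lambda>w. (fluct ?f n w)\<^sup>2)"
    using variance_eq[OF abs_int] variance_positive[of "\<lambda>w. \<bar>fluct ?f n w\<bar>"] fluct_square(1)[OF f, of n] by simp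
  also have "\<dots> = pmf_var p ?f" using fluct_square(2)[OF f n] .
  also have "\<dots> \<le> pmf_mean p (\<lambda>y. (?f y)\<^sup>2)"
    using measure_pmf.variance_eq[of p ?f] f f[unfolded fsq] by simp
  also have "\<dots> = pmf p x" unfolding fsq by (simp add: measure_pmf_single)
  finally have "expectation (\<lambda>w. \<bar>fluct ?f n w\<bar>) \<le> sqrt (pmf p x)" by (rule real_le_rsqrt)
  then have le: "expectation (\<lambda>w. \<bar>fluct ?f n w\<bar> / sqrt (real n)) \<le> sqrt (pmf p x) / sqrt (real n)"
    by (simp add: divide_right_mono)
  have "(\<integral>\<^sup>+w. ennreal \<bar>pmf (empirical X n w) x - pmf p x\<bar> \<partial>M) = ennreal (expectation (\<lambda>w. \<bar>fluct ?f n w\<bar> / sqrt (real n)))"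
    unfolding fl using abs_int by (intro nn_integral_eq_integral) auto
  also have "\<dots> \<le> ennreal (sqrt (pmf p x) / sqrt (real n))" by (rule ennreal_leI[OF le])
  finally show "(\<integral>\<^sup>+w. ennreal \<bar>pmf (empirical X n w) x - pmf p x\<bar> \<partial>M) \<le> ennreal (sqrt (pmf p x) / sqrt (real n))" .
  have fi: "integrable M (\<lambda>w. ?f (X i w))" for i
    using expectation_X(2)[of ?f i] f[unfolded fsq] by simp
  have emp: "pmf (empirical X n w) x = (\<Sum>i<n. ?f (X i w)) / real n" for w
    unfolding pmf_eq_expectation by (rule empirical_expectation[OF n])
  have "(\<integral>\<^sup>+w. ennreal \<bar>pmf (empirical X n w) x - pmf p x\<bar> \<partial>M) \<le> (\<integral>\<^sup>+w. ennreal (pmf (empirical X n w) x + pmf p x) \<partial>M)"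
    by (intro nn_integral_mono ennreal_leI) (simp add: abs_le_iff add_increasing add_increasing2)
  also have "\<dots> = ennreal (expectation (\<lambda>w. (\<Sum>i<n. ?f (X i w)) / real n + pmf p x))"
    unfolding emp using fi by (intro nn_integral_eq_integral) (auto intro!: AE_I2 add_nonneg_nonneg divide_nonneg_nonneg sum_nonneg)
  also have "expectation (\<lambda>w. (\<Sum>i<n. ?f (X i w)) / real n + pmf p x) = 2 * pmf p x"
    using n fi expectation_X(1)[of ?f] by (simp add: measure_pmf_single prob_space)
  finally show "(\<integral>\<^sup>+w. ennreal \<bar>pmf (empirical X n w) x - pmf p x\<bar> \<partial>M) \<le> ennreal (2 * pmf p x)" .
qed

lemma nn_expectation_wdist:
  assumes n: "0 < n" and v: "\<And>x. 0 \<le> v x"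
  shows "(\<integral>\<^sup>+w. wdist v (empirical X n w) p \<partial>M)
    = (\<integral>\<^sup>+x. ennreal (v x) * (\<integral>\<^sup>+w. ennreal \<bar>pmf (empirical X n w) x - pmf p x\<bar> \<partial>M) \<partial>count_space UNIV)"
proof -
  interpret P: pair_sigma_finite "count_space (UNIV :: 'a set)" M
    by (intro pair_sigma_finite.intro sigma_finite_measure_count_space_countable) (auto intro: sigma_finite_measure_axioms)
  let ?g = "\<lambda>(x, w). ennreal (v x * \<bar>pmf (empirical X n w) x - pmf p x\<bar>)"
  have meas: "(\<lambda>w. ennreal (v x * \<bar>pmf (empirical X n w) x - pmf p x\<bar>)) \<in> borel_measurable M" for x
    by (rule empirical_function_measurable[OF n]) simp
  have "?g \<in> borel_measurable (count_space UNIV \<Otimes>\<^sub>M M)"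
    using meas by (intro measurable_pair_measure_countable1) auto
  from P.Fubini'[OF this]
  have "(\<integral>\<^sup>+w. wdist v (empirical X n w) p \<partial>M)
      = (\<integral>\<^sup>+x. \<integral>\<^sup>+w. ennreal (v x * \<bar>pmf (empirical X n w) x - pmf p x\<bar>) \<partial>M \<partial>count_space UNIV)"
    by (simp add: wdist_def)
  also have "\<dots> = (\<integral>\<^sup>+x. ennreal (v x) * (\<integral>\<^sup>+w. ennreal \<bar>pmf (empirical X n w) x - pmf p x\<bar> \<partial>M) \<partial>count_space UNIV)"
  proof (intro nn_integral_cong)
    fix x
    have "(\<lambda>w. ennreal \<bar>pmf (empirical X n w) x - pmf p x\<bar>) \<in> borel_measurable M"
      by (rule empirical_function_measurable[OF n]) simp
    then show "(\<integral>\<^sup>+w. ennreal (v x * \<bar>pmf (empirical X n w) x - pmf p x\<bar>) \<partial>M)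
        = ennreal (v x) * (\<integral>\<^sup>+w. ennreal \<bar>pmf (empirical X n w) x - pmf p x\<bar> \<partial>M)"
      using v[of x] by (simp add: ennreal_mult nn_integral_cmult)
  qed
  finally show ?thesis .
qed

lemma wdist_measurable: "0 < n \<Longrightarrow> (\<lambda>w. wdist v (empirical X n w) p) \<in> borel_measurable M"
  by (rule empirical_function_measurable) simp_all

text \<open>The factor \<open>sqrt n\<close> cancels the rate of the mean absolute deviation,
  leaving the sum of \<open>v * sqrt p\<close>; Markov's inequality then gives a bound independent
  of \<open>n\<close>.\<close>

lemma prob_sqrt_wdist_ge:
  assumes n: "0 < n" and v: "\<And>x. 0 \<le> v x" and le: "(\<integral>\<^sup>+x. ennreal (v x * sqrt (pmf p x)) \<partial>count_space UNIV) \<le> ennreal \<eta>"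
    and \<eta>: "0 \<le> \<eta>" and e: "0 < e"
  shows "measure M {w \<in> space M. ennreal e \<le> ennreal (sqrt (real n)) * wdist v (empirical X n w) p} \<le> \<eta> / e"
proof (rule measure_ge_le_nn_integral[OF _ e _ \<eta>])
  note [measurable] = wdist_measurable[OF n]
  show "(\<lambda>w. ennreal (sqrt (real n)) * wdist v (empirical X n w) p) \<in> borel_measurable M" by measurable
  have "(\<integral>\<^sup>+w. ennreal (sqrt (real n)) * wdist v (empirical X n w) p \<partial>M)
      = ennreal (sqrt (real n)) * (\<integral>\<^sup>+x. ennreal (v x) * (\<integral>\<^sup>+w. ennreal \<bar>pmf (empirical X n w) x - pmf p x\<bar> \<partial>M) \<partial>count_space UNIV)"
    by (simp add: nn_integral_cmult nn_expectation_wdist[OF n v])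
  also have "\<dots> = (\<integral>\<^sup>+x. ennreal (sqrt (real n)) * (ennreal (v x) * (\<integral>\<^sup>+w. ennreal \<bar>pmf (empirical X n w) x - pmf p x\<bar> \<partial>M)) \<partial>count_space UNIV)"
    by (simp add: nn_integral_cmult)
  also have "\<dots> \<le> (\<integral>\<^sup>+x. ennreal (v x * sqrt (pmf p x)) \<partial>count_space UNIV)"
  proof (intro nn_integral_mono)
    fix x
    have "ennreal (sqrt (real n)) * (ennreal (v x) * (\<integral>\<^sup>+w. ennreal \<bar>pmf (empirical X n w) x - pmf p x\<bar> \<partial>M))
        \<le> ennreal (sqrt (real n)) * (ennreal (v x) * ennreal (sqrt (pmf p x) / sqrt (real n)))"
      by (intro mult_left_mono nn_abs_diff_pmf(1)[OF n]) auto
    also have "\<dots> = ennreal (v x * sqrt (pmf p x))"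
      using n v[of x] by (simp flip: ennreal_mult)
    finally show "ennreal (sqrt (real n)) * (ennreal (v x) * (\<integral>\<^sup>+w. ennreal \<bar>pmf (empirical X n w) x - pmf p x\<bar> \<partial>M))
      \<le> ennreal (v x * sqrt (pmf p x))" .
  qed
  also note le
  finally show "(\<integral>\<^sup>+w. ennreal (sqrt (real n)) * wdist v (empirical X n w) p \<partial>M) \<le> ennreal \<eta>" .
qed

text \<open>Here \<open>w\<close> is merely integrable under \<open>p\<close>. The mean distance
  tends to 0 by dominated convergence over \<open>x\<close>, with the two bounds of
  \<open>nn_abs_diff_pmf\<close> giving the limit and the majorant.\<close>

lemma wdist_empirical_tendsto:
  assumes w: "\<And>x. 0 \<le> w x" "pmf_integrable p w" and d: "0 < d"
  shows "(\<lambda>n. measure M {\<omega> \<in> space M. ennreal d \<le> wdist w (empirical X n \<omega>) p}) \<longlonglongrightarrow> 0"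
proof -
  let ?D = "\<lambda>n x. \<integral>\<^sup>+\<omega>. ennreal \<bar>pmf (empirical X n \<omega>) x - pmf p x\<bar> \<partial>M"
  have "(\<lambda>n. \<integral>\<^sup>+x. ennreal (w x) * ?D (Suc n) x \<partial>count_space UNIV) \<longlonglongrightarrow> nn_integral (count_space UNIV) (\<lambda>x::'a. 0)"
  proof (rule nn_integral_dominated_convergence[where u'="\<lambda>_. 0" and w="\<lambda>x. ennreal (pmf p x) * ennreal (2 * w x)"])
    fix n
    show "AE x in count_space UNIV. ennreal (w x) * ?D (Suc n) x \<le> ennreal (pmf p x) * ennreal (2 * w x)"
    proof (intro AE_I2)
      fix x
      have "ennreal (w x) * ?D (Suc n) x \<le> ennreal (w x) * ennreal (2 * pmf p x)"
        by (intro mult_left_mono nn_abs_diff_pmf(2)) auto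
      also have "\<dots> = ennreal (pmf p x) * ennreal (2 * w x)"
        using w(1)[of x] by (simp add: mult_ac flip: ennreal_mult)
      finally show "ennreal (w x) * ?D (Suc n) x \<le> ennreal (pmf p x) * ennreal (2 * w x)" .
    qed
  next
    have "(\<integral>\<^sup>+x. ennreal (pmf p x) * ennreal (2 * w x) \<partial>count_space UNIV) = (\<integral>\<^sup>+x. ennreal (2 * w x) \<partial>measure_pmf p)"
      by (simp add: nn_integral_measure_pmf)
    also have "\<dots> < \<infinity>"
      using integrable_mult_right[OF w(2), of 2] w(1) unfolding integrable_iff_bounded by (simp add: abs_mult)
    finally show "(\<integral>\<^sup>+x. ennreal (pmf p x) * ennreal (2 * w x) \<partial>count_space UNIV) < \<infinity>" .
  next
    show "AE x in count_space UNIV. (\<lambda>n. ennreal (w x) * ?D (Suc n) x) \<longlonglongrightarrow> 0"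
    proof (intro AE_I2)
      fix x
      have "(\<lambda>n. w x * sqrt (pmf p x) * sqrt (inverse (real (Suc n)))) \<longlonglongrightarrow> w x * sqrt (pmf p x) * sqrt 0"
        by (intro tendsto_intros LIMSEQ_inverse_real_of_nat)
      then have "(\<lambda>n. ennreal (w x * sqrt (pmf p x) * sqrt (inverse (real (Suc n))))) \<longlonglongrightarrow> ennreal 0"
        by (intro tendsto_ennrealI) simp
      then have lim: "(\<lambda>n. ennreal (w x * sqrt (pmf p x) * sqrt (inverse (real (Suc n))))) \<longlonglongrightarrow> 0" by simp
      have "ennreal (w x) * ?D (Suc n) x \<le> ennreal (w x * sqrt (pmf p x) * sqrt (inverse (real (Suc n))))" for n
      proof -
        have "ennreal (w x) * ?D (Suc n) x \<le> ennreal (w x) * ennreal (sqrt (pmf p x) / sqrt (real (Suc n)))"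
          by (intro mult_left_mono nn_abs_diff_pmf(1)) auto
        also have "\<dots> = ennreal (w x * sqrt (pmf p x) * sqrt (inverse (real (Suc n))))"
          using w(1)[of x] by (simp add: real_sqrt_inverse divide_inverse mult.assoc flip: ennreal_mult)
        finally show ?thesis .
      qed
      then show "(\<lambda>n. ennreal (w x) * ?D (Suc n) x) \<longlonglongrightarrow> 0"
        by (intro tendsto_sandwich[OF _ _ tendsto_const lim]) auto
    qed
  qed auto
  then have "(\<lambda>n. \<integral>\<^sup>+\<omega>. wdist w (empirical X (Suc n) \<omega>) p \<partial>M) \<longlonglongrightarrow> 0"
    by (simp add: nn_expectation_wdist[OF _ w(1)])
  then have lim: "(\<lambda>n. \<integral>\<^sup>+\<omega>. wdist w (empirical X n \<omega>) p \<partial>M) \<longlonglongrightarrow> 0"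
    by (rule LIMSEQ_imp_Suc)
  show ?thesis
  proof (rule tendstoI)
    fix e :: real assume e: "0 < e"
    have "eventually (\<lambda>n. (\<integral>\<^sup>+\<omega>. wdist w (empirical X n \<omega>) p \<partial>M) < ennreal (e * d / 2)) sequentially"
      using e d by (intro order_tendstoD(2)[OF lim]) simp
    with eventually_gt_at_top[of 0]
    show "eventually (\<lambda>n. dist (measure M {\<omega> \<in> space M. ennreal d \<le> wdist w (empirical X n \<omega>) p}) 0 < e) sequentially"
    proof eventually_elim
      case (elim n)
      have "measure M {\<omega> \<in> space M. ennreal d \<le> wdist w (empirical X n \<omega>) p} \<le> (e * d / 2) / d"
        using elim e d by (intro measure_ge_le_nn_integral wdist_measurable) auto
      then show ?case using e d by simp
    qed
  qed
qed

text \<open>A vanishing variance is treated apart, since the central limit theorem divides by the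
  standard deviation; the fluctuation is then almost surely 0.\<close>

lemma char_fluct_tendsto:
  assumes f: "pmf_integrable p (\<lambda>x. (f x)\<^sup>2)"
  shows "(\<lambda>n. char (distr M borel (fluct f n)) t) \<longlonglongrightarrow> exp (- (pmf_var p f * t\<^sup>2) / 2)"
proof -
  let ?m = "pmf_mean p f" and ?v = "pmf_var p f"
  have f1: "pmf_integrable p f" by (rule measure_pmf.square_integrable_imp_integrable[OF _ f]) simp
  have v0: "0 \<le> ?v" by (rule measure_pmf.variance_positive)
  show ?thesis
  proof (cases "?v = 0")
    case True
    have ae: "AE w in M. fluct f n w = 0" for n
    proof -
      have "(\<integral>\<^sup>+w. ennreal ((fluct f n w)\<^sup>2) \<partial>M) = 0"
        using nn_fluct_square_le[OF f, of n] True by simp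
      then show ?thesis by (subst (asm) nn_integral_0_iff_AE) auto
    qed
    have "char (distr M borel (fluct f n)) t = (CLINT w|M. 1)" for n
    proof -
      have "char (distr M borel (fluct f n)) t = (CLINT w|M. iexp (t * fluct f n w))"
        by (simp add: char_def integral_distr)
      also have "\<dots> = (CLINT w|M. 1)"
      proof (intro integral_cong_AE)
        show "AE w in M. iexp (t * fluct f n w) = 1" using ae[of n] by eventually_elim simp
      qed auto
      finally show ?thesis .
    qed
    then show ?thesis using True by (simp add: prob_space)
  next
    case False
    define \<sigma> where "\<sigma> = sqrt ?v"
    have \<sigma>: "0 < \<sigma>" "\<sigma>\<^sup>2 = ?v" using less_le[of 0 ?v] False v0 by (simp_all only: \<sigma>_def real_sqrt_gt_0_iff real_sqrt_pow2) auto
    have cl: "weak_conv_m (\<lambda>n. distr M borel (\<lambda>w. (\<Sum>i<n. f (X i w) - ?m) / sqrt (real n * \<sigma>\<^sup>2))) std_normal_distribution"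
    proof (rule central_limit_theorem[where X="\<lambda>i w. f (X i w)" and \<mu>="distr (measure_pmf p) borel f"])
      show "indep_vars (\<lambda>i. borel) (\<lambda>i w. f (X i w)) UNIV"
        using centered_indep[of f 0] by simp
      show "expectation (\<lambda>w. f (X n w)) = ?m" for n by (rule expectation_X(1))
      show "integrable M (\<lambda>w. (f (X n w))\<^sup>2)" for n using expectation_X(2)[of "\<lambda>x. (f x)\<^sup>2" n] f by simp
      show "variance (\<lambda>w. f (X n w)) = \<sigma>\<^sup>2" for n
        unfolding expectation_X(1)[of f n] \<sigma>(2) using expectation_X(1)[of "\<lambda>x. (f x - ?m)\<^sup>2" n] by simp
      show "distr M borel (\<lambda>w. f (X n w)) = distr (measure_pmf p) borel f" for n
        by (subst X_distr[of n, symmetric], subst distr_distr) (simp_all add: comp_def)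
    qed (rule \<sigma>(1))
    have "(\<lambda>w. (\<Sum>i<n. f (X i w) - ?m) / sqrt (real n * \<sigma>\<^sup>2)) = (\<lambda>w. fluct f n w / \<sigma>)" for n
      using \<sigma>(1) by (simp add: fluct_eq fun_eq_iff real_sqrt_mult)
    with cl have cl: "weak_conv_m (\<lambda>n. distr M borel (\<lambda>w. fluct f n w / \<sigma>)) std_normal_distribution" by simp
    have "(\<lambda>n. char (distr M borel (\<lambda>w. fluct f n w / \<sigma>)) (\<sigma> * t)) \<longlonglongrightarrow> char std_normal_distribution (\<sigma> * t)"
      by (rule levy_continuity1[OF _ real_dist_normal_dist cl]) simp
    moreover have "char (distr M borel (\<lambda>w. fluct f n w / \<sigma>)) (\<sigma> * t) = char (distr M borel (fluct f n)) t" for n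
      using \<sigma>(1) unfolding char_def by (subst (1 2) integral_distr) (simp_all add: mult_ac)
    ultimately show ?thesis
      by (simp add: char_std_normal_distribution power_mult_distrib \<sigma>(2))
  qed
qed

lemma remainder_conv0:
  assumes n: "filterlim n at_top sequentially"
    and R: "\<And>\<eta>. 0 < \<eta> \<Longrightarrow> \<exists>v B. (\<forall>x. 0 \<le> v x) \<and> (\<integral>\<^sup>+x. ennreal (v x * sqrt (pmf p x)) \<partial>count_space UNIV) \<le> ennreal \<eta> \<and>
        (\<lambda>k. measure M (B k)) \<longlonglongrightarrow> 0 \<and> (\<forall>\<^sub>F k in sequentially. B k \<in> sets M \<and>
          (\<forall>w\<in>space M - B k. ennreal \<bar>R k w\<bar> \<le> wdist v (empirical X (n k) w) p))"
  shows "conv0 M (\<lambda>k w. sqrt (real (n k)) * R k w)"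
  unfolding conv0_def
proof (intro allI impI tendstoI)
  fix e \<epsilon> :: real assume e: "0 < e" and \<epsilon>: "0 < \<epsilon>"
  \<comment> \<open>Markov's inequality will cost \<open>\<eta> / e\<close>, that is
    \<open>\<epsilon> / 4\<close>, next to at most \<open>\<epsilon> / 2\<close> for the exceptional
    event \<open>B k\<close>.\<close>
  define \<eta> where "\<eta> = e * \<epsilon> / 4"
  have "0 < \<eta>" using e \<epsilon> by (simp add: \<eta>_def)
  from R[OF this] obtain v B where v: "\<And>x. 0 \<le> v x" "(\<integral>\<^sup>+x. ennreal (v x * sqrt (pmf p x)) \<partial>count_space UNIV) \<le> ennreal \<eta>"
    and B: "(\<lambda>k. measure M (B k)) \<longlonglongrightarrow> 0"
    and ev: "\<forall>\<^sub>F k in sequentially. B k \<in> sets M \<and> (\<forall>w\<in>space M - B k. ennreal \<bar>R k w\<bar> \<le> wdist v (empirical X (n k) w) p)"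
    by (elim exE conjE) (rule that, auto)
  have "eventually (\<lambda>k. measure M (B k) < \<epsilon> / 2) sequentially"
    using \<epsilon> by (intro order_tendstoD(2)[OF B]) simp
  moreover have "eventually (\<lambda>k. 0 < n k) sequentially"
    by (rule eventually_compose_filterlim[OF eventually_gt_at_top n])
  ultimately show "eventually (\<lambda>k. dist (measure M {w \<in> space M. e < \<bar>sqrt (real (n k)) * R k w\<bar>}) 0 < \<epsilon>) sequentially"
    using ev
  proof eventually_elim
    case (elim k)
    let ?W = "{w \<in> space M. ennreal e \<le> ennreal (sqrt (real (n k))) * wdist v (empirical X (n k) w) p}"
    note [measurable] = wdist_measurable[OF elim(2), of v]
    have W: "?W \<in> sets M" by measurable
    have "{w \<in> space M. e < \<bar>sqrt (real (n k)) * R k w\<bar>} \<subseteq> B k \<union> ?W"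
    proof
      fix w assume w: "w \<in> {w \<in> space M. e < \<bar>sqrt (real (n k)) * R k w\<bar>}"
      show "w \<in> B k \<union> ?W"
      proof (cases "w \<in> B k")
        case False
        then have "ennreal \<bar>R k w\<bar> \<le> wdist v (empirical X (n k) w) p" using elim(3) w by auto
        have "ennreal e \<le> ennreal (sqrt (real (n k)) * \<bar>R k w\<bar>)" using w by (intro ennreal_leI) (simp add: abs_mult)
        also have "\<dots> = ennreal (sqrt (real (n k))) * ennreal \<bar>R k w\<bar>" by (simp add: ennreal_mult)
        also have "\<dots> \<le> ennreal (sqrt (real (n k))) * wdist v (empirical X (n k) w) p"
          by (intro mult_left_mono) (use \<open>ennreal \<bar>R k w\<bar> \<le> _\<close> in auto)
        finally show ?thesis using w by simp
      qed simp
    qed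
    then have "measure M {w \<in> space M. e < \<bar>sqrt (real (n k)) * R k w\<bar>} \<le> measure M (B k) + measure M ?W"
      using elim(3) W by (intro order_trans[OF finite_measure_mono measure_Un_le]) auto
    also have "measure M ?W \<le> \<eta> / e"
      using v e \<open>0 < \<eta>\<close> by (intro prob_sqrt_wdist_ge elim(2)) auto
    also have "\<eta> / e = \<epsilon> / 4" using e by (simp add: \<eta>_def)
    finally show ?case using elim(1) \<epsilon> by simp
  qed
qed

end

section \<open>Limit laws\<close>

lemma integrable_count_space_of_summable:
  fixes f g :: "'a \<Rightarrow> real"
  assumes g: "g summable_on UNIV" and le: "\<And>x. \<bar>f x\<bar> \<le> g x"
  shows "integrable (count_space UNIV) f"
proof -
  have "integrable (count_space UNIV) g"
    by (rule abs_summable_equivalent[THEN iffD1, OF summable_on_iff_abs_summable_on_real[THEN iffD1, OF g],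
          unfolded abs_summable_on_def])
  then show ?thesis
    by (rule Bochner_Integration.integrable_bound) (use order_trans[OF le abs_ge_self] in auto)
qed

text \<open>A nonnegative summable function is bounded by its sum, hence its square by a multiple of
  itself. With \<open>q = C * sqrt p\<close> this yields the second moment of the weight
  \<open>C\<close> under \<open>p\<close>.\<close>

lemma integrable_count_space_square:
  fixes q :: "'a \<Rightarrow> real"
  assumes q: "integrable (count_space UNIV) q" and q0: "\<And>x. 0 \<le> q x"
  shows "integrable (count_space UNIV) (\<lambda>x. (q x)\<^sup>2)"
proof -
  define I where "I = (\<integral>x. q x \<partial>count_space UNIV)"
  have "0 \<le> I" unfolding I_def by (intro integral_nonneg_AE AE_I2 q0)
  have q_le: "q x \<le> I" for x
  proof -
    have "ennreal (q x) \<le> (\<integral>\<^sup>+x. ennreal (q x) \<partial>count_space UNIV)" by (rule nn_integral_ge_point) simp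
    also have "\<dots> = ennreal I" unfolding I_def by (rule nn_integral_eq_integral[OF q AE_I2[OF q0]])
    finally show ?thesis using \<open>0 \<le> I\<close> by (simp only: ennreal_le_iff)
  qed
  show ?thesis
  proof (rule Bochner_Integration.integrable_bound[OF integrable_mult_right[OF q, of I]])
    show "AE x in count_space UNIV. norm ((q x)\<^sup>2) \<le> norm (I * q x)"
    proof (intro AE_I2)
      fix x
      have "(q x)\<^sup>2 \<le> I * q x"
        unfolding power2_eq_square by (rule mult_right_mono[OF q_le q0])
      then show "norm ((q x)\<^sup>2) \<le> norm (I * q x)" by simp
    qed
  qed simp
qed

text \<open>All moments come from one summability condition, using \<open>p \<le> sqrt p\<close> and
  the fact that the second cost weight and the exponential weight are at least 1, hence below their
  squares.\<close>

lemma weight_moments: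
  fixes p :: "'a pmf"
  assumes sum: "(\<lambda>x. weight_C lo hi x * sqrt (pmf p x)
          + ((weight_C lo' hi' x)\<^sup>2 + (weight_phi lam lo' hi' x)\<^sup>2) * pmf p x) summable_on UNIV"
    and lam: "0 < lam" and le: "\<And>x. lo' x \<le> hi' x"
  shows "pmf_integrable p (\<lambda>x. weight_C lo hi x + weight_C lo' hi' x + weight_phi lam lo' hi' x)"
    and "integrable (count_space UNIV) (\<lambda>x. weight_C lo hi x * sqrt (pmf p x))"
    and "pmf_integrable p (\<lambda>x. (weight_C lo hi x)\<^sup>2)"
proof -
  let ?C = "weight_C lo hi" and ?C' = "weight_C lo' hi'" and ?\<phi> = "weight_phi lam lo' hi'"
  have C: "0 \<le> ?C x" "1 \<le> ?C' x" for x using weight_C_ge_1[of lo hi x] weight_C_ge_1[of lo' hi' x] by linarith+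
  have \<phi>: "1 \<le> ?\<phi> x" for x using le[of x] lam by (simp add: weight_phi_def)
  have sq: "?C' x \<le> (?C' x)\<^sup>2" "?\<phi> x \<le> (?\<phi> x)\<^sup>2" for x
    using C(2)[of x] \<phi>[of x] by (simp_all add: power2_eq_square mult_le_cancel_left1)
  have r: "pmf p x \<le> sqrt (pmf p x)" for x
    using real_sqrt_le_mono[OF mult_left_le[OF pmf_le_1 pmf_nonneg, of p x p x]] by simp
  show "pmf_integrable p (\<lambda>x. ?C x + ?C' x + ?\<phi> x)"
    unfolding integrable_measure_pmf_iff
  proof (rule integrable_count_space_of_summable[OF sum])
    fix x
    have "?C x * pmf p x \<le> ?C x * sqrt (pmf p x)" by (intro mult_left_mono C r)
    moreover have "(?C' x + ?\<phi> x) * pmf p x \<le> ((?C' x)\<^sup>2 + (?\<phi> x)\<^sup>2) * pmf p x"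
      using sq[of x] by (intro mult_right_mono) auto
    moreover have "0 \<le> pmf p x * (?C x + ?C' x + ?\<phi> x)" using C[of x] \<phi>[of x] by (intro mult_nonneg_nonneg) auto
    ultimately show "\<bar>pmf p x * (?C x + ?C' x + ?\<phi> x)\<bar> \<le> ?C x * sqrt (pmf p x) + ((?C' x)\<^sup>2 + (?\<phi> x)\<^sup>2) * pmf p x"
      by (simp add: algebra_simps)
  qed
  show q: "integrable (count_space UNIV) (\<lambda>x. ?C x * sqrt (pmf p x))"
    by (rule integrable_count_space_of_summable[OF sum]) (simp add: C abs_mult)
  show "pmf_integrable p (\<lambda>x. (?C x)\<^sup>2)"
    using integrable_count_space_square[OF q] C(1) by (simp add: integrable_measure_pmf_iff power_mult_distrib mult.commute)
qed

lemma (in prob_space) indep_samples_imp_indep_var: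
  fixes X :: "nat \<Rightarrow> 'a \<Rightarrow> 'x" and Y :: "nat \<Rightarrow> 'a \<Rightarrow> 'y"
  assumes ind: "indep_samples M X Y"
    and X: "\<And>i. X i \<in> M \<rightarrow>\<^sub>M count_space UNIV" and Y: "\<And>i. Y i \<in> M \<rightarrow>\<^sub>M count_space UNIV"
    and f: "f \<in> (\<Pi>\<^sub>M i\<in>UNIV. count_space UNIV) \<rightarrow>\<^sub>M borel" and g: "g \<in> (\<Pi>\<^sub>M i\<in>UNIV. count_space UNIV) \<rightarrow>\<^sub>M borel"
  shows "indep_var borel (\<lambda>w. f (\<lambda>i. X i w)) borel (\<lambda>w. g (\<lambda>i. Y i w))"
proof -
  have sub: "sigma_sets (space M) {(\<lambda>w. h (\<lambda>i. V i w)) -` A \<inter> space M |A. A \<in> sets borel}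
      \<subseteq> sets (vimage_algebra (space M) (\<lambda>w i. V i w) (\<Pi>\<^sub>M i\<in>UNIV. count_space UNIV))"
    if h: "h \<in> (\<Pi>\<^sub>M i\<in>UNIV. count_space UNIV) \<rightarrow>\<^sub>M borel"
    for V :: "nat \<Rightarrow> 'a \<Rightarrow> 'v" and h :: "(nat \<Rightarrow> 'v) \<Rightarrow> 'c::topological_space"
  proof -
    let ?N = "vimage_algebra (space M) (\<lambda>w i. V i w) (\<Pi>\<^sub>M i\<in>UNIV. count_space UNIV)"
    have "(\<lambda>w. h (\<lambda>i. V i w)) -` A \<inter> space M \<in> sets ?N" if "A \<in> sets borel" for A
    proof -
      have "(\<lambda>w i. V i w) -` (h -` A \<inter> space (\<Pi>\<^sub>M i\<in>UNIV. count_space UNIV)) \<inter> space M \<in> sets ?N"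
        by (intro in_vimage_algebra measurable_sets[OF h that])
      moreover have "(\<lambda>w i. V i w) -` (h -` A \<inter> space (\<Pi>\<^sub>M i\<in>UNIV. count_space UNIV)) \<inter> space M
          = (\<lambda>w. h (\<lambda>i. V i w)) -` A \<inter> space M"
        by (auto simp: space_PiM)
      ultimately show ?thesis by simp
    qed
    then show ?thesis
      using sets.sigma_sets_subset[of "{(\<lambda>w. h (\<lambda>i. V i w)) -` A \<inter> space M |A. A \<in> sets borel}" ?N] by auto
  qed
  have "(\<lambda>w i. X i w) \<in> M \<rightarrow>\<^sub>M (\<Pi>\<^sub>M i\<in>UNIV. count_space UNIV)" "(\<lambda>w i. Y i w) \<in> M \<rightarrow>\<^sub>M (\<Pi>\<^sub>M i\<in>UNIV. count_space UNIV)"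
    using X Y by (auto intro!: measurable_PiM_single' simp: space_PiM)
  then have "random_variable borel (\<lambda>w. f (\<lambda>i. X i w))" "random_variable borel (\<lambda>w. g (\<lambda>i. Y i w))"
    using f g by (auto intro: measurable_compose)
  moreover have "indep_set (sigma_sets (space M) {(\<lambda>w. f (\<lambda>i. X i w)) -` A \<inter> space M |A. A \<in> sets borel})
      (sigma_sets (space M) {(\<lambda>w. g (\<lambda>i. Y i w)) -` A \<inter> space M |A. A \<in> sets borel})"
    using ind sub[OF f, of X] sub[OF g, of Y] unfolding indep_samples_def indep_sets2_eq by blast
  ultimately show ?thesis unfolding indep_var_eq by blast
qed

section \<open>The one-sample limit\<close>

locale erot_sample = erot_costs lam c cX_lo cX_hi dX_lo dX_hi cY_lo cY_hi dY_lo dY_hi + prob_space M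
  for lam and c :: "'x::countable \<Rightarrow> 'y::countable \<Rightarrow> real"
    and cX_lo cX_hi dX_lo dX_hi cY_lo cY_hi dY_lo dY_hi and M :: "'w measure" +
  fixes r :: "'x pmf" and s :: "'y pmf" and X :: "nat \<Rightarrow> 'w \<Rightarrow> 'x" and \<alpha> \<beta>
  assumes X_iid: "iid_sample M r X"
    and r_WX: "pmf_integrable r WX" and s_WY: "pmf_integrable s WY"
    and S: "schr r s \<alpha> \<beta>"
    and qX: "integrable (count_space UNIV) (\<lambda>x. CX x * sqrt (pmf r x))"
begin

sublocale X: iid_sequence M r X
  by unfold_locales (rule X_iid)

definition RX :: "nat \<Rightarrow> 'w \<Rightarrow> real" where
  "RX n w = cost (empirical X n w) s - cost r s
     - (pmf_mean (empirical X n w) \<alpha> - pmf_mean r \<alpha>)"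

lemma RX_measurable: "(\<lambda>w. sqrt (real n) * RX n w) \<in> borel_measurable M"
proof (cases "n = 0")
  case False
  then show ?thesis
    unfolding RX_def
    by (intro X.empirical_function_measurable[where f="\<lambda>p. sqrt (real n) * (cost p s - cost r s - (pmf_mean p \<alpha> - pmf_mean r \<alpha>))"]) auto
qed simp

lemma RX_conv0:
  assumes \<alpha>0: "\<alpha> x0 = 0" and n: "filterlim n at_top sequentially"
  shows "conv0 M (\<lambda>k w. sqrt (real (n k)) * RX (n k) w)"
proof (rule X.remainder_conv0[OF n])
  fix \<eta> :: real assume "0 < \<eta>"
  obtain \<delta> v where v: "0 < \<delta>" "\<And>x. 0 \<le> v x" "(\<integral>\<^sup>+x. ennreal (v x * sqrt (pmf r x)) \<partial>count_space UNIV) \<le> ennreal \<eta>"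
    "\<And>r'. wdist WX r' r < ennreal \<delta> \<Longrightarrow>
      ennreal \<bar>cost r' s - cost r s
        - (pmf_mean r' \<alpha> - pmf_mean r \<alpha>)\<bar> \<le> wdist v r' r"
    by (rule EROT_expansion_X[OF r_WX s_WY S \<alpha>0 qX \<open>0 < \<eta>\<close>]) (rule that)
  \<comment> \<open>The exceptional event: the empirical law leaves the ball on which the expansion
    is valid.\<close>
  let ?B = "\<lambda>n. {w \<in> space M. ennreal \<delta> \<le> wdist WX (empirical X n w) r}"
  show "\<exists>v B. (\<forall>x. 0 \<le> v x) \<and> (\<integral>\<^sup>+x. ennreal (v x * sqrt (pmf r x)) \<partial>count_space UNIV) \<le> ennreal \<eta> \<and>
        (\<lambda>k. measure M (B k)) \<longlonglongrightarrow> 0 \<and> (\<forall>\<^sub>F k in sequentially. B k \<in> sets M \<and>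
          (\<forall>w\<in>space M - B k. ennreal \<bar>RX (n k) w\<bar> \<le> wdist v (empirical X (n k) w) r))"
  proof (intro exI conjI allI)
    show "(\<lambda>k. measure M (?B (n k))) \<longlonglongrightarrow> 0"
      by (rule filterlim_compose[OF X.wdist_empirical_tendsto[OF WX_ge(4) r_WX v(1)] n])
    show "\<forall>\<^sub>F k in sequentially. ?B (n k) \<in> sets M \<and>
        (\<forall>w\<in>space M - ?B (n k). ennreal \<bar>RX (n k) w\<bar> \<le> wdist v (empirical X (n k) w) r)"
      using eventually_compose_filterlim[OF eventually_gt_at_top[of 0] n]
    proof eventually_elim
      case (elim k)
      note [measurable] = X.wdist_measurable[OF elim, of WX]
      show ?case by (auto simp: RX_def not_le intro!: v(4))
    qed
  qed (rule v(2), rule v(3))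
qed

lemma statistic_eq_X:
  "sqrt (real n) * (cost (empirical X n w) s - cost r s) = sqrt (real n) * RX n w + X.fluct \<alpha> n w"
  by (simp add: RX_def X.fluct_def algebra_simps)

lemma one_sample_limit:
  assumes \<alpha>0: "\<alpha> x0 = 0" and sq: "pmf_integrable r (\<lambda>x. (\<alpha> x)\<^sup>2)"
  shows "weak_conv_m (\<lambda>k. distr M borel (\<lambda>w. sqrt (real k) * (cost (empirical X k w) s - cost r s)))
    (normal_law 0 (pmf_var r \<alpha>))"
  unfolding statistic_eq_X
proof (rule levy_continuity[OF real_distribution_distr real_distribution_normal_law])
  show meas: "(\<lambda>w. sqrt (real k) * RX k w + X.fluct \<alpha> k w) \<in> borel_measurable M" for k
    by (intro borel_measurable_add RX_measurable X.fluct_measurable)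
  fix t
  have v0: "0 \<le> pmf_var r \<alpha>" by (rule measure_pmf.variance_positive)
  have d: "conv0 M (\<lambda>k w. sqrt (real k) * RX k w + X.fluct \<alpha> k w - X.fluct \<alpha> k w)"
    using RX_conv0[OF \<alpha>0 filterlim_ident] by simp
  from char_tendsto_of_conv0[OF meas X.fluct_measurable d X.char_fluct_tendsto[OF sq]]
  show "(\<lambda>k. char (distr M borel (\<lambda>w. sqrt (real k) * RX k w + X.fluct \<alpha> k w)) t)
      \<longlonglongrightarrow> char (normal_law 0 (pmf_var r \<alpha>)) t"
    using v0 by (simp only: char_normal_law power_mult_distrib real_sqrt_pow2)
qed

end

section \<open>The two-sample limit\<close>

locale erot_two_samples = erot_sample lam c cX_lo cX_hi dX_lo dX_hi cY_lo cY_hi dY_lo dY_hi M r s X \<alpha> \<beta>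
  for lam and c :: "'x::countable \<Rightarrow> 'y::countable \<Rightarrow> real"
    and cX_lo cX_hi dX_lo dX_hi cY_lo cY_hi dY_lo dY_hi and M :: "'w measure"
    and r s X \<alpha> \<beta> +
  fixes Y :: "nat \<Rightarrow> 'w \<Rightarrow> 'y"
  assumes Y_iid: "iid_sample M s Y"
    and qY: "integrable (count_space UNIV) (\<lambda>y. CY y * sqrt (pmf s y))"
begin

sublocale Y: iid_sequence M s Y
  by unfold_locales (rule Y_iid)

definition RY :: "nat \<Rightarrow> nat \<Rightarrow> 'w \<Rightarrow> real" where
  "RY n m w = cost (empirical X n w) (empirical Y m w) - cost (empirical X n w) s
     - (pmf_mean (empirical Y m w) \<beta> - pmf_mean s \<beta>)"

text \<open>The empirical laws are frozen one after the other. Positivity of \<open>n\<close>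
  excludes an unspecified first law, while for \<open>m = 0\<close> the factor \<open>sqrt m\<close>
  vanishes.\<close>

lemma RY_measurable: "0 < n \<Longrightarrow> (\<lambda>w. sqrt (real m) * RY n m w) \<in> borel_measurable M"
proof (cases "m = 0")
  case False
  assume "0 < n"
  then show ?thesis
    unfolding RY_def
    using False
    by (intro X.empirical_measurable_Pair[where f="\<lambda>p w. sqrt (real m) * (cost p (empirical Y m w) - cost p s - (pmf_mean (empirical Y m w) \<beta> - pmf_mean s \<beta>))"]
        Y.empirical_function_measurable[where f="\<lambda>q. sqrt (real m) * (cost _ q - cost _ s - (pmf_mean q \<beta> - pmf_mean s \<beta>))"]) auto
qed simp

lemma RY_conv0:
  assumes \<alpha>0: "\<alpha> x0 = 0" and n: "filterlim n at_top sequentially" and m: "filterlim m at_top sequentially"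
  shows "conv0 M (\<lambda>k w. sqrt (real (m k)) * RY (n k) (m k) w)"
proof (rule Y.remainder_conv0[OF m])
  fix \<eta> :: real assume "0 < \<eta>"
  obtain \<delta> v where v: "0 < \<delta>" "\<And>y. 0 \<le> v y" "(\<integral>\<^sup>+y. ennreal (v y * sqrt (pmf s y)) \<partial>count_space UNIV) \<le> ennreal \<eta>"
    "\<And>r' s'. wdist WX r' r < ennreal \<delta> \<Longrightarrow> wdist WY s' s < ennreal \<delta> \<Longrightarrow>
      ennreal \<bar>cost r' s' - cost r' s
        - (pmf_mean s' \<beta> - pmf_mean s \<beta>)\<bar> \<le> wdist v s' s"
    by (rule EROT_expansion_Y[OF r_WX s_WY S \<alpha>0 qY \<open>0 < \<eta>\<close>]) (rule that)
  let ?B = "\<lambda>n. {w \<in> space M. ennreal \<delta> \<le> wdist WX (empirical X n w) r}"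
  let ?C = "\<lambda>m. {w \<in> space M. ennreal \<delta> \<le> wdist WY (empirical Y m w) s}"
  have pos: "\<forall>\<^sub>F k in sequentially. 0 < n k \<and> 0 < m k"
    by (intro eventually_conj eventually_compose_filterlim[OF eventually_gt_at_top[of 0]] n m)
  have sets: "\<forall>\<^sub>F k in sequentially. ?B (n k) \<in> sets M \<and> ?C (m k) \<in> sets M"
    using pos
  proof eventually_elim
    case (elim k)
    note [measurable] = X.wdist_measurable[of "n k" WX] Y.wdist_measurable[of "m k" WY]
    show ?case using elim by auto
  qed
  show "\<exists>v B. (\<forall>x. 0 \<le> v x) \<and> (\<integral>\<^sup>+x. ennreal (v x * sqrt (pmf s x)) \<partial>count_space UNIV) \<le> ennreal \<eta> \<and>
        (\<lambda>k. measure M (B k)) \<longlonglongrightarrow> 0 \<and> (\<forall>\<^sub>F k in sequentially. B k \<in> sets M \<and>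
          (\<forall>w\<in>space M - B k. ennreal \<bar>RY (n k) (m k) w\<bar> \<le> wdist v (empirical Y (m k) w) s))"
  proof (intro exI conjI allI)
    have "(\<lambda>k. measure M (?B (n k)) + measure M (?C (m k))) \<longlonglongrightarrow> 0 + 0"
      by (intro tendsto_add filterlim_compose[OF X.wdist_empirical_tendsto[OF WX_ge(4) r_WX v(1)] n]
          filterlim_compose[OF Y.wdist_empirical_tendsto[OF WY_ge(4) s_WY v(1)] m])
    then have lim: "(\<lambda>k. measure M (?B (n k)) + measure M (?C (m k))) \<longlonglongrightarrow> 0" by simp
    show "(\<lambda>k. measure M (?B (n k) \<union> ?C (m k))) \<longlonglongrightarrow> 0"
      by (rule tendsto_sandwich[OF _ _ tendsto_const lim]) (use sets in \<open>auto elim!: eventually_mono intro!: measure_Un_le\<close>)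
    show "\<forall>\<^sub>F k in sequentially. ?B (n k) \<union> ?C (m k) \<in> sets M \<and>
        (\<forall>w\<in>space M - (?B (n k) \<union> ?C (m k)). ennreal \<bar>RY (n k) (m k) w\<bar> \<le> wdist v (empirical Y (m k) w) s)"
      using sets
    proof eventually_elim
      case (elim k)
      then show ?case by (auto simp: RY_def not_le intro!: v(4))
    qed
  qed (rule v(2), rule v(3))
qed

text \<open>The increment telescopes through the mixed value at \<open>(empirical X n w, s)\<close>.
  The common scale \<open>c'\<close> factors in two ways, so each part is seen at its own scale
  \<open>sqrt n\<close> or \<open>sqrt m\<close>.\<close>

lemma statistic_eq_XY:
  assumes "a * sqrt (real n) = c'" "b * sqrt (real m) = c'"
  shows "c' * (cost (empirical X n w) (empirical Y m w) - cost r s)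
    = (a * (sqrt (real n) * RX n w) + b * (sqrt (real m) * RY n m w)) + (a * X.fluct \<alpha> n w + b * Y.fluct \<beta> m w)"
proof -
  have "cost (empirical X n w) (empirical Y m w) - cost r s = (RX n w + (pmf_mean (empirical X n w) \<alpha> - pmf_mean r \<alpha>))
      + (RY n m w + (pmf_mean (empirical Y m w) \<beta> - pmf_mean s \<beta>))"
    by (simp add: RX_def RY_def)
  then have "c' * (cost (empirical X n w) (empirical Y m w) - cost r s)
      = c' * (RX n w + (pmf_mean (empirical X n w) \<alpha> - pmf_mean r \<alpha>))
      + c' * (RY n m w + (pmf_mean (empirical Y m w) \<beta> - pmf_mean s \<beta>))"
    by (simp only: distrib_left)
  also have "\<dots> = a * sqrt (real n) * (RX n w + (pmf_mean (empirical X n w) \<alpha> - pmf_mean r \<alpha>))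
      + b * sqrt (real m) * (RY n m w + (pmf_mean (empirical Y m w) \<beta> - pmf_mean s \<beta>))"
    by (simp only: assms)
  finally show ?thesis by (simp add: X.fluct_def Y.fluct_def algebra_simps)
qed

lemma char_fluct_sum:
  assumes "indep_samples M X Y"
  shows "char (distr M borel (\<lambda>w. a * X.fluct f n w + b * Y.fluct g m w)) t
    = char (distr M borel (X.fluct f n)) (a * t) * char (distr M borel (Y.fluct g m)) (b * t)"
proof -
  let ?f = "\<lambda>x. a * ((\<Sum>i<n. f (x i) - pmf_mean r f) / sqrt (real n))"
  let ?g = "\<lambda>y. b * ((\<Sum>i<m. g (y i) - pmf_mean s g) / sqrt (real m))"
  have coord: "(\<lambda>z. h (z i)) \<in> borel_measurable (\<Pi>\<^sub>M i\<in>UNIV. count_space UNIV)" for h :: "'c \<Rightarrow> real" and i :: nat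
    by (rule measurable_compose[OF measurable_component_singleton]) auto
  have "indep_var borel (\<lambda>w. ?f (\<lambda>i. X i w)) borel (\<lambda>w. ?g (\<lambda>i. Y i w))"
    by (intro indep_samples_imp_indep_var[OF assms] X.X_measurable Y.X_measurable borel_measurable_times
        borel_measurable_divide borel_measurable_sum borel_measurable_diff coord borel_measurable_const)
  then have "indep_var borel (\<lambda>w. a * X.fluct f n w) borel (\<lambda>w. b * Y.fluct g m w)"
    by (simp only: X.fluct_eq Y.fluct_eq)
  then have "char (distr M borel (\<lambda>w. a * X.fluct f n w + b * Y.fluct g m w)) t
      = char (distr M borel (\<lambda>w. a * X.fluct f n w)) t * char (distr M borel (\<lambda>w. b * Y.fluct g m w)) t"
    by (rule char_distr_add)
  moreover have "char (distr M borel (\<lambda>w. u * h w)) t = char (distr M borel h) (u * t)"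
    if "h \<in> borel_measurable M" for u and h :: "'w \<Rightarrow> real"
    using that unfolding char_def by (subst (1 2) integral_distr) (simp_all add: mult_ac)
  ultimately show ?thesis by simp
qed

text \<open>The statistic differs from the combination \<open>G\<close> with constant coefficients
  by two remainders and two fluctuations with null coefficients, all tending to 0 in probability.
  For \<open>G\<close>, independence turns the characteristic function into a product of two
  one-sample ones.\<close>

lemma two_sample_limit:
  assumes \<alpha>0: "\<alpha> x0 = 0" and sq\<alpha>: "pmf_integrable r (\<lambda>x. (\<alpha> x)\<^sup>2)" and sq\<beta>: "pmf_integrable s (\<lambda>y. (\<beta> y)\<^sup>2)"
    and ind: "indep_samples M X Y"
    and n: "filterlim n at_top sequentially" and m: "filterlim m at_top sequentially"
    and ratio: "(\<lambda>k. real (m k) / real (m k + n k)) \<longlonglongrightarrow> \<delta>" and \<delta>: "0 < \<delta>" "\<delta> < 1"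
  shows "weak_conv_m (\<lambda>k. distr M borel (\<lambda>w. sqrt (real (n k * m k) / real (n k + m k))
      * (cost (empirical X (n k) w) (empirical Y (m k) w) - cost r s)))
    (normal_law 0 (\<delta> * pmf_var r \<alpha> + (1 - \<delta>) * pmf_var s \<beta>))"
proof -
  let ?v = "pmf_var r \<alpha>" and ?u = "pmf_var s \<beta>"
  define a where "a k = sqrt (real (m k) / real (m k + n k))" for k
  define b where "b k = sqrt (real (n k) / real (m k + n k))" for k
  let ?c = "\<lambda>k. sqrt (real (n k * m k) / real (n k + m k))"
  have ab: "a k * sqrt (real (n k)) = ?c k" "b k * sqrt (real (m k)) = ?c k" for k
    by (simp_all add: a_def b_def mult.commute add.commute flip: real_sqrt_mult)
  have pos: "\<forall>\<^sub>F k in sequentially. 0 < n k \<and> 0 < m k"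
    by (intro eventually_conj eventually_compose_filterlim[OF eventually_gt_at_top[of 0]] n m)
  have a_lim: "a \<longlonglongrightarrow> sqrt \<delta>" unfolding a_def by (intro tendsto_intros ratio)
  have "(\<lambda>k. 1 - real (m k) / real (m k + n k)) \<longlonglongrightarrow> 1 - \<delta>" by (intro tendsto_intros ratio)
  moreover have "\<forall>\<^sub>F k in sequentially. 1 - real (m k) / real (m k + n k) = real (n k) / real (m k + n k)"
    using pos by eventually_elim (simp add: field_simps)
  ultimately have "(\<lambda>k. real (n k) / real (m k + n k)) \<longlonglongrightarrow> 1 - \<delta>" by (rule Lim_transform_eventually)
  then have b_lim: "b \<longlonglongrightarrow> sqrt (1 - \<delta>)" unfolding b_def by (intro tendsto_intros)
  have le1: "\<bar>a k\<bar> \<le> 1" "\<bar>b k\<bar> \<le> 1" for k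
    by (auto simp: a_def b_def divide_le_eq_1)
  define T where "T k w = ?c k * (cost (empirical X (n k) w) (empirical Y (m k) w) - cost r s)" for k w
  define G where "G k w = sqrt \<delta> * X.fluct \<alpha> (n k) w + sqrt (1 - \<delta>) * Y.fluct \<beta> (m k) w" for k w
  have G_meas: "G k \<in> borel_measurable M" for k unfolding G_def[abs_def] by measurable
  have T_meas: "T k \<in> borel_measurable M" for k
  \<comment> \<open>With an empty sample the prefactor is 0, so the unspecified empirical law does
    not affect measurability.\<close>
  proof (cases "n k = 0 \<or> m k = 0")
    case True
    then have "T k = (\<lambda>w. 0)" by (auto simp: T_def)
    then show ?thesis by simp
  next
    case False
    then show ?thesis
      unfolding T_def[abs_def]
      by (intro X.empirical_measurable_Pair[where f="\<lambda>p w. ?c k * (cost p (empirical Y (m k) w) - cost r s)"]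
          Y.empirical_function_measurable[where f="\<lambda>q. ?c k * (cost _ q - cost r s)"]) auto
  qed
  have RX0: "conv0 M (\<lambda>k w. a k * (sqrt (real (n k)) * RX (n k) w))"
    by (rule conv0_mono[OF RX_conv0[OF \<alpha>0 n]])
      (auto simp: RX_measurable abs_mult[of "a _"] intro!: mult_left_le_one_le le1)
  have RYm: "\<forall>\<^sub>F k in sequentially. (\<lambda>w. sqrt (real (m k)) * RY (n k) (m k) w) \<in> borel_measurable M"
    using pos by eventually_elim (simp add: RY_measurable)
  have RY0: "conv0 M (\<lambda>k w. b k * (sqrt (real (m k)) * RY (n k) (m k) w))"
    by (rule conv0_mono[OF RY_conv0[OF \<alpha>0 n m] RYm])
      (auto simp: abs_mult[of "b _"] intro!: mult_left_le_one_le le1)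
  have "(\<lambda>k. a k - sqrt \<delta>) \<longlonglongrightarrow> sqrt \<delta> - sqrt \<delta>" "(\<lambda>k. b k - sqrt (1 - \<delta>)) \<longlonglongrightarrow> sqrt (1 - \<delta>) - sqrt (1 - \<delta>)"
    by (intro tendsto_intros a_lim b_lim)+
  then have null: "(\<lambda>k. a k - sqrt \<delta>) \<longlonglongrightarrow> 0" "(\<lambda>k. b k - sqrt (1 - \<delta>)) \<longlonglongrightarrow> 0" by simp_all
  have Z0: "conv0 M (\<lambda>k w. (a k - sqrt \<delta>) * X.fluct \<alpha> (n k) w)"
    by (rule conv0_null_sequence_mult[OF X.fluct_measurable X.nn_fluct_square_le[OF sq\<alpha>] measure_pmf.variance_positive null(1)])
  have W0: "conv0 M (\<lambda>k w. (b k - sqrt (1 - \<delta>)) * Y.fluct \<beta> (m k) w)"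
    by (rule conv0_null_sequence_mult[OF Y.fluct_measurable Y.nn_fluct_square_le[OF sq\<beta>] measure_pmf.variance_positive null(2)])
  have meas: "\<forall>\<^sub>F k in sequentially. (\<lambda>w. a k * (sqrt (real (n k)) * RX (n k) w)) \<in> borel_measurable M"
    "\<forall>\<^sub>F k in sequentially. (\<lambda>w. b k * (sqrt (real (m k)) * RY (n k) (m k) w)) \<in> borel_measurable M"
    "\<forall>\<^sub>F k in sequentially. (\<lambda>w. (a k - sqrt \<delta>) * X.fluct \<alpha> (n k) w) \<in> borel_measurable M"
    "\<forall>\<^sub>F k in sequentially. (\<lambda>w. (b k - sqrt (1 - \<delta>)) * Y.fluct \<beta> (m k) w) \<in> borel_measurable M"
    using RYm by (auto intro!: always_eventually borel_measurable_times RX_measurable elim!: eventually_mono)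
  note add_meas = eventually_elim2[OF _ _ borel_measurable_add]
  have "conv0 M (\<lambda>k w. (a k * (sqrt (real (n k)) * RX (n k) w) + b k * (sqrt (real (m k)) * RY (n k) (m k) w))
      + ((a k - sqrt \<delta>) * X.fluct \<alpha> (n k) w + (b k - sqrt (1 - \<delta>)) * Y.fluct \<beta> (m k) w))"
    by (intro conv0_add RX0 RY0 Z0 W0 meas add_meas[OF meas(1,2)] add_meas[OF meas(3,4)])
  moreover have "(a k * (sqrt (real (n k)) * RX (n k) w) + b k * (sqrt (real (m k)) * RY (n k) (m k) w))
      + ((a k - sqrt \<delta>) * X.fluct \<alpha> (n k) w + (b k - sqrt (1 - \<delta>)) * Y.fluct \<beta> (m k) w) = T k w - G k w" for k w
    unfolding T_def statistic_eq_XY[OF ab] G_def by (simp only: left_diff_distrib)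
  ultimately have d: "conv0 M (\<lambda>k w. T k w - G k w)" by simp
  have v0: "0 \<le> ?v" "0 \<le> ?u" by (rule measure_pmf.variance_positive)+
  show ?thesis
    unfolding T_def[symmetric]
  proof (rule levy_continuity[OF real_distribution_distr real_distribution_normal_law])
    show "(\<lambda>w. T k w) \<in> borel_measurable M" for k by (rule T_meas)
    fix t
    have "(\<lambda>k. char (distr M borel (X.fluct \<alpha> (n k))) (sqrt \<delta> * t) * char (distr M borel (Y.fluct \<beta> (m k))) (sqrt (1 - \<delta>) * t))
        \<longlonglongrightarrow> of_real (exp (- (?v * (sqrt \<delta> * t)\<^sup>2) / 2)) * of_real (exp (- (?u * (sqrt (1 - \<delta>) * t)\<^sup>2) / 2))"
      by (intro tendsto_mult filterlim_compose[OF X.char_fluct_tendsto[OF sq\<alpha>] n] filterlim_compose[OF Y.char_fluct_tendsto[OF sq\<beta>] m])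
    also have "of_real (exp (- (?v * (sqrt \<delta> * t)\<^sup>2) / 2)) * of_real (exp (- (?u * (sqrt (1 - \<delta>) * t)\<^sup>2) / 2))
        = char (normal_law 0 (\<delta> * ?v + (1 - \<delta>) * ?u)) t"
    proof -
      have sd: "(sqrt \<delta> * t)\<^sup>2 = \<delta> * t\<^sup>2" "(sqrt (1 - \<delta>) * t)\<^sup>2 = (1 - \<delta>) * t\<^sup>2"
        "(sqrt (\<delta> * ?v + (1 - \<delta>) * ?u) * t)\<^sup>2 = (\<delta> * ?v + (1 - \<delta>) * ?u) * t\<^sup>2"
        using \<delta> v0 by (simp_all add: power_mult_distrib)
      have "- (?v * (\<delta> * t\<^sup>2)) / 2 + - (?u * ((1 - \<delta>) * t\<^sup>2)) / 2 = - ((\<delta> * ?v + (1 - \<delta>) * ?u) * t\<^sup>2) / 2"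
        by (simp add: field_simps)
      then show ?thesis
        unfolding char_normal_law sd of_real_mult[symmetric] exp_add[symmetric] by (simp only:)
    qed
    finally have "(\<lambda>k. char (distr M borel (G k)) t) \<longlonglongrightarrow> char (normal_law 0 (\<delta> * ?v + (1 - \<delta>) * ?u)) t"
      unfolding G_def[abs_def] char_fluct_sum[OF ind] .
    from char_tendsto_of_conv0[OF T_meas G_meas d this]
    show "(\<lambda>k. char (distr M borel (\<lambda>w. T k w)) t) \<longlonglongrightarrow> char (normal_law 0 (\<delta> * ?v + (1 - \<delta>) * ?u)) t" .
  qed
qed

end

text \<open>Given potentials agree with a normalised solution only on the support and up to a
  constant; the variance is blind to both differences.\<close>

lemma variance_shift_on_support:
  assumes g: "pmf_integrable p g" and eq: "\<And>x. x \<in> set_pmf p \<Longrightarrow> f x = g x + (t :: real)"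
  shows "pmf_var p f = pmf_var p g"
proof -
  have "pmf_mean p f = pmf_mean p (\<lambda>x. g x + t)"
    by (intro integral_cong_AE) (auto simp: AE_measure_pmf_iff eq)
  also have "\<dots> = pmf_mean p g + t" using g by simp
  finally have m: "pmf_mean p f = pmf_mean p g + t" .
  show ?thesis
    unfolding m by (intro integral_cong_AE) (auto simp: AE_measure_pmf_iff eq)
qed

lemma (in erot_costs) potentials_square_integrable:
  assumes r: "pmf_integrable r WX" and s: "pmf_integrable s WY" and S: "schr r s \<alpha> \<beta>"
  shows "pmf_integrable r (\<lambda>x. (CX x)\<^sup>2) \<Longrightarrow> pmf_integrable r (\<lambda>x. (\<alpha> x)\<^sup>2)"
    and "pmf_integrable s (\<lambda>y. (CY y)\<^sup>2) \<Longrightarrow> pmf_integrable s (\<lambda>y. (\<beta> y)\<^sup>2)"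
proof -
  obtain K where K: "0 \<le> K" "\<And>x. \<bar>\<alpha> x\<bar> \<le> K * CX x" "\<And>y. \<bar>\<beta> y\<bar> \<le> K * CY y"
    by (rule potential_growth[OF r s S]) (rule that)
  have sq: "\<bar>z\<^sup>2\<bar> \<le> K\<^sup>2 * w\<^sup>2" if "\<bar>z\<bar> \<le> K * w" for z w
    using power_mono[OF that abs_ge_zero, of 2] by (simp add: power_mult_distrib)
  show "pmf_integrable r (\<lambda>x. (\<alpha> x)\<^sup>2)" if "pmf_integrable r (\<lambda>x. (CX x)\<^sup>2)"
    by (rule integrable_measure_pmf_bound[OF integrable_mult_right[OF that] sq[OF K(2)]])
  show "pmf_integrable s (\<lambda>y. (\<beta> y)\<^sup>2)" if "pmf_integrable s (\<lambda>y. (CY y)\<^sup>2)"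
    by (rule integrable_measure_pmf_bound[OF integrable_mult_right[OF that] sq[OF K(3)]])
qed

theorem theorem3p2:
  fixes lam :: real
    and c :: "'x::countable \<Rightarrow> 'y::countable \<Rightarrow> real"
    and cX_lo cX_hi dX_lo dX_hi :: "'x \<Rightarrow> real"
    and cY_lo cY_hi dY_lo dY_hi :: "'y \<Rightarrow> real"
    and r :: "'x pmf" and s :: "'y pmf"
    and \<alpha> :: "'x \<Rightarrow> real" and \<beta> :: "'y \<Rightarrow> real"
    and M :: "'w measure"
    and X :: "nat \<Rightarrow> 'w \<Rightarrow> 'x"
  assumes "lam > 0"
    and "dominating c cX_lo cX_hi cY_lo cY_hi"
    and "dominating c dX_lo dX_hi dY_lo dY_hi"
    and "EROT_potentials lam c r s \<alpha> \<beta>"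
    and "prob_space M"
    and "iid_sample M r X"
  shows
    "((\<lambda>x. weight_C cX_lo cX_hi x * sqrt (pmf r x)
          + ((weight_C dX_lo dX_hi x)\<^sup>2 + (weight_phi lam dX_lo dX_hi x)\<^sup>2) * pmf r x)
        summable_on UNIV \<and>
      (\<lambda>y. (weight_C cY_lo cY_hi y + weight_C dY_lo dY_hi y + weight_phi lam cY_lo cY_hi y)
          * pmf s y) summable_on UNIV
      \<longrightarrow> weak_conv_m
          (\<lambda>k. distr M borel (\<lambda>w. sqrt (real k) *
             (real_of_ereal (EROT lam c (empirical X k w) s) - real_of_ereal (EROT lam c r s))))
          (normal_law 0 (measure_pmf.variance r \<alpha>)))
     \<and>
     (\<forall>(Y :: nat \<Rightarrow> 'w \<Rightarrow> 'y) (n :: nat \<Rightarrow> nat) (m :: nat \<Rightarrow> nat) (\<delta> :: real).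
      iid_sample M s Y \<and>
      indep_samples M X Y \<and>
      (\<lambda>x. weight_C cX_lo cX_hi x * sqrt (pmf r x)
          + ((weight_C dX_lo dX_hi x)\<^sup>2 + (weight_phi lam dX_lo dX_hi x)\<^sup>2) * pmf r x)
        summable_on UNIV \<and>
      (\<lambda>y. weight_C dY_lo dY_hi y * sqrt (pmf s y)
          + ((weight_C cY_lo cY_hi y)\<^sup>2 + (weight_phi lam cY_lo cY_hi y)\<^sup>2) * pmf s y)
        summable_on UNIV \<and>
      filterlim (\<lambda>k. min (m k) (n k)) at_top sequentially \<and>
      (\<lambda>k. real (m k) / real (m k + n k)) \<longlonglongrightarrow> \<delta> \<and>
      0 < \<delta> \<and> \<delta> < 1
      \<longrightarrow> weak_conv_m
          (\<lambda>k. distr M borel (\<lambda>w. sqrt (real (n k * m k) / real (n k + m k)) *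
             (real_of_ereal (EROT lam c (empirical X (n k) w) (empirical Y (m k) w))
              - real_of_ereal (EROT lam c r s))))
          (normal_law 0 (\<delta> * measure_pmf.variance r \<alpha> + (1 - \<delta>) * measure_pmf.variance s \<beta>)))"
proof -
  interpret E: erot_costs lam c cX_lo cX_hi dX_lo dX_hi cY_lo cY_hi dY_lo dY_hi
    using assms(1-3) by unfold_locales
  interpret P: prob_space M by fact
  let ?x0 = "undefined :: 'x"
  have dX: "dX_lo x \<le> dX_hi x" and cY: "cY_lo y \<le> cY_hi y" for x y
    using assms(2,3) by (auto simp: dominating_def)
  \<comment> \<open>The arbitrary maximising pair is exchanged for a solution valid everywhere and
    normalised at \<open>?x0\<close>. The shift enters the two potentials with opposite signs, and
    both variances stay the same.\<close>
  have potentials: "\<exists>a b. schroedinger lam c r s a b \<and> a ?x0 = 0 \<and>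
      pmf_var r \<alpha> = pmf_var r a \<and> pmf_var s \<beta> = pmf_var s b"
    if r: "pmf_integrable r E.WX" and s: "pmf_integrable s E.WY"
  proof -
    obtain a b where ab: "\<And>x. x \<in> set_pmf r \<Longrightarrow> a x = \<alpha> x" "\<And>y. y \<in> set_pmf s \<Longrightarrow> b y = \<beta> y" "schroedinger lam c r s a b"
      by (rule E.schroedinger_of_potentials[OF r s assms(4)]) (rule that)
    let ?a = "\<lambda>x. a x - a ?x0" and ?b = "\<lambda>y. b y + a ?x0"
    have S: "schroedinger lam c r s ?a ?b" by (rule schroedinger_shift[OF ab(3)])
    note int = E.potentials_integrable[OF r s S]
    show ?thesis
      by (intro exI[of _ ?a] exI[of _ ?b] conjI S variance_shift_on_support[where t="a ?x0"] variance_shift_on_support[where t="- a ?x0"]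
          int r s) (simp_all add: ab(1,2))
  qed
  show ?thesis
  proof (intro conjI allI impI; elim conjE)
    assume condX: "(\<lambda>x. weight_C cX_lo cX_hi x * sqrt (pmf r x)
          + ((weight_C dX_lo dX_hi x)\<^sup>2 + (weight_phi lam dX_lo dX_hi x)\<^sup>2) * pmf r x) summable_on UNIV"
      and condY: "(\<lambda>y. (weight_C cY_lo cY_hi y + weight_C dY_lo dY_hi y + weight_phi lam cY_lo cY_hi y) * pmf s y) summable_on UNIV"
    note mX = weight_moments[OF condX assms(1) dX]
    have r: "pmf_integrable r E.WX" using mX(1) by (simp add: E.WX_def[abs_def])
    have s: "pmf_integrable s E.WY"
      unfolding integrable_measure_pmf_iff
    proof (rule integrable_count_space_of_summable[OF condY])
      fix y
      have "0 \<le> pmf s y * E.WY y" using E.WY_ge(4) by (intro mult_nonneg_nonneg) auto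
      then show "\<bar>pmf s y * E.WY y\<bar> \<le> (weight_C cY_lo cY_hi y + weight_C dY_lo dY_hi y + weight_phi lam cY_lo cY_hi y) * pmf s y"
        by (simp add: E.WY_def mult.commute)
    qed
    obtain a b where ab: "schroedinger lam c r s a b" "a ?x0 = 0" "pmf_var r \<alpha> = pmf_var r a"
      using potentials[OF r s] by blast
    interpret S: erot_sample lam c cX_lo cX_hi dX_lo dX_hi cY_lo cY_hi dY_lo dY_hi M r s X a b
      by unfold_locales (use assms(6) r s ab(1) mX(2) in auto)
    show "weak_conv_m
          (\<lambda>k. distr M borel (\<lambda>w. sqrt (real k) *
             (real_of_ereal (EROT lam c (empirical X k w) s) - real_of_ereal (EROT lam c r s))))
          (normal_law 0 (pmf_var r \<alpha>))"
      using S.one_sample_limit[OF ab(2) E.potentials_square_integrable(1)[OF r s ab(1) mX(3)]]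
      unfolding ab(3) .
  next
    fix Y :: "nat \<Rightarrow> 'w \<Rightarrow> 'y" and n m :: "nat \<Rightarrow> nat" and \<delta> :: real
    assume Y: "iid_sample M s Y" and ind: "indep_samples M X Y"
      and condX: "(\<lambda>x. weight_C cX_lo cX_hi x * sqrt (pmf r x)
          + ((weight_C dX_lo dX_hi x)\<^sup>2 + (weight_phi lam dX_lo dX_hi x)\<^sup>2) * pmf r x) summable_on UNIV"
      and condY: "(\<lambda>y. weight_C dY_lo dY_hi y * sqrt (pmf s y)
          + ((weight_C cY_lo cY_hi y)\<^sup>2 + (weight_phi lam cY_lo cY_hi y)\<^sup>2) * pmf s y) summable_on UNIV"
      and min: "filterlim (\<lambda>k. min (m k) (n k)) at_top sequentially"
      and ratio: "(\<lambda>k. real (m k) / real (m k + n k)) \<longlonglongrightarrow> \<delta>" and \<delta>: "0 < \<delta>" "\<delta> < 1"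
    note mX = weight_moments[OF condX assms(1) dX] and mY = weight_moments[OF condY assms(1) cY]
    have r: "pmf_integrable r E.WX" using mX(1) by (simp add: E.WX_def[abs_def])
    have s: "pmf_integrable s E.WY" using mY(1) by (simp add: E.WY_def[abs_def] add.commute add.left_commute)
    obtain a b where ab: "schroedinger lam c r s a b" "a ?x0 = 0" "pmf_var r \<alpha> = pmf_var r a"
        "pmf_var s \<beta> = pmf_var s b"
      using potentials[OF r s] by blast
    interpret S: erot_two_samples lam c cX_lo cX_hi dX_lo dX_hi cY_lo cY_hi dY_lo dY_hi M r s X a b Y
      by unfold_locales (use assms(6) Y r s ab(1) mX(2) mY(2) in auto)
    have n: "filterlim n at_top sequentially" and m: "filterlim m at_top sequentially"
      by (rule filterlim_at_top_mono[OF min], simp)+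
    show "weak_conv_m
          (\<lambda>k. distr M borel (\<lambda>w. sqrt (real (n k * m k) / real (n k + m k)) *
             (real_of_ereal (EROT lam c (empirical X (n k) w) (empirical Y (m k) w))
              - real_of_ereal (EROT lam c r s))))
          (normal_law 0 (\<delta> * pmf_var r \<alpha> + (1 - \<delta>) * pmf_var s \<beta>))"
      using S.two_sample_limit[OF ab(2) E.potentials_square_integrable(1)[OF r s ab(1) mX(3)]
          E.potentials_square_integrable(2)[OF r s ab(1) mY(3)] ind n m ratio \<delta>]
      unfolding ab(3,4) .
  qed
qed

end
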